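(* For $t\in\mathbb{C}/2\pi\mathrm{i}(K+N)\mathbb{Z}$ let $\rho_t:\mathbb{CP}^1\to\mathbb{CP}^1$, $\rho_t(z)=e^{-\frac{Kt}{K+N}}z$. The action $$(\mathcal{E},\varphi)\mapsto(\rho_t^*\mathcal{E},\,e^t\rho_t^*\varphi),\qquad t\in\mathbb{C}/2\pi\mathrm{i}(K+N)\mathbb{Z},$$ maps $\mathcal{C}_{K,N}$ to $\mathcal{C}_{K,N}$; that is, if $(\mathcal{E},\varphi)\in\mathcal{C}_{K,N}$ then $(\rho_t^*\mathcal{E},e^t\rho_t^*\varphi)\in\mathcal{C}_{K,N}$ for every $t$.
   Context: $K\ge 2$ and $N\ge 1$ are coprime integers; $z$ is the standard coordinate on $\mathbb{C}\subset\mathbb{CP}^1$. Filtered bundles. A filtered rank $K$ bundle on $(\mathbb{CP}^1,\{\infty\})$ is a locally free $\mathcal{O}_{\mathbb{CP}^1}( *\{\infty\})$-module $\mathcal{E}$ of rank $K$ (where $\mathcal{O}_{\mathbb{CP}^1}( *\{\infty\})$ is the sheaf of meromorphic functions with poles only at $\infty$) with an increasing filtration by locally free $\mathcal{O}_{\mathbb{CP}^1}$-submodules $\mathcal{P}_\alpha\mathcal{E}$, $\alpha\in\mathbb{R}$, such that $\mathcal{P}_\alpha\mathcal{E}|_{\mathbb{C}}=\mathcal{E}|_{\mathbb{C}}$, $\mathcal{P}_\alpha\mathcal{E}=\bigcap_{\beta>\alpha}\mathcal{P}_\beta\mathcal{E}$, and near $\infty$, with $x=1/z$, $\mathcal{P}_{\alpha-1}\mathcal{E}=x\,\mathcal{P}_\alpha\mathcal{E}$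 (similarly over a disc with a marked point). For a section $s$ near $\infty$, its order is $\nu_\infty(s)=\inf\{\alpha: s\in\mathcal{P}_\alpha\mathcal{E}\}$. Direct sums and tensor products are filtered by $\mathcal{P}_\alpha(\mathcal{E}\oplus\mathcal{E}')=\mathcal{P}_\alpha\mathcal{E}\oplus\mathcal{P}_\alpha\mathcal{E}'$, $\mathcal{P}_\alpha(\mathcal{E}\otimes\mathcal{E}')=\sum_{\beta+\gamma=\alpha}\mathcal{P}_\beta\mathcal{E}\otimes\mathcal{P}_\gamma\mathcal{E}'$, and exterior powers as subbundles of tensor powers. A filtered $SL(K)$-bundle is a filtered rank $K$ bundle with a global section $\omega$ of $\wedge^K\mathcal{E}$ trivializing it on $\mathbb{C}$, with $\nu_\infty(\omega)=0$. A filtered $SL(K)$-Higgs bundle is a pair $(\mathcal{E},\varphi)$ with $\mathcal{E}$ a filtered $SL(K)$-bundle and $\varphi$ a traceless meromorphic section of $\operatorname{End}\mathcal{E}\otimes K_{\mathbb{CP}^1}$, holomorphic on $\mathbb{C}$. The category $\mathcal{C}_{K,N}$. Objects are filtered $SL(K)$-Higgs bundles $(\mathcal{E},\varphi)$ such that, for a disc $U$ around $\infty$ with coordinate $x=1/z$ and the ramified covering $\psi:\widetilde U\to U$, $x=u^{2K}$, with $\psi^*\mathcal{E}$ given its natural filtration (for which $\nu_{u=0}(\psi^*s)=2K\,\nu_\infty(s)$), there is a decomposition of filtered bundles $\psi^*\mathcal{E}=\bigoplus_{r=1}^K\mathcal{L}_r$ into filtered line bundles preserved by $\psi^*\varphi$,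 each $\mathcal{L}_r$ being equivalent to an ordinary line bundle with the standard filtration by pole order at $u=0$, and such that the restriction $\varphi_r$ of $\psi^*\varphi$ to $\mathcal{L}_r$ satisfies $(\varphi_r-d\mathfrak{a}_r)(\mathcal{P}_\alpha\mathcal{L}_r)\subset\mathcal{P}_{\alpha+1}\mathcal{L}_r\otimes K_{\widetilde U}$ for all $\alpha$, with $\mathfrak{a}_r=\frac{K}{K+N}e^{2\pi\mathrm{i}r/K}u^{-2(N+K)}$. Equivalently: there is a trivialization $g:\psi^*\mathcal{E}\to\mathcal{O}_{\widetilde U}^{\oplus K}$, inducing the filtration from the standard pole-order filtration, with $g(\psi^*\varphi)g^{-1}=-2K\operatorname{diag}(e^{2\pi\mathrm{i}/K},e^{4\pi\mathrm{i}/K},\dots,1)\frac{du}{u^{2K+2N+1}}+(\text{holomorphic in }u)$. Morphisms are isomorphisms of filtered bundles preserving the Higgs fields. *)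

theory Defs
  imports "HOL-Complex_Analysis.Complex_Analysis" "HOL-Algebra.Module"
    "HOL-Combinatorics.Permutations"
begin

section \<open>The Riemann sphere and its functions\<close>

text \<open>The sphere is the one-point compactification of \<open>\<complex>\<close>: \<open>Some z\<close> is the point with standard
  coordinate \<open>z\<close>, and \<open>None\<close> is the point at infinity, with local coordinate \<open>x = 1/z\<close>.\<close>

type_synonym cset = "complex option set"

definition CP1 :: "complex option topology" where
  "CP1 = Alexandroff_compactification euclidean"

definition fin :: "cset \<Rightarrow> complex set" where
  "fin U = {z. Some z \<in> U}"

text \<open>A section of \<open>\<O>(*\<infinity>)\<close> over \<open>U\<close> is recorded by its values at the finite points of \<open>U\<close>; it is made
  extensional, so that equality of functions is equality of sections.\<close>

definition Omer :: "cset \<Rightarrow> (complex \<Rightarrow> complex) ring" where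
  "Omer U = \<lparr>carrier = {f \<in> extensional (fin U). f holomorphic_on fin U \<and>
                 (None \<in> U \<longrightarrow> (\<lambda>x. f (1 / x)) meromorphic_on {0})},
     mult = (\<lambda>f g. \<lambda>z\<in>fin U. f z * g z), one = (\<lambda>z\<in>fin U. 1),
     zero = (\<lambda>z\<in>fin U. 0), add = (\<lambda>f g. \<lambda>z\<in>fin U. f z + g z)\<rparr>"

definition mer :: "cset \<Rightarrow> (complex \<Rightarrow> complex) set" where
  "mer U = carrier (Omer U)"

text \<open>The pole of \<open>f\<close> at infinity has order at most \<open>n\<close>: near \<open>x = 0\<close> the function \<open>x\<^sup>n f\<close> is
  holomorphic.\<close>

definition pole_le :: "int \<Rightarrow> (complex \<Rightarrow> complex) \<Rightarrow> bool" where
  "pole_le n f \<longleftrightarrow> (\<exists>g. g analytic_on {0} \<and> (\<forall>\<^sub>F x in at 0. x powi n * f (1 / x) = g x))"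

text \<open>The sections of \<open>\<O>\<close>, as a subring of the sections of \<open>\<O>(*\<infinity>)\<close>.\<close>

definition hol :: "cset \<Rightarrow> (complex \<Rightarrow> complex) set" where
  "hol U = {f \<in> mer U. None \<in> U \<longrightarrow> pole_le 0 f}"

section \<open>Filtered bundles\<close>

text \<open>\<open>Sec E U\<close> is the module of sections over \<open>U\<close>, \<open>Res E U V\<close> the restriction map from \<open>U\<close> to \<open>V\<close>,
  and \<open>Fil E \<alpha> U\<close> the set of sections of the \<open>\<alpha>\<close>-th step of the filtration. Only the values on open
  subsets of the base matter. (The record type \<open>module\<close> carries two unused ring fields.)\<close>

record 's fbundle =
  Sec :: "cset \<Rightarrow> (complex \<Rightarrow> complex, 's) module"
  Res :: "cset \<Rightarrow> cset \<Rightarrow> 's \<Rightarrow> 's"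
  Fil :: "real \<Rightarrow> cset \<Rightarrow> 's set"

definition module_sheaf :: "cset \<Rightarrow> 's fbundle \<Rightarrow> bool" where
  "module_sheaf X E \<longleftrightarrow>
    (\<forall>U. openin CP1 U \<and> U \<subseteq> X \<longrightarrow> module (Omer U) (Sec E U)) \<and>
    (\<forall>U V. openin CP1 U \<and> openin CP1 V \<and> V \<subseteq> U \<and> U \<subseteq> X \<longrightarrow>
       Res E U V \<in> carrier (Sec E U) \<rightarrow> carrier (Sec E V) \<and>
       (\<forall>s\<in>carrier (Sec E U). \<forall>t\<in>carrier (Sec E U).
          Res E U V (s \<oplus>\<^bsub>Sec E U\<^esub> t) = Res E U V s \<oplus>\<^bsub>Sec E V\<^esub> Res E U V t) \<and>
       (\<forall>f\<in>mer U. \<forall>s\<in>carrier (Sec E U).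
          Res E U V (f \<odot>\<^bsub>Sec E U\<^esub> s) = restrict f (fin V) \<odot>\<^bsub>Sec E V\<^esub> Res E U V s)) \<and>
    (\<forall>U. openin CP1 U \<and> U \<subseteq> X \<longrightarrow> (\<forall>s\<in>carrier (Sec E U). Res E U U s = s)) \<and>
    (\<forall>U V W. openin CP1 U \<and> openin CP1 V \<and> openin CP1 W \<and> W \<subseteq> V \<and> V \<subseteq> U \<and> U \<subseteq> X \<longrightarrow>
       (\<forall>s\<in>carrier (Sec E U). Res E V W (Res E U V s) = Res E U W s)) \<and>
    (\<forall>\<U> \<sigma>. (\<forall>U\<in>\<U>. openin CP1 U \<and> U \<subseteq> X \<and> \<sigma> U \<in> carrier (Sec E U)) \<and>
       (\<forall>U\<in>\<U>. \<forall>V\<in>\<U>. Res E U (U \<inter> V) (\<sigma> U) = Res E V (U \<inter> V) (\<sigma> V)) \<longrightarrow>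
       (\<exists>!s. s \<in> carrier (Sec E (\<Union>\<U>)) \<and> (\<forall>U\<in>\<U>. Res E (\<Union>\<U>) U s = \<sigma> U)))"

definition lincomb ::
    "'s fbundle \<Rightarrow> nat \<Rightarrow> cset \<Rightarrow> (nat \<Rightarrow> 's) \<Rightarrow> (nat \<Rightarrow> complex \<Rightarrow> complex) \<Rightarrow> 's" where
  "lincomb E K V e c = (\<Oplus>\<^bsub>Sec E V\<^esub>i\<in>{1..K}. c i \<odot>\<^bsub>Sec E V\<^esub> e i)"

text \<open>\<open>e\<^sub>1, \<dots>, e\<^sub>K\<close> is a frame over \<open>U\<close> of the subsheaf \<open>P\<close> of \<open>E\<close>, with coefficients in the sheaf of
  rings \<open>A\<close>; that is, it defines an isomorphism from the sheaf \<open>A\<^sup>K\<close> to \<open>P\<close> over \<open>U\<close>.\<close>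

definition frame_of :: "(cset \<Rightarrow> (complex \<Rightarrow> complex) set) \<Rightarrow> 's fbundle \<Rightarrow> (cset \<Rightarrow> 's set) \<Rightarrow>
    nat \<Rightarrow> cset \<Rightarrow> (nat \<Rightarrow> 's) \<Rightarrow> bool" where
  "frame_of A E P K U e \<longleftrightarrow> (\<forall>i\<in>{1..K}. e i \<in> P U) \<and>
    (\<forall>V. openin CP1 V \<and> V \<subseteq> U \<longrightarrow>
       (\<forall>c\<in>{1..K} \<rightarrow>\<^sub>E A V. lincomb E K V (\<lambda>i. Res E U V (e i)) c \<in> P V) \<and>
       (\<forall>s\<in>P V. \<exists>!c. c \<in> {1..K} \<rightarrow>\<^sub>E A V \<and> s = lincomb E K V (\<lambda>i. Res E U V (e i)) c))"

definition locally_free :: "(cset \<Rightarrow> (complex \<Rightarrow> complex) set) \<Rightarrow> cset \<Rightarrow> nat \<Rightarrow>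
    's fbundle \<Rightarrow> (cset \<Rightarrow> 's set) \<Rightarrow> bool" where
  "locally_free A X K E P \<longleftrightarrow>
    (\<forall>p\<in>X. \<exists>U e. openin CP1 U \<and> p \<in> U \<and> U \<subseteq> X \<and> frame_of A E P K U e)"

definition sections :: "'s fbundle \<Rightarrow> cset \<Rightarrow> 's set" where
  "sections E U = carrier (Sec E U)"

definition frame :: "'s fbundle \<Rightarrow> nat \<Rightarrow> cset \<Rightarrow> (nat \<Rightarrow> 's) \<Rightarrow> bool" where
  "frame E K U e \<longleftrightarrow> frame_of mer E (sections E) K U e"

definition locally_free_O_submodule ::
    "cset \<Rightarrow> nat \<Rightarrow> 's fbundle \<Rightarrow> (cset \<Rightarrow> 's set) \<Rightarrow> bool" where
  "locally_free_O_submodule X K E P \<longleftrightarrow>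
    (\<forall>U. openin CP1 U \<and> U \<subseteq> X \<longrightarrow>
       P U \<subseteq> sections E U \<and> \<zero>\<^bsub>Sec E U\<^esub> \<in> P U \<and>
       (\<forall>s\<in>P U. \<forall>t\<in>P U. s \<oplus>\<^bsub>Sec E U\<^esub> t \<in> P U) \<and>
       (\<forall>f\<in>hol U. \<forall>s\<in>P U. f \<odot>\<^bsub>Sec E U\<^esub> s \<in> P U)) \<and>
    (\<forall>U V. openin CP1 U \<and> openin CP1 V \<and> V \<subseteq> U \<and> U \<subseteq> X \<longrightarrow> (\<forall>s\<in>P U. Res E U V s \<in> P V)) \<and>
    (\<forall>\<U>. (\<forall>U\<in>\<U>. openin CP1 U \<and> U \<subseteq> X) \<longrightarrow>
       (\<forall>s\<in>sections E (\<Union>\<U>). (\<forall>U\<in>\<U>. Res E (\<Union>\<U>) U s \<in> P U) \<longrightarrow> s \<in> P (\<Union>\<U>))) \<and>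
    locally_free hol X K E P"

text \<open>A filtered bundle of rank \<open>K\<close> on an open set \<open>X\<close>, with marked point infinity. The base \<open>X\<close> is
  the whole sphere or a disc around infinity. The relation between \<open>\<P>\<^bsub>\<alpha>-1\<^esub>\<close> and \<open>\<P>\<^sub>\<alpha>\<close> is imposed where
  \<open>x = 1/z\<close> is defined.\<close>

definition filtered_bundle :: "cset \<Rightarrow> nat \<Rightarrow> 's fbundle \<Rightarrow> bool" where
  "filtered_bundle X K E \<longleftrightarrow> module_sheaf X E \<and> locally_free mer X K E (sections E) \<and>
    (\<forall>\<alpha>. locally_free_O_submodule X K E (Fil E \<alpha>)) \<and>
    (\<forall>U. openin CP1 U \<and> U \<subseteq> X \<longrightarrow>
       (\<forall>\<alpha> \<beta>. \<alpha> \<le> \<beta> \<longrightarrow> Fil E \<alpha> U \<subseteq> Fil E \<beta> U) \<and>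
       (None \<notin> U \<longrightarrow> (\<forall>\<alpha>. Fil E \<alpha> U = sections E U)) \<and>
       (\<forall>\<alpha>. Fil E \<alpha> U = (\<Inter>\<beta>\<in>{\<alpha><..}. Fil E \<beta> U)) \<and>
       (Some 0 \<notin> U \<longrightarrow> (\<forall>\<alpha>. Fil E (\<alpha> - 1) U =
          (\<lambda>s. (\<lambda>z\<in>fin U. 1 / z) \<odot>\<^bsub>Sec E U\<^esub> s) ` Fil E \<alpha> U)))"

text \<open>Coordinates of a section over \<open>V\<close> in a frame over \<open>V\<close>.\<close>

definition coord ::
    "'s fbundle \<Rightarrow> nat \<Rightarrow> cset \<Rightarrow> (nat \<Rightarrow> 's) \<Rightarrow> 's \<Rightarrow> nat \<Rightarrow> complex \<Rightarrow> complex" where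
  "coord E K V e s = (THE c. c \<in> {1..K} \<rightarrow>\<^sub>E mer V \<and> s = lincomb E K V e c)"

section \<open>Tensor powers, exterior powers, and filtered SL(K)-bundles\<close>

text \<open>A section \<open>T\<close> of the \<open>K\<close>-fold tensor power of \<open>E\<close> is given by its coefficients in all local
  frames: \<open>T V e I\<close> is the coefficient of \<open>e\<^bsub>I 1\<^esub> \<otimes> \<dots> \<otimes> e\<^bsub>I K\<^esub>\<close>.\<close>

type_synonym 's tensor = "cset \<Rightarrow> (nat \<Rightarrow> 's) \<Rightarrow> (nat \<Rightarrow> nat) \<Rightarrow> complex \<Rightarrow> complex"

abbreviation multi :: "nat \<Rightarrow> (nat \<Rightarrow> nat) set" where
  "multi K \<equiv> {1..K} \<rightarrow>\<^sub>E {1..K}"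

definition tensor_section :: "'s fbundle \<Rightarrow> nat \<Rightarrow> cset \<Rightarrow> 's tensor \<Rightarrow> bool" where
  "tensor_section E K U T \<longleftrightarrow>
    (\<forall>V e. openin CP1 V \<and> V \<subseteq> U \<and> frame E K V e \<longrightarrow>
       (\<forall>I\<in>multi K. T V e I \<in> mer V) \<and>
       (\<forall>W. openin CP1 W \<and> W \<subseteq> V \<longrightarrow>
          (\<forall>I\<in>multi K. T W (\<lambda>i. Res E V W (e i)) I = restrict (T V e I) (fin W))) \<and>
       (\<forall>e'. frame E K V e' \<longrightarrow> (\<forall>I\<in>multi K. \<forall>z\<in>fin V.
          T V e I z = (\<Sum>J\<in>multi K. (\<Prod>i\<in>{1..K}. coord E K V e (e' (J i)) (I i) z) * T V e' J z))))"

text \<open>The top exterior power consists of the antisymmetric tensors.\<close>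

definition wedge_section :: "'s fbundle \<Rightarrow> nat \<Rightarrow> cset \<Rightarrow> 's tensor \<Rightarrow> bool" where
  "wedge_section E K U T \<longleftrightarrow> tensor_section E K U T \<and>
    (\<forall>V e. openin CP1 V \<and> V \<subseteq> U \<and> frame E K V e \<longrightarrow>
       (\<forall>\<pi>. \<pi> permutes {1..K} \<longrightarrow> (\<forall>I\<in>multi K. \<forall>z\<in>fin V.
          T V e (I \<circ> \<pi>) z = of_int (sign \<pi>) * T V e I z)))"

text \<open>The germ of \<open>T\<close> at infinity lies in \<open>\<P>\<^sub>\<alpha>\<close> of the tensor power, which is the sum of the
  \<open>\<P>\<^bsub>\<beta>1\<^esub>E \<otimes> \<dots> \<otimes> \<P>\<^bsub>\<beta>K\<^esub>E\<close> over \<open>\<beta>\<^sub>1 + \<dots> + \<beta>\<^sub>K = \<alpha>\<close>.\<close>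

definition tensor_Fil :: "'s fbundle \<Rightarrow> nat \<Rightarrow> real \<Rightarrow> 's tensor \<Rightarrow> bool" where
  "tensor_Fil E K \<alpha> T \<longleftrightarrow>
    (\<exists>V (m::nat) \<beta> s. openin CP1 V \<and> None \<in> V \<and>
       (\<forall>j<m. (\<Sum>i\<in>{1..K}. \<beta> j i) = \<alpha> \<and> (\<forall>i\<in>{1..K}. s j i \<in> Fil E (\<beta> j i) V)) \<and>
       (\<forall>W e. openin CP1 W \<and> W \<subseteq> V \<and> frame E K W e \<longrightarrow>
          (\<forall>I\<in>multi K. \<forall>z\<in>fin W.
             T W e I z = (\<Sum>j<m. \<Prod>i\<in>{1..K}. coord E K W e (Res E V W (s j i)) (I i) z))))"

definition tensor_order :: "'s fbundle \<Rightarrow> nat \<Rightarrow> 's tensor \<Rightarrow> ereal" where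
  "tensor_order E K T = Inf (ereal ` {\<alpha>. tensor_Fil E K \<alpha> T})"

definition trivializes_on_C :: "'s fbundle \<Rightarrow> nat \<Rightarrow> 's tensor \<Rightarrow> bool" where
  "trivializes_on_C E K \<omega> \<longleftrightarrow>
    (\<forall>U \<eta>. openin CP1 U \<and> None \<notin> U \<and> wedge_section E K U \<eta> \<longrightarrow>
       (\<exists>!f. f \<in> mer U \<and> (\<forall>V e. openin CP1 V \<and> V \<subseteq> U \<and> frame E K V e \<longrightarrow>
          (\<forall>I\<in>multi K. \<forall>z\<in>fin V. \<eta> V e I z = f z * \<omega> V e I z))))"

definition filtered_SL_bundle :: "nat \<Rightarrow> 's fbundle \<Rightarrow> 's tensor \<Rightarrow> bool" where
  "filtered_SL_bundle K E \<omega> \<longleftrightarrow> filtered_bundle UNIV K E \<and> wedge_section E K UNIV \<omega> \<and>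
     trivializes_on_C E K \<omega> \<and> tensor_order E K \<omega> = 0"

section \<open>Higgs fields\<close>

text \<open>Since \<open>dz\<close> generates the canonical sheaf over \<open>\<O>(*\<infinity>)\<close>, a meromorphic section of
  \<open>End E \<otimes> K\<close> that is holomorphic on \<open>\<complex>\<close> is uniquely \<open>\<phi> = \<Phi> dz\<close> with \<open>\<Phi>\<close> an \<open>\<O>(*\<infinity>)\<close>-linear
  endomorphism of the sheaf \<open>E\<close>. A Higgs field is recorded by this \<open>\<Phi>\<close>.\<close>

type_synonym 's higgs = "cset \<Rightarrow> 's \<Rightarrow> 's"

definition higgs_field :: "'s fbundle \<Rightarrow> 's higgs \<Rightarrow> bool" where
  "higgs_field E \<Phi> \<longleftrightarrow>
    (\<forall>U. openin CP1 U \<longrightarrow> \<Phi> U \<in> sections E U \<rightarrow> sections E U \<and>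
       (\<forall>s\<in>sections E U. \<forall>t\<in>sections E U. \<Phi> U (s \<oplus>\<^bsub>Sec E U\<^esub> t) = \<Phi> U s \<oplus>\<^bsub>Sec E U\<^esub> \<Phi> U t) \<and>
       (\<forall>f\<in>mer U. \<forall>s\<in>sections E U. \<Phi> U (f \<odot>\<^bsub>Sec E U\<^esub> s) = f \<odot>\<^bsub>Sec E U\<^esub> \<Phi> U s)) \<and>
    (\<forall>U V. openin CP1 U \<and> openin CP1 V \<and> V \<subseteq> U \<longrightarrow>
       (\<forall>s\<in>sections E U. Res E U V (\<Phi> U s) = \<Phi> V (Res E U V s)))"

definition traceless :: "'s fbundle \<Rightarrow> nat \<Rightarrow> 's higgs \<Rightarrow> bool" where
  "traceless E K \<Phi> \<longleftrightarrow>
    (\<forall>V e. openin CP1 V \<and> frame E K V e \<longrightarrow>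
       (\<forall>z\<in>fin V. (\<Sum>i\<in>{1..K}. coord E K V e (\<Phi> V (e i)) i z) = 0))"

definition filtered_SL_Higgs_bundle ::
    "nat \<Rightarrow> 's fbundle \<times> 's tensor \<times> 's higgs \<Rightarrow> bool" where
  "filtered_SL_Higgs_bundle K = (\<lambda>(E, \<omega>, \<Phi>).
     filtered_SL_bundle K E \<omega> \<and> higgs_field E \<Phi> \<and> traceless E K \<Phi>)"

section \<open>The ramified covering near infinity\<close>

definition disc :: "real \<Rightarrow> cset" where
  "disc R = insert None (Some ` {z. R < norm z})"

text \<open>The covering surface is a disc around infinity in a second sphere, with standard coordinate
  \<open>w\<close>; the coordinate at its marked point is \<open>u = 1/w\<close>, so that \<open>x = u\<^sup>n\<close> reads \<open>z = w\<^sup>n\<close>.\<close>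

definition covering :: "nat \<Rightarrow> complex option \<Rightarrow> complex option" where
  "covering n = map_option (\<lambda>w. w ^ n)"

text \<open>The pullback under \<open>covering n\<close> of the restriction of \<open>E\<close> to \<open>U\<close>, where \<open>e\<close> is a frame of \<open>E\<close>
  over \<open>U\<close>: it is the free module on \<open>\<psi>\<^sup>* e\<^sub>1, \<dots>, \<psi>\<^sup>* e\<^sub>K\<close>, and its sections are recorded by their
  coordinates in this frame. The natural filtration is generated by the products \<open>f \<psi>\<^sup>* s\<close> with
  \<open>s\<close> in \<open>\<P>\<^sub>\<beta>E\<close> and \<open>f\<close> of pole order at most \<open>k\<close>, where \<open>n \<beta> + k \<le> \<alpha>\<close>.\<close>

definition cover_pullback ::
    "'s fbundle \<Rightarrow> nat \<Rightarrow> nat \<Rightarrow> cset \<Rightarrow> (nat \<Rightarrow> 's) \<Rightarrow> (nat \<Rightarrow> complex \<Rightarrow> complex) fbundle" where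
  "cover_pullback E K n U e = \<lparr>
     Sec = (\<lambda>W. \<lparr>carrier = {1..K} \<rightarrow>\<^sub>E mer W, mult = undefined, one = undefined,
        zero = (\<lambda>i\<in>{1..K}. \<lambda>w\<in>fin W. 0),
        add = (\<lambda>\<sigma> \<tau>. \<lambda>i\<in>{1..K}. \<lambda>w\<in>fin W. \<sigma> i w + \<tau> i w),
        smult = (\<lambda>f \<sigma>. \<lambda>i\<in>{1..K}. \<lambda>w\<in>fin W. f w * \<sigma> i w)\<rparr>),
     Res = (\<lambda>W W' \<sigma>. \<lambda>i\<in>{1..K}. restrict (\<sigma> i) (fin W')),
     Fil = (\<lambda>\<alpha> W. {\<sigma> \<in> {1..K} \<rightarrow>\<^sub>E mer W. None \<in> W \<longrightarrow>
        (\<exists>W' V (m::nat) \<beta> k f s. openin CP1 W' \<and> None \<in> W' \<and> W' \<subseteq> W \<and>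
           openin CP1 V \<and> V \<subseteq> U \<and> W' \<subseteq> covering n -` V \<and>
           (\<forall>j<m. s j \<in> Fil E (\<beta> j) V \<and> f j \<in> mer W' \<and> pole_le (k j) (f j) \<and>
              real n * \<beta> j + of_int (k j) \<le> \<alpha>) \<and>
           (\<forall>i\<in>{1..K}. \<forall>w\<in>fin W'.
              \<sigma> i w = (\<Sum>j<m. f j w * coord E K V (\<lambda>i. Res E U V (e i)) (s j) i (w ^ n))))})\<rparr>"

text \<open>The coefficient of \<open>du\<close> in \<open>\<psi>\<^sup>*\<phi>\<close>, applied to a section; here \<open>\<phi> = \<Phi> dz\<close> and
  \<open>z = u\<^bsup>-n\<^esup>\<close>. As \<open>du\<close> generates the canonical sheaf of the covering disc, sections of
  \<open>F \<otimes> K\<close> are identified with sections of \<open>F\<close> through it.\<close>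

definition cover_higgs :: "'s fbundle \<Rightarrow> nat \<Rightarrow> nat \<Rightarrow> cset \<Rightarrow> (nat \<Rightarrow> 's) \<Rightarrow> 's higgs \<Rightarrow>
    (nat \<Rightarrow> complex \<Rightarrow> complex) higgs" where
  "cover_higgs E K n U e \<Phi> W \<sigma> = (\<lambda>i\<in>{1..K}. \<lambda>w\<in>fin W.
     deriv (\<lambda>u. 1 / u ^ n) (1 / w) *
     (\<Sum>j\<in>{1..K}. coord E K U e (\<Phi> U (e j)) i (w ^ n) * \<sigma> j w))"

text \<open>The function \<open>\<aa>\<^sub>r\<close> of the coordinate \<open>u\<close>.\<close>

definition polar :: "nat \<Rightarrow> nat \<Rightarrow> nat \<Rightarrow> complex \<Rightarrow> complex" where
  "polar K N r u = of_nat K / of_nat (K + N) * exp (2 * of_real pi * \<i> * of_nat r / of_nat K) *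
     u powi (- (2 * (int N + int K)))"

definition subbundle ::
    "'s fbundle \<Rightarrow> (cset \<Rightarrow> 's set) \<Rightarrow> (real \<Rightarrow> cset \<Rightarrow> 's set) \<Rightarrow> 's fbundle" where
  "subbundle F A B = F\<lparr>Sec := (\<lambda>W. (Sec F W)\<lparr>carrier := A W\<rparr>), Fil := B\<rparr>"

text \<open>The filtered bundles \<open>(A r, B r)\<close>, for \<open>r = 1, \<dots>, K\<close>, decompose \<open>F\<close> as a filtered bundle.\<close>

definition filtered_decomposition :: "cset \<Rightarrow> 's fbundle \<Rightarrow> nat \<Rightarrow>
    (nat \<Rightarrow> cset \<Rightarrow> 's set) \<Rightarrow> (nat \<Rightarrow> real \<Rightarrow> cset \<Rightarrow> 's set) \<Rightarrow> bool" where
  "filtered_decomposition X F K A B \<longleftrightarrow>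
    (\<forall>W. openin CP1 W \<and> W \<subseteq> X \<longrightarrow>
       (\<forall>r\<in>{1..K}. A r W \<subseteq> sections F W) \<and>
       (\<forall>\<sigma>\<in>sections F W. \<exists>!\<tau>. \<tau> \<in> (\<Pi>\<^sub>E r\<in>{1..K}. A r W) \<and> \<sigma> = finsum (Sec F W) \<tau> {1..K}) \<and>
       (\<forall>\<alpha>. Fil F \<alpha> W = {finsum (Sec F W) \<tau> {1..K} | \<tau>. \<tau> \<in> (\<Pi>\<^sub>E r\<in>{1..K}. B r \<alpha> W)}))"

text \<open>The filtration of the line bundle \<open>L\<close> is the filtration by pole order at infinity (in the
  coordinate \<open>u = 1/w\<close>) that comes from an ordinary line bundle \<open>M\<close>, with \<open>L = M(*\<infinity>)\<close>.\<close>

definition standard_line_filtration :: "cset \<Rightarrow> 's fbundle \<Rightarrow> bool" where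
  "standard_line_filtration X L \<longleftrightarrow>
    (\<exists>M. locally_free_O_submodule X 1 L M \<and>
      (\<forall>W. openin CP1 W \<and> W \<subseteq> X \<longrightarrow>
         (None \<notin> W \<longrightarrow> M W = sections L W) \<and>
         (\<forall>\<alpha>. Fil L \<alpha> W = {s \<in> sections L W. None \<in> W \<longrightarrow>
            (\<exists>W' m f. openin CP1 W' \<and> None \<in> W' \<and> W' \<subseteq> W \<and> m \<in> M W' \<and> f \<in> mer W' \<and>
               pole_le \<lfloor>\<alpha>\<rfloor> f \<and> Res L W W' s = f \<odot>\<^bsub>Sec L W'\<^esub> m)})))"

text \<open>The disc can be chosen so small that \<open>E\<close> has a frame over it; the condition does not depend on
  the frame, since two frames give isomorphic pullbacks.\<close>

definition irregular_type :: "nat \<Rightarrow> nat \<Rightarrow> 's fbundle \<Rightarrow> 's higgs \<Rightarrow> bool" where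
  "irregular_type K N E \<Phi> \<longleftrightarrow>
    (\<exists>R>0. \<exists>e. frame E K (disc R) e \<and>
      (let X = covering (2 * K) -` disc R;
           F = cover_pullback E K (2 * K) (disc R) e;
           \<Psi> = cover_higgs E K (2 * K) (disc R) e \<Phi>
       in \<exists>A B. filtered_decomposition X F K A B \<and>
         (\<forall>r\<in>{1..K}.
            filtered_bundle X 1 (subbundle F (A r) (B r)) \<and>
            standard_line_filtration X (subbundle F (A r) (B r)) \<and>
            (\<forall>W. openin CP1 W \<and> W \<subseteq> X \<longrightarrow>
               (\<forall>\<sigma>\<in>A r W. \<Psi> W \<sigma> \<in> A r W) \<and>
               (\<forall>\<alpha>. \<forall>\<sigma>\<in>B r \<alpha> W.
                  (\<lambda>i\<in>{1..K}. \<lambda>w\<in>fin W. \<Psi> W \<sigma> i w - deriv (polar K N r) (1 / w) * \<sigma> i w)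
                    \<in> B r (\<alpha> + 1) W)))))"

text \<open>The objects of the category. An object consists of the filtered bundle, its section \<open>\<omega>\<close> of the
  top exterior power, and its Higgs field.\<close>

definition C_KN :: "nat \<Rightarrow> nat \<Rightarrow> ('s fbundle \<times> 's tensor \<times> 's higgs) set" where
  "C_KN K N = {(E, \<omega>, \<Phi>). filtered_SL_Higgs_bundle K (E, \<omega>, \<Phi>) \<and> irregular_type K N E \<Phi>}"

section \<open>Pullback along automorphisms and the action\<close>

text \<open>Pullback along the automorphism \<open>map_option h\<close> of the sphere, for \<open>h\<close> an affine automorphism of
  \<open>\<complex>\<close>. For an isomorphism \<open>\<rho>\<close> the sections of \<open>\<rho>\<^sup>*E\<close> over \<open>U\<close> are those of \<open>E\<close> over \<open>\<rho>(U)\<close>, and a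
  function \<open>f\<close> acts through \<open>f \<circ> \<rho>\<^bsup>-1\<^esup>\<close>.\<close>

definition pullback :: "(complex \<Rightarrow> complex) \<Rightarrow> 's fbundle \<Rightarrow> 's fbundle" where
  "pullback h E = (let \<rho> = (\<lambda>U. map_option h ` U) in \<lparr>
     Sec = (\<lambda>U. (Sec E (\<rho> U))\<lparr>smult :=
        (\<lambda>f s. (\<lambda>z\<in>fin (\<rho> U). f (inv_into UNIV h z)) \<odot>\<^bsub>Sec E (\<rho> U)\<^esub> s)\<rparr>),
     Res = (\<lambda>U V. Res E (\<rho> U) (\<rho> V)),
     Fil = (\<lambda>\<alpha> U. Fil E \<alpha> (\<rho> U))\<rparr>)"

definition pullback_tensor :: "(complex \<Rightarrow> complex) \<Rightarrow> 's tensor \<Rightarrow> 's tensor" where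
  "pullback_tensor h T = (\<lambda>U e I. \<lambda>z\<in>fin U. T (map_option h ` U) e I (h z))"

text \<open>\<open>\<rho>\<^sup>*(\<Phi> dz) = h' \<rho>\<^sup>*\<Phi> dz\<close>.\<close>

definition pullback_higgs ::
    "(complex \<Rightarrow> complex) \<Rightarrow> 's fbundle \<Rightarrow> 's higgs \<Rightarrow> 's higgs" where
  "pullback_higgs h E \<Phi> = (\<lambda>U s.
     (\<lambda>z\<in>fin U. deriv h z) \<odot>\<^bsub>Sec (pullback h E) U\<^esub> \<Phi> (map_option h ` U) s)"

definition scale_higgs :: "complex \<Rightarrow> 's fbundle \<Rightarrow> 's higgs \<Rightarrow> 's higgs" where
  "scale_higgs c E \<Phi> = (\<lambda>U s. (\<lambda>z\<in>fin U. c) \<odot>\<^bsub>Sec E U\<^esub> \<Phi> U s)"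

text \<open>\<open>\<rho>\<^sub>t\<close> on the finite points; the map of the sphere is \<open>map_option (rho K N t)\<close>.\<close>

definition rho :: "nat \<Rightarrow> nat \<Rightarrow> complex \<Rightarrow> complex \<Rightarrow> complex" where
  "rho K N t z = exp (- (of_nat K * t / of_nat (K + N))) * z"

definition act :: "nat \<Rightarrow> nat \<Rightarrow> complex \<Rightarrow>
    's fbundle \<times> 's tensor \<times> 's higgs \<Rightarrow> 's fbundle \<times> 's tensor \<times> 's higgs" where
  "act K N t = (\<lambda>(E, \<omega>, \<Phi>).
     (pullback (rho K N t) E, pullback_tensor (rho K N t) \<omega>,
      scale_higgs (exp t) (pullback (rho K N t) E) (pullback_higgs (rho K N t) E \<Phi>)))"

end

theory Submission
  imports Defs
begin

text \<open>The action moves the base by the dilation \<open>\<rho>\<^sub>t(z) = c z\<close> with \<open>c = exp (- K t / (K + N))\<close>. An object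
  of \<open>\<C>\<^bsub>K,N\<^esub>\<close> consists of data on the sphere, subject to conditions that are intrinsic, and of a
  normal form at infinity, in which the coordinate occurs explicitly. The two parts have different
  reasons to be preserved.

  The conditions on the sphere (sheaf of modules, local freeness, the filtration, \<open>\<omega>\<close>, linearity and
  tracelessness of \<open>\<phi>\<close>) speak only of sections, restriction maps, functions and filtration steps.
  They therefore pass along every isomorphism of bundles that covers a dilation; the locale
  \<open>bundle_iso\<close> describes such isomorphisms, and the lemmas whose names end in \<open>_transport\<close> or \<open>_iff\<close>
  carry the conditions across. The coordinate is visible in two ways. The relation
  \<open>\<P>\<^bsub>\<alpha>-1\<^esub> = x \<P>\<^sub>\<alpha>\<close> uses \<open>x = 1/z\<close>, which the dilation multiplies by a constant; constants are units
  that preserve every \<open>\<P>\<^sub>\<alpha>\<close>. The Higgs field is \<open>\<Phi> dz\<close>, and pulling back \<open>dz\<close> multiplies \<open>\<Phi>\<close> by a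
  constant, just as \<open>e\<^sup>t\<close> does, which affects neither linearity nor tracelessness.

  At infinity put \<open>z = w\<^bsup>2K\<^esup>\<close>, \<open>u = 1/w\<close>. The dilation by \<open>c\<close> lifts to the covering as the dilation of
  \<open>w\<close> by \<open>d = exp (- t / (2 (K + N)))\<close>, because \<open>d\<^bsup>2K\<^esup> = c\<close>. The polar part \<open>\<aa>\<^sub>r\<close> is a constant times
  \<open>w\<^bsup>2(N+K)\<^esup>\<close>, so the lift multiplies it by \<open>d\<^bsup>2(N+K)\<^esup> = e\<^bsup>-t\<^esup>\<close>, and the factor \<open>e\<^sup>t\<close> of the action
  restores it. Each \<open>\<aa>\<^sub>r\<close> is thus fixed separately, and pulling back the line bundles \<open>\<L>\<^sub>r\<close> along the
  lift, with the same indices, decomposes the new object: this is \<open>irregular_type_pullback\<close>. It uses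
  that the pullback of \<open>\<psi>\<^sup>*\<E>\<close> along the lift is \<open>\<psi>\<^sup>*\<rho>\<^sub>t\<^sup>*\<E>\<close> as a filtered bundle (\<open>cover_iso\<close>) and
  that the Higgs fields correspond (\<open>cover_higgs_push\<close>).

  Replacing \<open>t\<close> by \<open>t + 2 \<pi> \<i> (K + N) m\<close> changes the exponents \<open>t\<close> and \<open>- K t / (K + N)\<close> by multiples of
  \<open>2 \<pi> \<i>\<close>, so the action only depends on the class of \<open>t\<close>.\<close>

section \<open>Dilations of the sphere\<close>

definition dil :: "complex \<Rightarrow> cset \<Rightarrow> cset" where
  "dil c U = map_option ((*) c) ` U"

text \<open>A function on \<open>U\<close> becomes a function on \<open>dil c U\<close> by composition with the inverse dilation. No
  restriction is built in, which makes \<open>push c\<close> a bijection between all functions, so that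
  quantifiers can be exchanged freely; extensional functions stay extensional.\<close>

definition push :: "complex \<Rightarrow> (complex \<Rightarrow> 'a) \<Rightarrow> complex \<Rightarrow> 'a" where
  "push c f = (\<lambda>z. f (z / c))"

locale dilation =
  fixes c :: complex
  assumes nz: "c \<noteq> 0"
begin

lemma inverse_dilation: "dilation (inverse c)"
  using nz by unfold_locales simp

lemma None_dil [simp]: "None \<in> dil c U \<longleftrightarrow> None \<in> U"
  by (auto simp: dil_def image_iff)

lemma Some_dil [simp]: "Some z \<in> dil c U \<longleftrightarrow> Some (z / c) \<in> U"
proof
  assume "Some z \<in> dil c U"
  then show "Some (z / c) \<in> U" using nz by (auto simp: dil_def image_iff map_option_case split: option.splits)
next
  assume "Some (z / c) \<in> U"
  then show "Some z \<in> dil c U" unfolding dil_def using nz by (intro image_eqI[of _ _ "Some (z / c)"]) auto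
qed

lemma fin_dil [simp]: "z \<in> fin (dil c U) \<longleftrightarrow> z / c \<in> fin U"
  by (simp add: fin_def)

lemma dil_inverse [simp]: "dil (inverse c) (dil c U) = U" "dil c (dil (inverse c) U) = U"
  using nz by (simp_all add: dil_def image_image option.map_comp o_def mult.assoc[symmetric] option.map_ident)

lemma push_inverse [simp]: "push (inverse c) (push c f) = f" "push c (push (inverse c) f) = f"
  using nz by (simp_all add: push_def)

lemma dil_subset [simp]: "dil c U \<subseteq> dil c V \<longleftrightarrow> U \<subseteq> V"
  by (metis dil_def dil_inverse(1) image_mono)

lemma dil_UNIV [simp]: "dil c UNIV = UNIV"
  by (metis dil_inverse(2) dil_subset top.extremum_uniqueI top_greatest)

lemma dil_Int: "dil c (U \<inter> V) = dil c U \<inter> dil c V"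
proof (rule Set.set_eqI)
  fix p show "p \<in> dil c (U \<inter> V) \<longleftrightarrow> p \<in> dil c U \<inter> dil c V" by (cases p) auto
qed

lemma dil_Union: "dil c (\<Union>\<U>) = \<Union>(dil c ` \<U>)"
  by (auto simp: dil_def)

lemma all_dil: "(\<forall>U. P U) \<longleftrightarrow> (\<forall>U. P (dil c U))"
  by (metis dil_inverse(2))

lemma ex_dil: "(\<exists>U. P U) \<longleftrightarrow> (\<exists>U. P (dil c U))"
  by (metis dil_inverse(2))

text \<open>Near infinity this holds because the image of a compact set under \<open>z \<mapsto> c z\<close> is compact.\<close>

lemma openin_dil_imp: 
  assumes "openin CP1 U" shows "openin CP1 (dil c U)"
proof -
  have img: "(*) c ` V = (\<lambda>z. z / c) -` V" for V
    using nz by (force simp: image_iff)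
  from assms consider V where "open V" "U = Some ` V" 
    | C where "compact C" "U = insert None (Some ` (UNIV - C))"
    by (auto simp: CP1_def openin_Alexandroff_compactification)
  then show ?thesis
  proof cases
    case 1
    have "dil c U = Some ` ((*) c ` V)" by (auto simp: 1 dil_def image_image)
    moreover have "open ((*) c ` V)" unfolding img
      by (rule open_vimage[OF 1(1)]) (use nz in \<open>auto intro!: continuous_intros\<close>)
    ultimately show ?thesis by (simp add: CP1_def)
  next
    case 2
    have "inj ((*) c)" using nz by (auto intro: injI)
    moreover have "surj ((*) c)" using nz by (intro surjI[of _ "\<lambda>z. z / c"]) simp
    ultimately have "(*) c ` (UNIV - C) = UNIV - (*) c ` C" by (simp add: image_set_diff)
    then have "dil c U = insert None (Some ` (UNIV - (*) c ` C))" 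
      by (simp add: 2 dil_def image_image flip: image_image[of Some "(*) c"])
    moreover have "compact ((*) c ` C)" 
      by (rule compact_continuous_image) (use 2 in \<open>auto intro!: continuous_intros\<close>)
    ultimately show ?thesis 
      by (auto simp: CP1_def openin_Alexandroff_compactification compact_imp_closed)
  qed
qed

lemma openin_dil [simp]: "openin CP1 (dil c U) \<longleftrightarrow> openin CP1 U"
  using openin_dil_imp dilation.openin_dil_imp[OF inverse_dilation] dil_inverse(1) by metis

lemma mer_push_imp:
  assumes "f \<in> mer U" shows "push c f \<in> mer (dil c U)"
proof -
  have f: "f \<in> extensional (fin U)" "f holomorphic_on fin U" 
      "None \<in> U \<Longrightarrow> (\<lambda>x. f (1 / x)) meromorphic_on {0}"
    using assms by (auto simp: mer_def Omer_def)
  have "push c f \<in> extensional (fin (dil c U))" 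
    using f(1) by (auto simp: extensional_def push_def)
  moreover have "push c f holomorphic_on fin (dil c U)"
    unfolding push_def using nz
    by (intro holomorphic_on_compose_gen[OF _ f(2), of "\<lambda>z. z / c", unfolded o_def])
       (auto intro!: holomorphic_intros)
  moreover have "(\<lambda>x. push c f (1 / x)) meromorphic_on {0}" if "None \<in> U"
  proof -
    have "(\<lambda>x. (\<lambda>y. f (1 / y)) (c * x)) meromorphic_on {0}"
      by (rule meromorphic_on_compose[OF f(3)[OF that]]) (auto intro!: analytic_intros)
    then show ?thesis by (simp add: push_def mult.commute)
  qed
  ultimately show ?thesis by (auto simp: mer_def Omer_def)
qed

lemma mer_push [simp]: "push c f \<in> mer (dil c U) \<longleftrightarrow> f \<in> mer U"
  using mer_push_imp dilation.mer_push_imp[OF inverse_dilation] dil_inverse(1) push_inverse(1) by metis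

lemma pole_le_push_imp:
  assumes "pole_le n f" shows "pole_le n (push c f)"
proof -
  obtain g where g: "g analytic_on {0}" "\<forall>\<^sub>F x in at 0. x powi n * f (1 / x) = g x"
    using assms by (auto simp: pole_le_def)
  \<comment> \<open>In the coordinate \<open>x = 1/z\<close> at infinity, \<open>push c f\<close> is \<open>f\<close> read at \<open>c x\<close>.\<close>
  have lim: "filterlim (\<lambda>x. c * x) (at 0) (at 0)"
    using nz by (auto simp: filterlim_at eventually_at_filter intro!: tendsto_eq_intros)
  have "\<forall>\<^sub>F x in at 0. (c * x) powi n * f (1 / (c * x)) = g (c * x)"
    using eventually_compose_filterlim[OF g(2) lim] .
  then have "\<forall>\<^sub>F x in at 0. x powi n * push c f (1 / x) = inverse (c powi n) * g (c * x)"
    by (rule eventually_mono) (use nz in \<open>auto simp: push_def power_int_mult_distrib field_simps\<close>)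
  moreover have "(\<lambda>x. g (c * x)) analytic_on {0}"
    using analytic_on_compose[of "\<lambda>x. c * x" "{0}" g] g(1)
    by (auto simp: o_def intro!: analytic_intros)
  then have "(\<lambda>x. inverse (c powi n) * g (c * x)) analytic_on {0}"
    by (auto intro!: analytic_intros)
  ultimately show ?thesis unfolding pole_le_def by blast
qed

lemma pole_le_push [simp]: "pole_le n (push c f) \<longleftrightarrow> pole_le n f"
  using pole_le_push_imp dilation.pole_le_push_imp[OF inverse_dilation] push_inverse(1) by metis

lemma hol_push [simp]: "push c f \<in> hol (dil c U) \<longleftrightarrow> f \<in> hol U"
  by (simp add: hol_def)

lemma extensional_push [simp]: "push c f \<in> extensional (fin (dil c U)) \<longleftrightarrow> f \<in> extensional (fin U)"
  using nz by (simp add: extensional_def push_def) (metis nonzero_mult_div_cancel_left)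

lemma push_eq [simp]: "push c f = push c g \<longleftrightarrow> f = g"
  by (metis push_inverse(1))

lemma push_restrict: "push c (restrict f (fin U)) = restrict (push c f) (fin (dil c U))"
  by (auto simp: push_def)

lemma ex_push: "(\<exists>f. P f) \<longleftrightarrow> (\<exists>f. P (push c f))"
  by (metis push_inverse(2))

lemma all_fin_dil: "(\<forall>z\<in>fin (dil c V). P z) \<longleftrightarrow> (\<forall>z\<in>fin V. P (c * z))"
proof safe
  fix z assume "\<forall>z\<in>fin V. P (c * z)" "z \<in> fin (dil c V)"
  then have "P (c * (z / c))" by (metis fin_dil)
  then show "P z" using nz by simp
qed (use nz in auto)

lemma push_at [simp]: "push c f (c * z) = f z"
  using nz by (simp add: push_def)

end

section \<open>The rings of functions\<close>

lemma mer_extensional: "f \<in> mer U \<Longrightarrow> f \<in> extensional (fin U)"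
  by (simp add: mer_def Omer_def)

text \<open>A restricted function takes the default value off its domain. The next lemma shows that the
  default value is never seen near an interior point at infinity, so that meromorphy and pole order
  there can be read off the unrestricted formula.\<close>

lemma eventually_fin_at_infinity:
  assumes "openin CP1 U" "None \<in> U" shows "\<forall>\<^sub>F x in at 0. 1 / x \<in> fin U"
proof -
  obtain C where C: "compact C" "U = insert None (Some ` (UNIV - C))"
    using assms by (auto simp: CP1_def openin_Alexandroff_compactification)
  then obtain B where B: "B > 0" "\<And>z. z \<in> C \<Longrightarrow> norm z \<le> B"
    using compact_imp_bounded bounded_pos by metis
  have "\<forall>\<^sub>F x in at 0. x \<noteq> 0 \<and> dist x (0::complex) < 1 / B"
    using B(1) unfolding eventually_at by (intro exI[of _ "1 / B"]) auto
  then show ?thesis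
  proof (rule eventually_mono)
    fix x :: complex assume "x \<noteq> 0 \<and> dist x 0 < 1 / B"
    then have "norm (1 / x) > B" using B(1) by (auto simp: norm_divide field_simps)
    then have "1 / x \<notin> C" using B(2) by force
    then show "1 / x \<in> fin U" by (simp add: C(2) fin_def image_iff)
  qed
qed

lemma restrict_in_mer:
  assumes "openin CP1 U" "f holomorphic_on fin U"
    and "None \<in> U \<Longrightarrow> (\<lambda>x. f (1 / x)) meromorphic_on {0}"
  shows "restrict f (fin U) \<in> mer U"
proof -
  have "(\<lambda>x. restrict f (fin U) (1 / x)) meromorphic_on {0}" if "None \<in> U"
  proof -
    have "\<forall>\<^sub>F x in at 0. restrict f (fin U) (1 / x) = f (1 / x)"
      using eventually_fin_at_infinity[OF assms(1) that] by (rule eventually_mono) simp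
    then have "(\<lambda>x. restrict f (fin U) (1 / x)) meromorphic_on {0} \<longleftrightarrow> (\<lambda>x. f (1 / x)) meromorphic_on {0}"
      by (intro meromorphic_on_cong) auto
    then show ?thesis using assms(3)[OF that] by simp
  qed
  moreover have "restrict f (fin U) holomorphic_on fin U"
    using assms(2) by (rule holomorphic_transform) simp
  ultimately show ?thesis by (simp add: mer_def Omer_def)
qed

lemma mer_holomorphic: "f \<in> mer U \<Longrightarrow> f holomorphic_on fin U"
  and mer_meromorphic: "f \<in> mer U \<Longrightarrow> None \<in> U \<Longrightarrow> (\<lambda>x. f (1 / x)) meromorphic_on {0}"
  by (auto simp: mer_def Omer_def)

lemma mer_add: 
  assumes "openin CP1 U" "f \<in> mer U" "g \<in> mer U" shows "(\<lambda>z\<in>fin U. f z + g z) \<in> mer U"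
  using assms by (intro restrict_in_mer) 
    (auto intro!: holomorphic_intros meromorphic_intros dest: mer_holomorphic mer_meromorphic)

lemma mer_mult: 
  assumes "openin CP1 U" "f \<in> mer U" "g \<in> mer U" shows "(\<lambda>z\<in>fin U. f z * g z) \<in> mer U"
  using assms by (intro restrict_in_mer) 
    (auto intro!: holomorphic_intros meromorphic_intros dest: mer_holomorphic mer_meromorphic)

lemma mer_const: "openin CP1 U \<Longrightarrow> (\<lambda>z\<in>fin U. a) \<in> mer U"
  by (intro restrict_in_mer) (auto intro!: holomorphic_intros meromorphic_intros)

lemma hol_const: 
  assumes "openin CP1 U" shows "(\<lambda>z\<in>fin U. a) \<in> hol U"
proof -
  have "pole_le 0 (\<lambda>z\<in>fin U. a)" if "None \<in> U"
    unfolding pole_le_def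
  proof (intro exI conjI)
    show "(\<lambda>x. a) analytic_on {0::complex}" by (auto intro!: analytic_intros)
    show "\<forall>\<^sub>F x in at 0. x powi 0 * (\<lambda>z\<in>fin U. a) (1 / x) = a"
      using eventually_fin_at_infinity[OF assms that] by (rule eventually_mono) simp
  qed
  then show ?thesis using assms by (simp add: hol_def mer_const)
qed

lemma mer_coordinate: 
  assumes "openin CP1 U" "Some 0 \<notin> U" shows "(\<lambda>z\<in>fin U. 1 / z) \<in> mer U"
proof (rule restrict_in_mer[OF assms(1)])
  show "(\<lambda>z. 1 / z) holomorphic_on fin U"
    using assms(2) by (auto simp: fin_def intro!: holomorphic_intros)
  show "(\<lambda>x. 1 / (1 / x)) meromorphic_on {0::complex}" by (simp add: meromorphic_on_id)
qed

lemma Omer_simps [simp]: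
  "carrier (Omer U) = mer U"
  "f \<otimes>\<^bsub>Omer U\<^esub> g = (\<lambda>z\<in>fin U. f z * g z)" "\<one>\<^bsub>Omer U\<^esub> = (\<lambda>z\<in>fin U. 1)"
  "f \<oplus>\<^bsub>Omer U\<^esub> g = (\<lambda>z\<in>fin U. f z + g z)" "\<zero>\<^bsub>Omer U\<^esub> = (\<lambda>z\<in>fin U. 0)"
  by (simp_all add: Omer_def mer_def)

lemma cring_Omer:
  assumes U: "openin CP1 U" shows "cring (Omer U)"
proof -
  note closed = mer_add[OF U] mer_mult[OF U] mer_const[OF U] 
  have ext: "f z = undefined" if "f \<in> mer U" "z \<notin> fin U" for f z
    using mer_extensional[OF that(1)] that(2) by (auto simp: extensional_def)
  have "\<exists>g\<in>mer U. (\<lambda>z\<in>fin U. g z + f z) = (\<lambda>z\<in>fin U. 0)" if "f \<in> mer U" for f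
    by (rule bexI[OF _ closed(2)[OF closed(3)[of "-1"] that]]) auto
  then have "abelian_group (Omer U)"
    by (intro abelian_groupI) (use closed in \<open>auto simp: fun_eq_iff add_ac intro: ext[symmetric]\<close>)
  moreover have "comm_monoid (Omer U)"
    by (rule comm_monoidI) (use closed in \<open>auto simp: fun_eq_iff mult_ac intro: ext[symmetric]\<close>)
  ultimately show ?thesis
    by (rule cringI) (auto simp: fun_eq_iff distrib_right)
qed

section \<open>Frames and coordinates\<close>

lemma sheaf_module: 
  "module_sheaf X E \<Longrightarrow> openin CP1 U \<Longrightarrow> U \<subseteq> X \<Longrightarrow> module (Omer U) (Sec E U)"
  by (simp add: module_sheaf_def)

lemma sheaf_Res_closed: 
  "\<lbrakk>module_sheaf X E; openin CP1 U; openin CP1 V; V \<subseteq> U; U \<subseteq> X; s \<in> carrier (Sec E U)\<rbrakk>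
    \<Longrightarrow> Res E U V s \<in> carrier (Sec E V)"
  by (simp add: module_sheaf_def Pi_iff)

lemma sheaf_Res_self: 
  "\<lbrakk>module_sheaf X E; openin CP1 U; U \<subseteq> X; s \<in> carrier (Sec E U)\<rbrakk> \<Longrightarrow> Res E U U s = s"
  by (simp add: module_sheaf_def)

lemma sheaf_Res_trans: 
  "\<lbrakk>module_sheaf X E; openin CP1 U; openin CP1 V; openin CP1 W; W \<subseteq> V; V \<subseteq> U; U \<subseteq> X; 
    s \<in> carrier (Sec E U)\<rbrakk> \<Longrightarrow> Res E V W (Res E U V s) = Res E U W s"
  by (simp add: module_sheaf_def)

lemma lincomb_cong:
  assumes "module (Omer V) (Sec E V)" "\<And>i. i \<in> {1..K} \<Longrightarrow> e i \<in> carrier (Sec E V)"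
    and "\<And>i. i \<in> {1..K} \<Longrightarrow> f i \<in> mer V"
    and "\<And>i. i \<in> {1..K} \<Longrightarrow> e i = e' i" "\<And>i. i \<in> {1..K} \<Longrightarrow> f i = f' i"
  shows "lincomb E K V e f = lincomb E K V e' f'"
proof -
  interpret module "Omer V" "Sec E V" by fact
  have "(\<lambda>i. f i \<odot>\<^bsub>Sec E V\<^esub> e i) \<in> {1..K} \<rightarrow> carrier (Sec E V)" 
    using assms by (intro Pi_I smult_closed) auto
  moreover have "f i \<odot>\<^bsub>Sec E V\<^esub> e i = f' i \<odot>\<^bsub>Sec E V\<^esub> e' i" if "i \<in> {1..K}" for i
    using assms that by simp
  ultimately show ?thesis unfolding lincomb_def by (intro finsum_cong') (auto simp: Pi_iff)
qed

lemma frame_sections: "frame E K U e \<Longrightarrow> i \<in> {1..K} \<Longrightarrow> e i \<in> carrier (Sec E U)"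
  by (simp add: frame_def frame_of_def sections_def)

text \<open>A frame over \<open>V\<close> is tested on all smaller open sets; over \<open>V\<close> itself the restriction maps are
  identities, which gives the coordinates of \<open>coord\<close>.\<close>

lemma frame_unique_coords:
  assumes "module_sheaf X E" "openin CP1 V" "V \<subseteq> X" "frame E K V e" "s \<in> carrier (Sec E V)"
  shows "\<exists>!f. f \<in> {1..K} \<rightarrow>\<^sub>E mer V \<and> s = lincomb E K V e f"
proof -
  note M = sheaf_module[OF assms(1-3)]
  have e: "e i \<in> carrier (Sec E V)" if "i \<in> {1..K}" for i 
    using frame_sections[OF assms(4) that] .
  have "lincomb E K V (\<lambda>i. Res E V V (e i)) f = lincomb E K V e f" if "f \<in> {1..K} \<rightarrow>\<^sub>E mer V" for f
    using that by (intro lincomb_cong M) (auto simp: sheaf_Res_self[OF assms(1-3)] e PiE_iff)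
  then have "f \<in> {1..K} \<rightarrow>\<^sub>E mer V \<and> s = lincomb E K V (\<lambda>i. Res E V V (e i)) f \<longleftrightarrow>
     f \<in> {1..K} \<rightarrow>\<^sub>E mer V \<and> s = lincomb E K V e f" for f by auto
  moreover have "\<exists>!f. f \<in> {1..K} \<rightarrow>\<^sub>E mer V \<and> s = lincomb E K V (\<lambda>i. Res E V V (e i)) f"
    using assms by (auto simp: frame_def frame_of_def sections_def)
  ultimately show ?thesis by simp
qed

lemma coord_eqI:
  assumes "module_sheaf X E" "openin CP1 V" "V \<subseteq> X" "frame E K V e" 
    and "f \<in> {1..K} \<rightarrow>\<^sub>E mer V" "s = lincomb E K V e f" "s \<in> carrier (Sec E V)"
  shows "coord E K V e s = f"
  using frame_unique_coords[OF assms(1-4) assms(7)] assms(5,6) unfolding coord_def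
  by (intro the1_equality) auto

lemma 
  assumes "module_sheaf X E" "openin CP1 V" "V \<subseteq> X" "frame E K V e" "s \<in> carrier (Sec E V)"
  shows coord_mer: "coord E K V e s \<in> {1..K} \<rightarrow>\<^sub>E mer V"
    and lincomb_coord: "s = lincomb E K V e (coord E K V e s)"
  using theI'[OF frame_unique_coords[OF assms]] unfolding coord_def by auto

lemma frame_restrict:
  assumes "module_sheaf X E" "openin CP1 U" "U \<subseteq> X" "openin CP1 V" "V \<subseteq> U" "frame E K U e"
  shows "frame E K V (\<lambda>i. Res E U V (e i))"
proof -
  have *: "Res E V W (Res E U V (e i)) = Res E U W (e i)" 
    "Res E U W (e i) \<in> carrier (Sec E W)"
    if "i \<in> {1..K}" "openin CP1 W" "W \<subseteq> V" for i W
    using sheaf_Res_trans[OF assms(1,2,4) that(2,3) assms(5,3)] frame_sections[OF assms(6) that(1)]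
      sheaf_Res_closed[OF assms(1,2) that(2)] that assms by auto
  have eq: "lincomb E K W (\<lambda>i. Res E V W (Res E U V (e i))) f = lincomb E K W (\<lambda>i. Res E U W (e i)) f"
    if "openin CP1 W" "W \<subseteq> V" "f \<in> {1..K} \<rightarrow>\<^sub>E mer W" for W f
    using that assms by (intro lincomb_cong sheaf_module[OF assms(1)]) (auto simp: * PiE_iff)
  have new: "\<forall>f\<in>{1..K} \<rightarrow>\<^sub>E mer W. lincomb E K W (\<lambda>i. Res E V W (Res E U V (e i))) f \<in> carrier (Sec E W)"
    "\<forall>s\<in>carrier (Sec E W). \<exists>!f. f \<in> {1..K} \<rightarrow>\<^sub>E mer W \<and> s = lincomb E K W (\<lambda>i. Res E V W (Res E U V (e i))) f"
    if W: "openin CP1 W" "W \<subseteq> V" for W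
  proof -
    have old: "\<forall>f\<in>{1..K} \<rightarrow>\<^sub>E mer W. lincomb E K W (\<lambda>i. Res E U W (e i)) f \<in> carrier (Sec E W)"
      "\<forall>s\<in>carrier (Sec E W). \<exists>!f. f \<in> {1..K} \<rightarrow>\<^sub>E mer W \<and> s = lincomb E K W (\<lambda>i. Res E U W (e i)) f"
      using assms(6)[unfolded frame_def frame_of_def sections_def, THEN conjunct2, THEN spec, THEN mp,
        OF conjI[OF W(1) order_trans[OF W(2) assms(5)]]] by (rule conjunct1, rule conjunct2)
    then show "\<forall>f\<in>{1..K} \<rightarrow>\<^sub>E mer W. lincomb E K W (\<lambda>i. Res E V W (Res E U V (e i))) f \<in> carrier (Sec E W)"
      using eq[OF W] by simp
    have "f \<in> {1..K} \<rightarrow>\<^sub>E mer W \<and> s = lincomb E K W (\<lambda>i. Res E V W (Res E U V (e i))) f \<longleftrightarrow>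
      f \<in> {1..K} \<rightarrow>\<^sub>E mer W \<and> s = lincomb E K W (\<lambda>i. Res E U W (e i)) f" for s f
      using eq[OF W] by auto
    then show "\<forall>s\<in>carrier (Sec E W). \<exists>!f. f \<in> {1..K} \<rightarrow>\<^sub>E mer W \<and> s = lincomb E K W (\<lambda>i. Res E V W (Res E U V (e i))) f"
      using old(2) by simp
  qed
  show ?thesis unfolding frame_def frame_of_def sections_def
  proof (intro conjI allI impI)
    show "\<forall>i\<in>{1..K}. Res E U V (e i) \<in> carrier (Sec E V)"
      using *(2)[OF _ assms(4) order_refl] by blast
  qed (elim conjE, rule new, assumption+)+
qed

section \<open>Isomorphisms of bundles over a dilation\<close>

text \<open>Coordinates outside \<open>{1..K}\<close> hold the default value of extensional families, and are left alone.
  In this way \<open>push_coords c K\<close> is a bijection of the whole type and also preserves extensionality.\<close>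

definition push_coords :: "complex \<Rightarrow> nat \<Rightarrow> (nat \<Rightarrow> complex \<Rightarrow> complex) \<Rightarrow> nat \<Rightarrow> complex \<Rightarrow> complex" where
  "push_coords c K f = (\<lambda>i. if i \<in> {1..K} then push c (f i) else f i)"

lemma (in dilation) bij_push_coords: "bij (push_coords c K)"
proof (rule bij_betw_byWitness[where f' = "push_coords (inverse c) K"])
qed (auto simp: push_coords_def)

lemma (in dilation) push_coords_PiE [simp]: 
  assumes "\<And>V f. push c f \<in> A (dil c V) \<longleftrightarrow> f \<in> A V"
  shows "push_coords c K f \<in> {1..K} \<rightarrow>\<^sub>E A (dil c V) \<longleftrightarrow> f \<in> {1..K} \<rightarrow>\<^sub>E A V"
  by (auto simp: push_coords_def PiE_iff extensional_def assms)

lemma bij_all: "bij g \<Longrightarrow> (\<forall>x. P x) \<longleftrightarrow> (\<forall>x. P (g x))"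
  unfolding bij_def surj_def by metis

lemma bij_ex1: "bij g \<Longrightarrow> (\<exists>!x. P x) \<longleftrightarrow> (\<exists>!x. P (g x))"
  unfolding bij_def surj_def inj_def Ex1_def by metis

text \<open>An isomorphism from \<open>E1\<close> to the pullback of \<open>E2\<close> along \<open>z \<mapsto> c z\<close>. One map \<open>T\<close> serves all open sets,
  and it is a bijection of the types of sections: a quantifier over sections of \<open>E2\<close> then becomes a
  quantifier over sections of \<open>E1\<close> without further conditions. Linearity is required for extensional
  functions only, since scalar multiplication in a pullback ignores the values of a function outside
  its domain, whereas \<open>E2\<close> may react to them.\<close>

locale bundle_iso = dilation c for c +
  fixes E1 :: "'a fbundle" and E2 :: "'b fbundle" and T :: "'a \<Rightarrow> 'b"
  assumes bijT: "bij T"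
    and carrier_iff [simp]: "T s \<in> carrier (Sec E2 (dil c U)) \<longleftrightarrow> s \<in> carrier (Sec E1 U)"
    and T_zero: "T \<zero>\<^bsub>Sec E1 U\<^esub> = \<zero>\<^bsub>Sec E2 (dil c U)\<^esub>"
    and T_add: "T (s \<oplus>\<^bsub>Sec E1 U\<^esub> t) = T s \<oplus>\<^bsub>Sec E2 (dil c U)\<^esub> T t"
    and T_smult: "f \<in> extensional (fin U) \<Longrightarrow> T (f \<odot>\<^bsub>Sec E1 U\<^esub> s) = push c f \<odot>\<^bsub>Sec E2 (dil c U)\<^esub> T s"
    and T_Res: "T (Res E1 U V s) = Res E2 (dil c U) (dil c V) (T s)"
    and T_Fil [simp]: "T s \<in> Fil E2 \<alpha> (dil c U) \<longleftrightarrow> s \<in> Fil E1 \<alpha> U"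
begin

lemma T_eq [simp]: "T s = T t \<longleftrightarrow> s = t"
  using bijT by (simp add: bij_def inj_eq)

lemma T_inv [simp]: "T (inv_into UNIV T t) = t" "inv_into UNIV T (T s) = s"
  using bijT by (simp_all add: bij_def surj_f_inv_f)

lemma all_T: "(\<forall>t. P t) \<longleftrightarrow> (\<forall>s. P (T s))"
  by (rule bij_all[OF bijT])

lemma ex_T: "(\<exists>t. P t) \<longleftrightarrow> (\<exists>s. P (T s))"
  using all_T[of "\<lambda>t. \<not> P t"] by blast

lemma sections_iff [simp]: "T s \<in> sections E2 (dil c U) \<longleftrightarrow> s \<in> sections E1 U"
  by (simp add: sections_def)

lemma finsum_T:
  assumes "abelian_monoid (Sec E1 U)" "abelian_monoid (Sec E2 (dil c U))"
    and "finite I" "\<tau> \<in> I \<rightarrow> carrier (Sec E1 U)"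
  shows "T (finsum (Sec E1 U) \<tau> I) = finsum (Sec E2 (dil c U)) (\<lambda>i. T (\<tau> i)) I"
proof -
  interpret A: abelian_monoid "Sec E1 U" by fact
  interpret B: abelian_monoid "Sec E2 (dil c U)" by fact
  from assms(3,4) show ?thesis
    by (induction I) (simp_all add: T_zero T_add Pi_iff)
qed

text \<open>All identities in the module are checked after applying the injective map \<open>T\<close>; additive inverses
  are the preimages of additive inverses.\<close>

lemma module_transport:
  assumes "openin CP1 U" "module (Omer (dil c U)) (Sec E2 (dil c U))"
  shows "module (Omer U) (Sec E1 U)"
proof (rule moduleI)
  interpret M: module "Omer (dil c U)" "Sec E2 (dil c U)" by fact
  have ext [simp]: "f \<in> extensional (fin U)" if "f \<in> mer U" for f using mer_extensional[OF that] .
  have push_add: "push c (\<lambda>z\<in>fin U. f z + g z) = push c f \<oplus>\<^bsub>Omer (dil c U)\<^esub> push c g" for f g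
    by (auto simp: push_def fun_eq_iff)
  have push_mult: "push c (\<lambda>z\<in>fin U. f z * g z) = push c f \<otimes>\<^bsub>Omer (dil c U)\<^esub> push c g" for f g
    by (auto simp: push_def fun_eq_iff)
  have push_one: "push c (\<lambda>z\<in>fin U. 1) = \<one>\<^bsub>Omer (dil c U)\<^esub>"
    by (auto simp: push_def fun_eq_iff)
  show "cring (Omer U)" by (rule cring_Omer) fact
  have TI: "T s = T t \<Longrightarrow> s = t" for s t by simp
  have TC: "T s \<in> carrier (Sec E2 (dil c U)) \<Longrightarrow> s \<in> carrier (Sec E1 U)" for s by simp
  show "abelian_group (Sec E1 U)"
  proof (rule abelian_groupI)
    fix s t r assume *: "s \<in> carrier (Sec E1 U)" "t \<in> carrier (Sec E1 U)"
    show "s \<oplus>\<^bsub>Sec E1 U\<^esub> t \<in> carrier (Sec E1 U)"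
      by (rule TC) (simp add: T_add *)
    show "s \<oplus>\<^bsub>Sec E1 U\<^esub> t = t \<oplus>\<^bsub>Sec E1 U\<^esub> s"
      by (rule TI) (simp add: T_add * M.a_comm)
    assume **: "r \<in> carrier (Sec E1 U)"
    show "s \<oplus>\<^bsub>Sec E1 U\<^esub> t \<oplus>\<^bsub>Sec E1 U\<^esub> r = s \<oplus>\<^bsub>Sec E1 U\<^esub> (t \<oplus>\<^bsub>Sec E1 U\<^esub> r)"
      by (rule TI) (simp add: T_add * ** M.a_assoc)
  next
    fix s assume *: "s \<in> carrier (Sec E1 U)"
    show "\<zero>\<^bsub>Sec E1 U\<^esub> \<oplus>\<^bsub>Sec E1 U\<^esub> s = s"
      by (rule TI) (simp add: T_add T_zero *)
    define t where "t = inv_into UNIV T (\<ominus>\<^bsub>Sec E2 (dil c U)\<^esub> T s)"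
    have "t \<oplus>\<^bsub>Sec E1 U\<^esub> s = \<zero>\<^bsub>Sec E1 U\<^esub>"
      by (rule TI) (simp add: T_add T_zero t_def * M.l_neg)
    moreover have "t \<in> carrier (Sec E1 U)"
      by (rule TC) (simp add: t_def *)
    ultimately show "\<exists>t\<in>carrier (Sec E1 U). t \<oplus>\<^bsub>Sec E1 U\<^esub> s = \<zero>\<^bsub>Sec E1 U\<^esub>" ..
  qed (rule TC, simp add: T_zero)
  show "\<one>\<^bsub>Omer U\<^esub> \<odot>\<^bsub>Sec E1 U\<^esub> s = s" if "s \<in> carrier (Sec E1 U)" for s
    using M.smult_one[of "T s"] that by (intro TI) (simp add: T_smult push_one)
  fix f g s t assume "f \<in> carrier (Omer U)" and s: "s \<in> carrier (Sec E1 U)"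
  then have f: "f \<in> mer U" by simp
  show "f \<odot>\<^bsub>Sec E1 U\<^esub> s \<in> carrier (Sec E1 U)"
    by (rule TC) (simp add: T_smult f s)
  show "f \<odot>\<^bsub>Sec E1 U\<^esub> (s \<oplus>\<^bsub>Sec E1 U\<^esub> t) = f \<odot>\<^bsub>Sec E1 U\<^esub> s \<oplus>\<^bsub>Sec E1 U\<^esub> f \<odot>\<^bsub>Sec E1 U\<^esub> t"
    if "t \<in> carrier (Sec E1 U)"
    using M.smult_r_distr[of "push c f" "T s" "T t"] that
    by (intro TI) (simp add: T_smult T_add f s)
  assume "g \<in> carrier (Omer U)"
  then have g: "g \<in> mer U" by simp
  show "(f \<oplus>\<^bsub>Omer U\<^esub> g) \<odot>\<^bsub>Sec E1 U\<^esub> s = f \<odot>\<^bsub>Sec E1 U\<^esub> s \<oplus>\<^bsub>Sec E1 U\<^esub> g \<odot>\<^bsub>Sec E1 U\<^esub> s"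
    using M.smult_l_distr[of "push c f" "push c g" "T s"]
    by (intro TI) (simp add: T_smult T_add push_add f g s)
  show "(f \<otimes>\<^bsub>Omer U\<^esub> g) \<odot>\<^bsub>Sec E1 U\<^esub> s = f \<odot>\<^bsub>Sec E1 U\<^esub> (g \<odot>\<^bsub>Sec E1 U\<^esub> s)"
    using M.smult_assoc1[of "push c f" "push c g" "T s"]
    by (intro TI) (simp add: T_smult T_add push_mult f g s)
qed

text \<open>For the gluing property, a cover of a subset of \<open>X\<close> and local sections of \<open>E1\<close> are moved to a cover
  and local sections of \<open>E2\<close>; as \<open>T\<close> is bijective, the unique glued section of \<open>E2\<close> comes from a unique
  section of \<open>E1\<close>.\<close>

lemma module_sheaf_transport:
  assumes E2: "module_sheaf (dil c X) E2"
  shows "module_sheaf X E1"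
proof -
  have TI: "T s = T t \<Longrightarrow> s = t" for s t by simp
  have TC: "T s \<in> carrier (Sec E2 (dil c U)) \<Longrightarrow> s \<in> carrier (Sec E1 U)" for s U by simp
  have mod: "module (Omer U) (Sec E1 U)" if "openin CP1 U" "U \<subseteq> X" for U
    using that by (intro module_transport sheaf_module[OF E2]) auto
  have E2_Res: 
    "\<forall>s\<in>carrier (Sec E2 U). \<forall>t\<in>carrier (Sec E2 U).
          Res E2 U V (s \<oplus>\<^bsub>Sec E2 U\<^esub> t) = Res E2 U V s \<oplus>\<^bsub>Sec E2 V\<^esub> Res E2 U V t"
    "\<forall>f\<in>mer U. \<forall>s\<in>carrier (Sec E2 U).
          Res E2 U V (f \<odot>\<^bsub>Sec E2 U\<^esub> s) = restrict f (fin V) \<odot>\<^bsub>Sec E2 V\<^esub> Res E2 U V s"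
    if "openin CP1 U" "openin CP1 V" "V \<subseteq> U" "U \<subseteq> dil c X" for U V
    using E2 that unfolding module_sheaf_def by simp_all
  have Res_closed: "Res E1 U V s \<in> carrier (Sec E1 V)"
    if "openin CP1 U" "openin CP1 V" "V \<subseteq> U" "U \<subseteq> X" "s \<in> carrier (Sec E1 U)" for U V s
    by (rule TC) (use that in \<open>simp add: T_Res sheaf_Res_closed[OF E2]\<close>)
  have Res_add: "Res E1 U V (s \<oplus>\<^bsub>Sec E1 U\<^esub> t) = Res E1 U V s \<oplus>\<^bsub>Sec E1 V\<^esub> Res E1 U V t"
    if "openin CP1 U" "openin CP1 V" "V \<subseteq> U" "U \<subseteq> X" "s \<in> carrier (Sec E1 U)" "t \<in> carrier (Sec E1 U)" 
    for U V s t
    by (rule TI) (use that in \<open>simp add: T_Res T_add E2_Res\<close>)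
  have Res_smult: "Res E1 U V (f \<odot>\<^bsub>Sec E1 U\<^esub> s) = restrict f (fin V) \<odot>\<^bsub>Sec E1 V\<^esub> Res E1 U V s"
    if "openin CP1 U" "openin CP1 V" "V \<subseteq> U" "U \<subseteq> X" "f \<in> mer U" "s \<in> carrier (Sec E1 U)" 
    for U V f s
    by (rule TI) (use that mer_extensional in \<open>simp add: T_Res T_smult E2_Res push_restrict\<close>)
  have Res_self: "Res E1 U U s = s" if "openin CP1 U" "U \<subseteq> X" "s \<in> carrier (Sec E1 U)" for U s
    by (rule TI) (use that in \<open>simp add: T_Res sheaf_Res_self[OF E2]\<close>)
  have Res_trans: "Res E1 V W (Res E1 U V s) = Res E1 U W s" 
    if "openin CP1 U" "openin CP1 V" "openin CP1 W" "W \<subseteq> V" "V \<subseteq> U" "U \<subseteq> X" 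
      "s \<in> carrier (Sec E1 U)" for U V W s
    by (rule TI) (use that in \<open>simp add: T_Res sheaf_Res_trans[OF E2]\<close>)
  have glue: "\<exists>!s. s \<in> carrier (Sec E1 (\<Union>\<U>)) \<and> (\<forall>U\<in>\<U>. Res E1 (\<Union>\<U>) U s = \<sigma> U)"
    if loc: "\<forall>U\<in>\<U>. openin CP1 U \<and> U \<subseteq> X \<and> \<sigma> U \<in> carrier (Sec E1 U)"
      and agree: "\<forall>U\<in>\<U>. \<forall>V\<in>\<U>. Res E1 U (U \<inter> V) (\<sigma> U) = Res E1 V (U \<inter> V) (\<sigma> V)" for \<U> \<sigma>
  proof -
    define \<sigma>' where "\<sigma>' V = T (\<sigma> (dil (inverse c) V))" for V
    have 1: "\<forall>U\<in>dil c ` \<U>. openin CP1 U \<and> U \<subseteq> dil c X \<and> \<sigma>' U \<in> carrier (Sec E2 U)"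
      using loc by (simp add: \<sigma>'_def)
    have "Res E2 (dil c U) (dil c (U \<inter> V)) (\<sigma>' (dil c U)) = Res E2 (dil c V) (dil c (U \<inter> V)) (\<sigma>' (dil c V))"
      if "U \<in> \<U>" "V \<in> \<U>" for U V
      using bspec[OF bspec[OF agree that(1)] that(2)] by (simp add: \<sigma>'_def flip: T_Res)
    then have 2: "\<forall>U\<in>dil c ` \<U>. \<forall>V\<in>dil c ` \<U>. Res E2 U (U \<inter> V) (\<sigma>' U) = Res E2 V (U \<inter> V) (\<sigma>' V)"
      by (auto simp: dil_Int)
    have "\<exists>!s. s \<in> carrier (Sec E2 (\<Union>(dil c ` \<U>))) \<and> 
        (\<forall>U\<in>dil c ` \<U>. Res E2 (\<Union>(dil c ` \<U>)) U s = \<sigma>' U)"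
      using E2[unfolded module_sheaf_def, THEN conjunct2, THEN conjunct2, THEN conjunct2, THEN conjunct2,
        rule_format, OF conjI[OF 1 2]] .
    then have "\<exists>!s. T s \<in> carrier (Sec E2 (dil c (\<Union>\<U>))) \<and> 
        (\<forall>U\<in>\<U>. Res E2 (dil c (\<Union>\<U>)) (dil c U) (T s) = \<sigma>' (dil c U))"
      by (subst (asm) bij_ex1[OF bijT]) (simp flip: dil_Union)
    then show ?thesis by (simp add: \<sigma>'_def flip: T_Res)
  qed
  show ?thesis unfolding module_sheaf_def
    by (intro conjI allI impI ballI Pi_I; elim conjE;
        rule mod Res_closed Res_add Res_smult Res_self Res_trans glue; assumption)
qed

lemma lincomb_T:
  assumes "openin CP1 V" "module (Omer (dil c V)) (Sec E2 (dil c V))" 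
    and "\<And>i. i \<in> {1..K} \<Longrightarrow> e i \<in> carrier (Sec E1 V)" "\<And>i. i \<in> {1..K} \<Longrightarrow> f i \<in> mer V"
  shows "T (lincomb E1 K V e f) = lincomb E2 K (dil c V) (\<lambda>i. T (e i)) (push_coords c K f)"
proof -
  interpret M2: module "Omer (dil c V)" "Sec E2 (dil c V)" by fact
  interpret M1: module "Omer V" "Sec E1 V" using assms by (intro module_transport)
  have *: "T (f i \<odot>\<^bsub>Sec E1 V\<^esub> e i) = push_coords c K f i \<odot>\<^bsub>Sec E2 (dil c V)\<^esub> T (e i)"
    if "i \<in> {1..K}" for i
    using that assms(4)[OF that] mer_extensional by (simp add: T_smult push_coords_def)
  have "T (lincomb E1 K V e f) = (\<Oplus>\<^bsub>Sec E2 (dil c V)\<^esub>i\<in>{1..K}. T (f i \<odot>\<^bsub>Sec E1 V\<^esub> e i))"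
    unfolding lincomb_def
    by (rule finsum_T) (use assms in \<open>auto simp del: atLeastAtMost_iff intro!: M1.smult_closed M1.abelian_monoid_axioms M2.abelian_monoid_axioms\<close>)
  also have "\<dots> = lincomb E2 K (dil c V) (\<lambda>i. T (e i)) (push_coords c K f)"
    unfolding lincomb_def
    by (rule M2.finsum_cong') (use assms(3,4) in \<open>auto simp: * push_coords_def intro!: M2.smult_closed\<close>)
  finally show ?thesis .
qed

text \<open>The ring sheaf \<open>A\<close> is either \<open>mer\<close> or \<open>hol\<close>, and the pair \<open>P1\<close>, \<open>P2\<close> is either the full sheaves of
  sections, a step of the filtrations, or the line bundle that defines a standard filtration.\<close>

lemma frame_of_iff:
  assumes E2: "module_sheaf (dil c X) E2" and U: "openin CP1 U" "U \<subseteq> X"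
    and A: "\<And>V f. push c f \<in> A (dil c V) \<longleftrightarrow> f \<in> A V" "\<And>V. A V \<subseteq> mer V"
    and P: "\<And>V s. \<lbrakk>openin CP1 V; V \<subseteq> X\<rbrakk> \<Longrightarrow> T s \<in> P2 (dil c V) \<longleftrightarrow> s \<in> P1 V"
      "\<And>V. \<lbrakk>openin CP1 V; V \<subseteq> X\<rbrakk> \<Longrightarrow> P1 V \<subseteq> carrier (Sec E1 V)"
  shows "frame_of A E2 P2 K (dil c U) (\<lambda>i. T (e i)) \<longleftrightarrow> frame_of A E1 P1 K U e"
proof -
  note E1 = module_sheaf_transport[OF E2]
  have main: "((\<forall>f\<in>{1..K} \<rightarrow>\<^sub>E A (dil c V). lincomb E2 K (dil c V) (\<lambda>i. Res E2 (dil c U) (dil c V) (T (e i))) f \<in> P2 (dil c V)) \<and>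
       (\<forall>s\<in>P2 (dil c V). \<exists>!f. f \<in> {1..K} \<rightarrow>\<^sub>E A (dil c V) \<and> s = lincomb E2 K (dil c V) (\<lambda>i. Res E2 (dil c U) (dil c V) (T (e i))) f))
     \<longleftrightarrow> ((\<forall>f\<in>{1..K} \<rightarrow>\<^sub>E A V. lincomb E1 K V (\<lambda>i. Res E1 U V (e i)) f \<in> P1 V) \<and>
       (\<forall>s\<in>P1 V. \<exists>!f. f \<in> {1..K} \<rightarrow>\<^sub>E A V \<and> s = lincomb E1 K V (\<lambda>i. Res E1 U V (e i)) f))"
    if V: "openin CP1 V" "V \<subseteq> U" and e: "\<forall>i\<in>{1..K}. e i \<in> P1 U" for V
  proof -
    have VX: "V \<subseteq> X" using V U by simp
    have "lincomb E2 K (dil c V) (\<lambda>i. Res E2 (dil c U) (dil c V) (T (e i))) (push_coords c K f)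
        = T (lincomb E1 K V (\<lambda>i. Res E1 U V (e i)) f)" if "f \<in> {1..K} \<rightarrow>\<^sub>E A V" for f
      unfolding T_Res[symmetric]
    proof (rule lincomb_T[symmetric])
      show "module (Omer (dil c V)) (Sec E2 (dil c V))"
        using V VX by (intro sheaf_module[OF E2]) auto
      show "Res E1 U V (e i) \<in> carrier (Sec E1 V)" if "i \<in> {1..K}" for i
        using e P(2)[OF U] that by (intro sheaf_Res_closed[OF E1 U(1) V U(2)]) auto
      show "f i \<in> mer V" if "i \<in> {1..K}" for i
        using PiE_mem[OF \<open>f \<in> _\<close> that] A(2) by blast
    qed (rule V)
    note lin = this
    have Afun: "(\<forall>f\<in>{1..K} \<rightarrow>\<^sub>E A (dil c V). Q f) \<longleftrightarrow> (\<forall>f\<in>{1..K} \<rightarrow>\<^sub>E A V. Q (push_coords c K f))" for Q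
      unfolding Ball_def by (subst bij_all[OF bij_push_coords[of K]]) (simp only: push_coords_PiE[where A = A, OF A(1)])
    have Asec: "(\<forall>s\<in>P2 (dil c V). Q s) \<longleftrightarrow> (\<forall>s\<in>P1 V. Q (T s))" for Q
      unfolding Ball_def by (subst all_T) (simp add: P(1)[OF V(1) VX])
    have Efun: "(\<exists>!f. f \<in> {1..K} \<rightarrow>\<^sub>E A (dil c V) \<and> Q f) \<longleftrightarrow> 
        (\<exists>!f. f \<in> {1..K} \<rightarrow>\<^sub>E A V \<and> Q (push_coords c K f))" for Q
      by (subst bij_ex1[OF bij_push_coords[of K]]) (simp only: push_coords_PiE[where A = A, OF A(1)])
    show ?thesis
      unfolding Afun Asec Efun by (simp add: lin P(1)[OF V(1) VX] cong: conj_cong)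
  qed
  show ?thesis
    unfolding frame_of_def
  proof (rule conj_cong)
    show "(\<forall>i\<in>{1..K}. T (e i) \<in> P2 (dil c U)) = (\<forall>i\<in>{1..K}. e i \<in> P1 U)"
      by (rule ball_cong[OF refl]) (rule P(1)[OF U])
    assume "\<forall>i\<in>{1..K}. e i \<in> P1 U"
    note main' = main[OF _ _ this]
    show "(\<forall>V. openin CP1 V \<and> V \<subseteq> dil c U \<longrightarrow>
         (\<forall>f\<in>{1..K} \<rightarrow>\<^sub>E A V. lincomb E2 K V (\<lambda>i. Res E2 (dil c U) V (T (e i))) f \<in> P2 V) \<and>
         (\<forall>s\<in>P2 V. \<exists>!f. f \<in> {1..K} \<rightarrow>\<^sub>E A V \<and> s = lincomb E2 K V (\<lambda>i. Res E2 (dil c U) V (T (e i))) f)) =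
       (\<forall>V. openin CP1 V \<and> V \<subseteq> U \<longrightarrow>
         (\<forall>f\<in>{1..K} \<rightarrow>\<^sub>E A V. lincomb E1 K V (\<lambda>i. Res E1 U V (e i)) f \<in> P1 V) \<and>
         (\<forall>s\<in>P1 V. \<exists>!f. f \<in> {1..K} \<rightarrow>\<^sub>E A V \<and> s = lincomb E1 K V (\<lambda>i. Res E1 U V (e i)) f))"
      by (subst all_dil, unfold openin_dil dil_subset, intro all_cong1 imp_cong refl main')
         (elim conjE, assumption)+
  qed
qed

end

section \<open>Transport of filtered bundles\<close>

lemma O_submoduleD:
  assumes "locally_free_O_submodule X K E P" "openin CP1 U" "U \<subseteq> X"
  shows "P U \<subseteq> carrier (Sec E U)" "\<zero>\<^bsub>Sec E U\<^esub> \<in> P U"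
    "\<lbrakk>s \<in> P U; t \<in> P U\<rbrakk> \<Longrightarrow> s \<oplus>\<^bsub>Sec E U\<^esub> t \<in> P U"
    "\<lbrakk>f \<in> hol U; s \<in> P U\<rbrakk> \<Longrightarrow> f \<odot>\<^bsub>Sec E U\<^esub> s \<in> P U"
    "\<lbrakk>openin CP1 V; V \<subseteq> U; s \<in> P U\<rbrakk> \<Longrightarrow> Res E U V s \<in> P V"
  using assms by (simp_all add: locally_free_O_submodule_def sections_def)

lemma filtered_bundleD:
  assumes "filtered_bundle X K E" "openin CP1 U" "U \<subseteq> X"
  shows "\<alpha> \<le> \<beta> \<Longrightarrow> Fil E \<alpha> U \<subseteq> Fil E \<beta> U"
    and "None \<notin> U \<Longrightarrow> Fil E \<alpha> U = sections E U"
    and "Fil E \<alpha> U = (\<Inter>\<beta>\<in>{\<alpha><..}. Fil E \<beta> U)"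
    and "Some 0 \<notin> U \<Longrightarrow> Fil E (\<alpha> - 1) U = (\<lambda>s. (\<lambda>z\<in>fin U. 1 / z) \<odot>\<^bsub>Sec E U\<^esub> s) ` Fil E \<alpha> U"
proof -
  note * = assms(1)[unfolded filtered_bundle_def, THEN conjunct2, THEN conjunct2, THEN conjunct2,
      THEN spec, THEN mp, OF conjI[OF assms(2,3)]]
  show "\<alpha> \<le> \<beta> \<Longrightarrow> Fil E \<alpha> U \<subseteq> Fil E \<beta> U"
    by (rule *[THEN conjunct1, THEN spec, THEN spec, THEN mp])
  show "None \<notin> U \<Longrightarrow> Fil E \<alpha> U = sections E U"
    by (rule *[THEN conjunct2, THEN conjunct1, THEN mp, THEN spec])
  show "Fil E \<alpha> U = (\<Inter>\<beta>\<in>{\<alpha><..}. Fil E \<beta> U)"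
    by (rule *[THEN conjunct2, THEN conjunct2, THEN conjunct1, THEN spec])
  show "Some 0 \<notin> U \<Longrightarrow> Fil E (\<alpha> - 1) U = (\<lambda>s. (\<lambda>z\<in>fin U. 1 / z) \<odot>\<^bsub>Sec E U\<^esub> s) ` Fil E \<alpha> U"
    by (rule *[THEN conjunct2, THEN conjunct2, THEN conjunct2, THEN mp, THEN spec])
qed

context bundle_iso begin

lemma frame_iff:
  assumes "module_sheaf (dil c X) E2" "openin CP1 U" "U \<subseteq> X"
  shows "frame E2 K (dil c U) (\<lambda>i. T (e i)) \<longleftrightarrow> frame E1 K U e"
  unfolding frame_def using assms by (intro frame_of_iff[where X = X]) (auto simp: sections_def)

lemma coord_T:
  assumes E2: "module_sheaf (dil c X) E2" and V: "openin CP1 V" "V \<subseteq> X" 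
    and e: "frame E1 K V e" and s: "s \<in> carrier (Sec E1 V)"
  shows "coord E2 K (dil c V) (\<lambda>i. T (e i)) (T s) = push_coords c K (coord E1 K V e s)"
proof (rule coord_eqI[OF E2])
  note E1 = module_sheaf_transport[OF E2]
  note mer = coord_mer[OF E1 V e s] and lin = lincomb_coord[OF E1 V e s]
  show "frame E2 K (dil c V) (\<lambda>i. T (e i))" using frame_iff[OF E2 V] e by simp
  show "push_coords c K (coord E1 K V e s) \<in> {1..K} \<rightarrow>\<^sub>E mer (dil c V)"
    using mer by (subst push_coords_PiE[where A = mer]) auto
  have "T s = T (lincomb E1 K V e (coord E1 K V e s))" using lin by simp
  also have "\<dots> = lincomb E2 K (dil c V) (\<lambda>i. T (e i)) (push_coords c K (coord E1 K V e s))"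
    using V mer sheaf_module[OF E2, of "dil c V"] frame_sections[OF e]
    by (intro lincomb_T) (auto simp: PiE_iff)
  finally show "T s = \<dots>" .
qed (use V s in auto)

lemma coord_T_at:
  assumes "module_sheaf (dil c X) E2" "openin CP1 V" "V \<subseteq> X" "frame E1 K V e" 
    and "s \<in> carrier (Sec E1 V)" "i \<in> {1..K}"
  shows "coord E1 K V e s i z = coord E2 K (dil c V) (\<lambda>i. T (e i)) (T s) i (c * z)"
  using assms(6) nz unfolding coord_T[OF assms(1-5)] by (simp add: push_coords_def push_def)

lemma all_frames: "(\<forall>e. P e) \<longleftrightarrow> (\<forall>e. P (\<lambda>i. T (e i)))" for P :: "(nat \<Rightarrow> 'b) \<Rightarrow> bool"
proof safe
  fix e assume "\<forall>e. P (\<lambda>i. T (e i))"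
  from spec[OF this, of "\<lambda>i. inv_into UNIV T (e i)"] show "P e" by simp
qed simp

lemma ex_frames: "(\<exists>e. P e) \<longleftrightarrow> (\<exists>e. P (\<lambda>i. T (e i)))" for P :: "(nat \<Rightarrow> 'b) \<Rightarrow> bool"
  using all_frames[of "\<lambda>e. \<not> P e"] by blast

lemma dil_point: 
  assumes "p \<in> X" obtains q where "q \<in> dil c X" "\<And>U. q \<in> dil c U \<longleftrightarrow> p \<in> U"
proof -
  have "map_option ((*) c) p \<in> dil c U \<longleftrightarrow> p \<in> U" for U 
    using nz by (cases p) auto
  then show ?thesis using that assms by blast
qed

lemma locally_free_transport:
  assumes E2: "module_sheaf (dil c X) E2" 
    and A: "\<And>V f. push c f \<in> A (dil c V) \<longleftrightarrow> f \<in> A V" "\<And>V. A V \<subseteq> mer V"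
    and P: "\<And>V s. \<lbrakk>openin CP1 V; V \<subseteq> X\<rbrakk> \<Longrightarrow> T s \<in> P2 (dil c V) \<longleftrightarrow> s \<in> P1 V"
      "\<And>V. \<lbrakk>openin CP1 V; V \<subseteq> X\<rbrakk> \<Longrightarrow> P1 V \<subseteq> carrier (Sec E1 V)"
    and free: "locally_free A (dil c X) K E2 P2"
  shows "locally_free A X K E1 P1"
  unfolding locally_free_def
proof
  fix p assume "p \<in> X"
  then obtain q where q: "q \<in> dil c X" "\<And>U. q \<in> dil c U \<longleftrightarrow> p \<in> U" using dil_point by metis
  have "\<exists>U e. openin CP1 U \<and> q \<in> U \<and> U \<subseteq> dil c X \<and> frame_of A E2 P2 K U e"
    using free q(1) unfolding locally_free_def by blast
  then obtain U e where "openin CP1 (dil c U)" "q \<in> dil c U" "dil c U \<subseteq> dil c X" 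
      "frame_of A E2 P2 K (dil c U) (\<lambda>i. T (e i))"
    by (subst (asm) ex_dil, subst (asm) ex_frames) blast
  moreover from this have "frame_of A E1 P1 K U e"
    using frame_of_iff[where X = X and A = A and ?P1.0 = P1 and ?P2.0 = P2, OF E2 _ _ A P] by simp
  ultimately show "\<exists>U e. openin CP1 U \<and> p \<in> U \<and> U \<subseteq> X \<and> frame_of A E1 P1 K U e"
    using q(2) by auto
qed

lemma O_submodule_transport:
  assumes E2: "module_sheaf (dil c X) E2" 
    and P: "\<And>V s. \<lbrakk>openin CP1 V; V \<subseteq> X\<rbrakk> \<Longrightarrow> T s \<in> P2 (dil c V) \<longleftrightarrow> s \<in> P1 V"
    and sub: "locally_free_O_submodule (dil c X) K E2 P2"
  shows "locally_free_O_submodule X K E1 P1"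
proof -
  have TI: "T s = T t \<Longrightarrow> s = t" for s t by simp
  note sub1 = O_submoduleD[OF sub]
  have PC: "P1 U \<subseteq> carrier (Sec E1 U)" if "openin CP1 U" "U \<subseteq> X" for U
  proof
    fix s assume "s \<in> P1 U"
    then have "T s \<in> P2 (dil c U)" using P[OF that] by simp
    then have "T s \<in> carrier (Sec E2 (dil c U))" using sub1(1)[of "dil c U"] that by auto
    then show "s \<in> carrier (Sec E1 U)" by simp
  qed
  have hol_ext: "f \<in> extensional (fin U)" if "f \<in> hol U" for f U
    using that mer_extensional by (auto simp: hol_def)
  have PI: "T s \<in> P2 (dil c U) \<Longrightarrow> s \<in> P1 U" if "openin CP1 U" "U \<subseteq> X" for s U using P that by blast
  have alg: "P1 U \<subseteq> sections E1 U \<and> \<zero>\<^bsub>Sec E1 U\<^esub> \<in> P1 U \<and>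
       (\<forall>s\<in>P1 U. \<forall>t\<in>P1 U. s \<oplus>\<^bsub>Sec E1 U\<^esub> t \<in> P1 U) \<and>
       (\<forall>f\<in>hol U. \<forall>s\<in>P1 U. f \<odot>\<^bsub>Sec E1 U\<^esub> s \<in> P1 U)" if U: "openin CP1 U \<and> U \<subseteq> X" for U
    using U PC sub1[of "dil c U"] 
    by (auto simp: sections_def P T_add T_zero T_smult hol_ext intro!: PI)
  have res: "Res E1 U V s \<in> P1 V" 
    if "openin CP1 U" "openin CP1 V" "V \<subseteq> U" "U \<subseteq> X" "s \<in> P1 U" for U V s
    using that by (intro PI) (simp_all add: T_Res P sub1(5))
  have glue: "s \<in> P1 (\<Union>\<U>)" 
    if U: "\<forall>U\<in>\<U>. openin CP1 U \<and> U \<subseteq> X" and s: "s \<in> sections E1 (\<Union>\<U>)" "\<forall>U\<in>\<U>. Res E1 (\<Union>\<U>) U s \<in> P1 U" for \<U> s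
  proof -
    have "\<forall>s\<in>sections E2 (\<Union>(dil c ` \<U>)). 
        (\<forall>U\<in>dil c ` \<U>. Res E2 (\<Union>(dil c ` \<U>)) U s \<in> P2 U) \<longrightarrow> s \<in> P2 (\<Union>(dil c ` \<U>))"
      using sub[unfolded locally_free_O_submodule_def, THEN conjunct2, THEN conjunct2, THEN conjunct1,
        THEN spec, of "dil c ` \<U>"] U by auto
    then have "T s \<in> P2 (dil c (\<Union>\<U>))"
      using s U by (auto simp: P simp flip: dil_Union T_Res)
    then show ?thesis using U by (intro PI openin_Union) auto
  qed
  have "locally_free hol X K E1 P1"
    by (rule locally_free_transport[OF E2, where ?P2.0 = P2])
      (use P PC sub in \<open>auto simp: hol_def locally_free_O_submodule_def\<close>)
  then show ?thesis
    unfolding locally_free_O_submodule_def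
    using alg res glue by (intro conjI allI impI ballI; (elim conjE)?) simp_all
qed

text \<open>Only the relation between \<open>\<P>\<^bsub>\<alpha>-1\<^esub>\<close> and \<open>\<P>\<^sub>\<alpha>\<close> involves the coordinate. Multiplication by \<open>1/z\<close> on \<open>E2\<close>
  corresponds to multiplication by \<open>1/(c z)\<close> on \<open>E1\<close>, and multiplication by \<open>1/c\<close> maps each
  \<open>\<P>\<^sub>\<alpha>\<close> onto itself, the inverse being multiplication by \<open>c\<close>.\<close>

lemma filtered_bundle_transport:
  assumes E2: "filtered_bundle (dil c X) K E2"
  shows "filtered_bundle X K E1"
proof -
  have sh2: "module_sheaf (dil c X) E2" using E2 by (simp add: filtered_bundle_def)
  note sh1 = module_sheaf_transport[OF sh2]
  have sub2: "locally_free_O_submodule (dil c X) K E2 (Fil E2 \<alpha>)" for \<alpha>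
    using E2 by (simp add: filtered_bundle_def)
  have sub1: "locally_free_O_submodule X K E1 (Fil E1 \<alpha>)" for \<alpha>
    by (rule O_submodule_transport[OF sh2 _ sub2]) simp
  have free: "locally_free mer X K E1 (sections E1)"
    by (rule locally_free_transport[OF sh2, where ?P2.0 = "sections E2"]) 
      (use E2 in \<open>auto simp: filtered_bundle_def sections_def\<close>)
  have TS: "A = B" if "T ` A = T ` B" for A B
    using that bijT by (simp add: bij_def inj_image_eq_iff)
  have TF: "T ` Fil E1 \<alpha> U = Fil E2 \<alpha> (dil c U)" for \<alpha> U
  proof -
    have "\<forall>t. t \<in> T ` Fil E1 \<alpha> U \<longleftrightarrow> t \<in> Fil E2 \<alpha> (dil c U)" by (subst all_T) auto
    then show ?thesis by blast
  qed
  have "(\<forall>\<alpha> \<beta>. \<alpha> \<le> \<beta> \<longrightarrow> Fil E1 \<alpha> U \<subseteq> Fil E1 \<beta> U) \<and>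
       (None \<notin> U \<longrightarrow> (\<forall>\<alpha>. Fil E1 \<alpha> U = sections E1 U)) \<and>
       (\<forall>\<alpha>. Fil E1 \<alpha> U = (\<Inter>\<beta>\<in>{\<alpha><..}. Fil E1 \<beta> U)) \<and>
       (Some 0 \<notin> U \<longrightarrow> (\<forall>\<alpha>. Fil E1 (\<alpha> - 1) U =
          (\<lambda>s. (\<lambda>z\<in>fin U. 1 / z) \<odot>\<^bsub>Sec E1 U\<^esub> s) ` Fil E1 \<alpha> U))" 
    if U: "openin CP1 U" "U \<subseteq> X" for U
  proof (intro conjI allI impI)
    have U': "openin CP1 (dil c U)" "dil c U \<subseteq> dil c X" using U by auto
    note F2 = filtered_bundleD[OF E2 U']
    show "Fil E1 \<alpha> U \<subseteq> Fil E1 \<beta> U" if "\<alpha> \<le> \<beta>" for \<alpha> \<beta>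
      using subsetD[OF F2(1)[OF that]] by (metis T_Fil subsetI)
    show "Fil E1 \<alpha> U = sections E1 U" if "None \<notin> U" for \<alpha>
    proof (intro Set.set_eqI)
      show "s \<in> Fil E1 \<alpha> U \<longleftrightarrow> s \<in> sections E1 U" for s
        using T_Fil[of s \<alpha> U] F2(2)[of \<alpha>] that by simp
    qed
    have "s \<in> Fil E1 \<alpha> U \<longleftrightarrow> (\<forall>\<beta>>\<alpha>. s \<in> Fil E1 \<beta> U)" for \<alpha> s
      unfolding T_Fil[symmetric] using F2(3)[of \<alpha>] by blast
    then show "Fil E1 \<alpha> U = (\<Inter>\<beta>\<in>{\<alpha><..}. Fil E1 \<beta> U)" for \<alpha> by auto
    fix \<alpha> assume "Some 0 \<notin> U"
    interpret M: module "Omer U" "Sec E1 U" using sheaf_module[OF sh1 U] .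
    let ?x = "\<lambda>z\<in>fin U. 1 / z" and ?k = "\<lambda>a. \<lambda>z\<in>fin U. a"
    have x: "?x \<in> mer U" by (rule mer_coordinate) fact+
    have k: "?k a \<in> hol U" "?k a \<in> mer U" for a :: complex using hol_const mer_const U by auto
    have Fil_k: "?k a \<odot>\<^bsub>Sec E1 U\<^esub> s \<in> Fil E1 \<beta> U" if "s \<in> Fil E1 \<beta> U" for a \<beta> s
      by (rule O_submoduleD(4)[OF sub1 U k(1) that])
    have Fil_carrier: "s \<in> carrier (Sec E1 U)" if "s \<in> Fil E1 \<beta> U" for \<beta> s
      using O_submoduleD(1)[OF sub1 U] that by blast
    have Tx: "(\<lambda>z\<in>fin (dil c U). 1 / z) \<odot>\<^bsub>Sec E2 (dil c U)\<^esub> T s = T (?x \<odot>\<^bsub>Sec E1 U\<^esub> (?k (inverse c) \<odot>\<^bsub>Sec E1 U\<^esub> s))" 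
      if "s \<in> carrier (Sec E1 U)" for s
    proof -
      have "?x \<odot>\<^bsub>Sec E1 U\<^esub> (?k (inverse c) \<odot>\<^bsub>Sec E1 U\<^esub> s) = (?x \<otimes>\<^bsub>Omer U\<^esub> ?k (inverse c)) \<odot>\<^bsub>Sec E1 U\<^esub> s"
        using M.smult_assoc1[of ?x "?k (inverse c)" s] x k that by simp
      moreover have "push c (?x \<otimes>\<^bsub>Omer U\<^esub> ?k (inverse c)) = (\<lambda>z\<in>fin (dil c U). 1 / z)"
        using nz by (auto simp: push_def fun_eq_iff)
      ultimately show ?thesis by (simp add: T_smult)
    qed
    have "Fil E2 (\<alpha> - 1) (dil c U) = 
       (\<lambda>s. T (?x \<odot>\<^bsub>Sec E1 U\<^esub> (?k (inverse c) \<odot>\<^bsub>Sec E1 U\<^esub> s))) ` Fil E1 \<alpha> U"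
      unfolding F2(4)[unfolded Some_dil div_0, OF \<open>Some 0 \<notin> U\<close>] unfolding TF[symmetric] image_image
      by (rule image_cong) (simp_all add: Tx Fil_carrier)
    then have "T ` Fil E1 (\<alpha> - 1) U = 
        T ` (\<lambda>s. ?x \<odot>\<^bsub>Sec E1 U\<^esub> (?k (inverse c) \<odot>\<^bsub>Sec E1 U\<^esub> s)) ` Fil E1 \<alpha> U"
      unfolding TF image_image .
    then have "Fil E1 (\<alpha> - 1) U = (\<lambda>s. ?x \<odot>\<^bsub>Sec E1 U\<^esub> (?k (inverse c) \<odot>\<^bsub>Sec E1 U\<^esub> s)) ` Fil E1 \<alpha> U"
      by (rule TS)
    also have "\<dots> = (\<lambda>s. ?x \<odot>\<^bsub>Sec E1 U\<^esub> s) ` (\<lambda>s. ?k (inverse c) \<odot>\<^bsub>Sec E1 U\<^esub> s) ` Fil E1 \<alpha> U"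
      by (simp add: image_image)
    also have "(\<lambda>s. ?k (inverse c) \<odot>\<^bsub>Sec E1 U\<^esub> s) ` Fil E1 \<alpha> U = Fil E1 \<alpha> U"
    proof (intro equalityI subsetI)
      fix s assume s: "s \<in> Fil E1 \<alpha> U"
      have "?k (inverse c) \<odot>\<^bsub>Sec E1 U\<^esub> (?k c \<odot>\<^bsub>Sec E1 U\<^esub> s) = (?k (inverse c) \<otimes>\<^bsub>Omer U\<^esub> ?k c) \<odot>\<^bsub>Sec E1 U\<^esub> s"
        using M.smult_assoc1[of "?k (inverse c)" "?k c" s] k Fil_carrier[OF s] by simp
      also have "?k (inverse c) \<otimes>\<^bsub>Omer U\<^esub> ?k c = \<one>\<^bsub>Omer U\<^esub>" using nz by (auto simp: fun_eq_iff)
      also have "\<one>\<^bsub>Omer U\<^esub> \<odot>\<^bsub>Sec E1 U\<^esub> s = s" by (rule M.smult_one[OF Fil_carrier[OF s]])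
      finally have "s = ?k (inverse c) \<odot>\<^bsub>Sec E1 U\<^esub> (?k c \<odot>\<^bsub>Sec E1 U\<^esub> s)" by (rule sym)
      then show "s \<in> (\<lambda>s. ?k (inverse c) \<odot>\<^bsub>Sec E1 U\<^esub> s) ` Fil E1 \<alpha> U" using Fil_k[OF s] by blast
    qed (auto intro: Fil_k)
    finally show "Fil E1 (\<alpha> - 1) U = (\<lambda>s. ?x \<odot>\<^bsub>Sec E1 U\<^esub> s) ` Fil E1 \<alpha> U" .
  qed
  note fil = this
  show ?thesis
    unfolding filtered_bundle_def
    by (intro conjI[OF sh1 conjI[OF free conjI[OF allI[OF sub1]]]] allI[where P = "\<lambda>U. openin CP1 U \<and> U \<subseteq> X \<longrightarrow> _ U"] impI)
       (elim conjE, rule fil)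
qed

lemma standard_line_filtration_transport:
  assumes E2: "module_sheaf (dil c X) E2" and std: "standard_line_filtration (dil c X) E2"
  shows "standard_line_filtration X E1"
proof -
  obtain M2 where M2: "locally_free_O_submodule (dil c X) 1 E2 M2"
      "\<forall>W. openin CP1 W \<and> W \<subseteq> dil c X \<longrightarrow>
         (None \<notin> W \<longrightarrow> M2 W = sections E2 W) \<and>
         (\<forall>\<alpha>. Fil E2 \<alpha> W = {s \<in> sections E2 W. None \<in> W \<longrightarrow>
            (\<exists>W' m f. openin CP1 W' \<and> None \<in> W' \<and> W' \<subseteq> W \<and> m \<in> M2 W' \<and> f \<in> mer W' \<and>
               pole_le \<lfloor>\<alpha>\<rfloor> f \<and> Res E2 W W' s = f \<odot>\<^bsub>Sec E2 W'\<^esub> m)})"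
    using std unfolding standard_line_filtration_def by - (elim exE conjE, rule that)
  define M1 where "M1 W = {s. T s \<in> M2 (dil c W)}" for W
  show ?thesis unfolding standard_line_filtration_def
  proof (intro exI[of _ M1] conjI allI impI)
    show "locally_free_O_submodule X 1 E1 M1"
      by (rule O_submodule_transport[OF E2 _ M2(1)]) (simp add: M1_def)
    fix W assume "openin CP1 W \<and> W \<subseteq> X"
    then have W: "openin CP1 (dil c W) \<and> dil c W \<subseteq> dil c X" by simp
    show "M1 W = sections E1 W" if "None \<notin> W"
      using M2(2)[THEN spec, THEN mp, OF W] that by (simp add: M1_def)
    fix \<alpha>
    have "T s \<in> Fil E2 \<alpha> (dil c W) \<longleftrightarrow> T s \<in> sections E2 (dil c W) \<and> (None \<in> dil c W \<longrightarrow>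
            (\<exists>W' m f. openin CP1 (dil c W') \<and> None \<in> dil c W' \<and> dil c W' \<subseteq> dil c W \<and> 
               T m \<in> M2 (dil c W') \<and> push c f \<in> mer (dil c W') \<and>
               pole_le \<lfloor>\<alpha>\<rfloor> (push c f) \<and> Res E2 (dil c W) (dil c W') (T s) = push c f \<odot>\<^bsub>Sec E2 (dil c W')\<^esub> T m))" for s
      using M2(2)[THEN spec, THEN mp, OF W] by (simp, subst ex_dil, subst ex_T, subst ex_push) simp
    then have "s \<in> Fil E1 \<alpha> W \<longleftrightarrow> s \<in> sections E1 W \<and> (None \<in> W \<longrightarrow>
            (\<exists>W' m f. openin CP1 W' \<and> None \<in> W' \<and> W' \<subseteq> W \<and> m \<in> M1 W' \<and> f \<in> mer W' \<and>
               pole_le \<lfloor>\<alpha>\<rfloor> f \<and> Res E1 W W' s = f \<odot>\<^bsub>Sec E1 W'\<^esub> m))" for s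
      by (simp add: M1_def T_smult mer_extensional flip: T_Res cong: conj_cong)
        (simp flip: T_smult add: mer_extensional cong: conj_cong)
    then show "Fil E1 \<alpha> W = {s \<in> sections E1 W. None \<in> W \<longrightarrow>
            (\<exists>W' m f. openin CP1 W' \<and> None \<in> W' \<and> W' \<subseteq> W \<and> m \<in> M1 W' \<and> f \<in> mer W' \<and>
               pole_le \<lfloor>\<alpha>\<rfloor> f \<and> Res E1 W W' s = f \<odot>\<^bsub>Sec E1 W'\<^esub> m)}" by blast
  qed
qed

end

section \<open>Transport of tensors and Higgs fields\<close>

lemma coord_smult:
  assumes sh: "module_sheaf X E" and V: "openin CP1 V" "V \<subseteq> X" and e: "frame E K V e" 
    and s: "s \<in> carrier (Sec E V)" and f: "f \<in> mer V" and i: "i \<in> {1..K}" "z \<in> fin V"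
  shows "coord E K V e (f \<odot>\<^bsub>Sec E V\<^esub> s) i z = f z * coord E K V e s i z"
proof -
  interpret module "Omer V" "Sec E V" by (rule sheaf_module[OF sh V])
  define x where "x = coord E K V e s"
  have x: "x \<in> {1..K} \<rightarrow>\<^sub>E mer V" "s = lincomb E K V e x"
    using coord_mer[OF sh V e s] lincomb_coord[OF sh V e s] unfolding x_def by auto
  define y where "y = (\<lambda>i\<in>{1..K}. f \<otimes>\<^bsub>Omer V\<^esub> x i)"
  have xi: "x i \<in> carrier (Omer V)" if "i \<in> {1..K}" for i using x(1) that by (auto simp: PiE_iff)
  have fc: "f \<in> carrier (Omer V)" using f by simp
  have y: "y i \<in> carrier (Omer V)" if "i \<in> {1..K}" for i
    using R.m_closed[OF fc xi[OF that]] that by (simp only: y_def restrict_apply if_True)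
  have "f \<odot>\<^bsub>Sec E V\<^esub> s = (\<Oplus>\<^bsub>Sec E V\<^esub>i\<in>{1..K}. f \<odot>\<^bsub>Sec E V\<^esub> (x i \<odot>\<^bsub>Sec E V\<^esub> e i))"
    unfolding x(2) lincomb_def
    by (rule finsum_smult_ldistr) (use fc xi frame_sections[OF e] in \<open>auto intro!: smult_closed\<close>)
  also have "\<dots> = lincomb E K V e y" unfolding lincomb_def
    using y xi fc frame_sections[OF e] by (intro finsum_cong') (auto simp: y_def smult_assoc1 simp del: Omer_simps)
  finally have "coord E K V e (f \<odot>\<^bsub>Sec E V\<^esub> s) = y"
    using y by (intro coord_eqI[OF sh V e _ _ smult_closed[OF fc s]]) (auto simp: y_def)
  then show ?thesis using i by (simp add: y_def x_def)
qed

lemma higgs_closed: 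
  "higgs_field E \<Phi> \<Longrightarrow> openin CP1 U \<Longrightarrow> s \<in> carrier (Sec E U) \<Longrightarrow> \<Phi> U s \<in> carrier (Sec E U)"
  unfolding higgs_field_def sections_def by (simp add: Pi_iff)

context bundle_iso begin

text \<open>The tensor \<open>T1\<close> on \<open>E1\<close> corresponds to \<open>T2\<close> on \<open>E2\<close>. Tensors are families of coefficients, whose
  values at anything but frames carry no meaning; hence only frames are compared.\<close>

definition tensor_corr :: "nat \<Rightarrow> cset \<Rightarrow> 'a tensor \<Rightarrow> 'b tensor \<Rightarrow> bool" where
  "tensor_corr K U T1 T2 \<longleftrightarrow> (\<forall>V e. openin CP1 V \<and> V \<subseteq> U \<and> frame E1 K V e \<longrightarrow> 
     (\<forall>I\<in>multi K. T2 (dil c V) (\<lambda>i. T (e i)) I = push c (T1 V e I)))"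

lemma all_frames_over:
  assumes "module_sheaf UNIV E2"
  shows "(\<forall>V e. openin CP1 V \<and> V \<subseteq> dil c U \<and> frame E2 K V e \<longrightarrow> P V e) \<longleftrightarrow>
    (\<forall>V e. openin CP1 V \<and> V \<subseteq> U \<and> frame E1 K V e \<longrightarrow> P (dil c V) (\<lambda>i. T (e i)))"
proof -
  have "(\<forall>V e. openin CP1 V \<and> V \<subseteq> dil c U \<and> frame E2 K V e \<longrightarrow> P V e) \<longleftrightarrow>
    (\<forall>V e. openin CP1 V \<and> V \<subseteq> U \<and> frame E2 K (dil c V) (\<lambda>i. T (e i)) \<longrightarrow> P (dil c V) (\<lambda>i. T (e i)))"
    by (subst all_dil, subst all_frames) simp
  also have "\<dots> \<longleftrightarrow> (\<forall>V e. openin CP1 V \<and> V \<subseteq> U \<and> frame E1 K V e \<longrightarrow> P (dil c V) (\<lambda>i. T (e i)))"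
    using frame_iff[of UNIV] assms by (metis dil_UNIV subset_UNIV)
  finally show ?thesis .
qed

text \<open>The transition coefficients between two frames of \<open>E1\<close> are, after composition with the dilation,
  those between the corresponding frames of \<open>E2\<close>, so the transformation law is the same on both sides.\<close>

lemma tensor_section_iff:
  assumes sh: "module_sheaf UNIV E2" and corr: "tensor_corr K U T1 T2"
  shows "tensor_section E2 K (dil c U) T2 \<longleftrightarrow> tensor_section E1 K U T1"
  unfolding tensor_section_def all_frames_over[OF sh]
proof (intro all_cong1 imp_cong refl)
  have sh2: "module_sheaf (dil c UNIV) E2" using sh by simp
  note sh1 = module_sheaf_transport[OF sh2]
  have corr': "T2 (dil c V) (\<lambda>i. T (e i)) I = push c (T1 V e I)" 
    if "openin CP1 V" "V \<subseteq> U" "frame E1 K V e" "I \<in> multi K" for V e I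
    using corr that by (simp add: tensor_corr_def)
  fix V e assume *: "openin CP1 V \<and> V \<subseteq> U \<and> frame E1 K V e"
  show "((\<forall>I\<in>multi K. T2 (dil c V) (\<lambda>i. T (e i)) I \<in> mer (dil c V)) \<and>
       (\<forall>W. openin CP1 W \<and> W \<subseteq> dil c V \<longrightarrow>
          (\<forall>I\<in>multi K. T2 W (\<lambda>i. Res E2 (dil c V) W (T (e i))) I = restrict (T2 (dil c V) (\<lambda>i. T (e i)) I) (fin W))) \<and>
       (\<forall>e'. frame E2 K (dil c V) e' \<longrightarrow> (\<forall>I\<in>multi K. \<forall>z\<in>fin (dil c V).
          T2 (dil c V) (\<lambda>i. T (e i)) I z = (\<Sum>J\<in>multi K. (\<Prod>i\<in>{1..K}. 
            coord E2 K (dil c V) (\<lambda>i. T (e i)) (e' (J i)) (I i) z) * T2 (dil c V) e' J z)))) =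
     ((\<forall>I\<in>multi K. T1 V e I \<in> mer V) \<and>
       (\<forall>W. openin CP1 W \<and> W \<subseteq> V \<longrightarrow>
          (\<forall>I\<in>multi K. T1 W (\<lambda>i. Res E1 V W (e i)) I = restrict (T1 V e I) (fin W))) \<and>
       (\<forall>e'. frame E1 K V e' \<longrightarrow> (\<forall>I\<in>multi K. \<forall>z\<in>fin V.
          T1 V e I z = (\<Sum>J\<in>multi K. (\<Prod>i\<in>{1..K}. coord E1 K V e (e' (J i)) (I i) z) * T1 V e' J z))))"
  proof (intro arg_cong2[where f = "(\<and>)"], goal_cases)
    case 1
    show ?case using * by (intro ball_cong) (simp_all add: corr')
  next
    case 2
    have "(\<forall>W. openin CP1 W \<and> W \<subseteq> dil c V \<longrightarrow>
           (\<forall>I\<in>multi K. T2 W (\<lambda>i. Res E2 (dil c V) W (T (e i))) I = restrict (T2 (dil c V) (\<lambda>i. T (e i)) I) (fin W)))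
      \<longleftrightarrow> (\<forall>W. openin CP1 W \<and> W \<subseteq> V \<longrightarrow>
           (\<forall>I\<in>multi K. T2 (dil c W) (\<lambda>i. T (Res E1 V W (e i))) I = restrict (T2 (dil c V) (\<lambda>i. T (e i)) I) (fin (dil c W))))"
      by (subst all_dil) (simp add: T_Res)
    also have "\<dots> \<longleftrightarrow> (\<forall>W. openin CP1 W \<and> W \<subseteq> V \<longrightarrow>
           (\<forall>I\<in>multi K. T1 W (\<lambda>i. Res E1 V W (e i)) I = restrict (T1 V e I) (fin W)))"
    proof (intro all_cong1 imp_cong refl ball_cong, elim conjE)
      fix W I assume W: "openin CP1 W" "W \<subseteq> V" and I: "I \<in> multi K"
      have "frame E1 K W (\<lambda>i. Res E1 V W (e i))"
        using * W by (intro frame_restrict[OF sh1]) auto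
      moreover have "W \<subseteq> U" using * W by auto
      ultimately show "T2 (dil c W) (\<lambda>i. T (Res E1 V W (e i))) I = restrict (T2 (dil c V) (\<lambda>i. T (e i)) I) (fin (dil c W))
        \<longleftrightarrow> T1 W (\<lambda>i. Res E1 V W (e i)) I = restrict (T1 V e I) (fin W)"
        using * W I by (simp add: corr' flip: push_restrict)
    qed
    finally show ?case .
  next
    case 3
    from * have fr: "frame E2 K (dil c V) (\<lambda>i. T (e' i)) \<longleftrightarrow> frame E1 K V e'" for e'
      by (intro frame_iff[OF sh2]) auto
    show ?case
    proof (subst all_frames, unfold fr all_fin_dil, intro all_cong1 imp_cong refl ball_cong)
      fix e' I z assume e': "frame E1 K V e'" and I: "I \<in> multi K" and z: "z \<in> fin V"
      have "coord E2 K (dil c V) (\<lambda>i. T (e i)) (T (e' (J i))) (I i) (c * z) = coord E1 K V e (e' (J i)) (I i) z"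
        if "J \<in> multi K" "i \<in> {1..K}" for J i
      proof -
        have "J i \<in> {1..K}" "I i \<in> {1..K}" using that I by (auto dest: PiE_mem simp del: atLeastAtMost_iff)
        then show ?thesis
          using * frame_sections[OF e'] by (intro coord_T_at[OF sh2, symmetric]) auto
      qed
      then have "(\<Sum>J\<in>multi K. (\<Prod>i\<in>{1..K}. 
          coord E2 K (dil c V) (\<lambda>i. T (e i)) (T (e' (J i))) (I i) (c * z)) * T2 (dil c V) (\<lambda>i. T (e' i)) J (c * z))
        = (\<Sum>J\<in>multi K. (\<Prod>i\<in>{1..K}. coord E1 K V e (e' (J i)) (I i) z) * T1 V e' J z)"
        using * e' by (intro sum.cong refl arg_cong2[where f = "(*)"] prod.cong) (simp_all add: corr')
      then show "(T2 (dil c V) (\<lambda>i. T (e i)) I (c * z) = (\<Sum>J\<in>multi K. (\<Prod>i\<in>{1..K}. 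
          coord E2 K (dil c V) (\<lambda>i. T (e i)) (T (e' (J i))) (I i) (c * z)) * T2 (dil c V) (\<lambda>i. T (e' i)) J (c * z)))
        \<longleftrightarrow> (T1 V e I z = (\<Sum>J\<in>multi K. (\<Prod>i\<in>{1..K}. coord E1 K V e (e' (J i)) (I i) z) * T1 V e' J z))"
        using * e' I by (simp add: corr')
    qed
  qed
qed

lemma multi_permute: "I \<in> multi K \<Longrightarrow> \<pi> permutes {1..K} \<Longrightarrow> I \<circ> \<pi> \<in> multi K"
  by (auto simp: PiE_iff extensional_def permutes_in_image permutes_not_in simp del: atLeastAtMost_iff)

lemma wedge_section_iff:
  assumes sh: "module_sheaf UNIV E2" and corr: "tensor_corr K U T1 T2"
  shows "wedge_section E2 K (dil c U) T2 \<longleftrightarrow> wedge_section E1 K U T1"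
  unfolding wedge_section_def tensor_section_iff[OF assms] all_frames_over[OF sh] all_fin_dil
proof (intro conj_cong refl all_cong1 imp_cong ball_cong)
  fix V e \<pi> I z assume V: "openin CP1 V \<and> V \<subseteq> U \<and> frame E1 K V e" and I: "\<pi> permutes {1..K}" "I \<in> multi K"
  have corr': "T2 (dil c V) (\<lambda>i. T (e i)) J = push c (T1 V e J)" if "J \<in> multi K" for J
    using corr V that by (simp add: tensor_corr_def)
  show "T2 (dil c V) (\<lambda>i. T (e i)) (I \<circ> \<pi>) (c * z) = of_int (sign \<pi>) * T2 (dil c V) (\<lambda>i. T (e i)) I (c * z) \<longleftrightarrow>
    T1 V e (I \<circ> \<pi>) z = of_int (sign \<pi>) * T1 V e I z"
    unfolding corr'[OF I(2)] corr'[OF multi_permute[OF I(2,1)]] by simp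
qed

lemma bij_push: "bij (push c)"
  by (rule bij_betw_byWitness[where f' = "push (inverse c)"]) auto

text \<open>A wedge section \<open>\<eta>1\<close> of \<open>E1\<close> comes from one of \<open>E2\<close>, namely \<open>\<eta>2\<close> below; the function that expresses
  \<open>\<eta>2\<close> by \<open>\<omega>2\<close>, composed with the dilation, expresses \<open>\<eta>1\<close> by \<open>\<omega>1\<close>.\<close>

lemma trivializes_transport:
  assumes sh: "module_sheaf UNIV E2" and corr: "tensor_corr K UNIV \<omega>1 \<omega>2"
    and triv: "trivializes_on_C E2 K \<omega>2"
  shows "trivializes_on_C E1 K \<omega>1"
  unfolding trivializes_on_C_def
proof (intro allI impI; elim conjE)
  fix U \<eta>1 assume U: "openin CP1 U" "None \<notin> U" and \<eta>1: "wedge_section E1 K U \<eta>1"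
  define \<eta>2 :: "'b tensor" where "\<eta>2 V e I = push c (\<eta>1 (dil (inverse c) V) (\<lambda>i. inv_into UNIV T (e i)) I)" for V e I
  have \<eta>2: "\<eta>2 (dil c V) (\<lambda>i. T (e i)) I = push c (\<eta>1 V e I)" for V e I
    by (simp add: \<eta>2_def)
  have "tensor_corr K U \<eta>1 \<eta>2" by (simp add: tensor_corr_def \<eta>2)
  then have "wedge_section E2 K (dil c U) \<eta>2" using wedge_section_iff[OF sh] \<eta>1 by simp
  then have "\<exists>!f. f \<in> mer (dil c U) \<and> (\<forall>V e. openin CP1 V \<and> V \<subseteq> dil c U \<and> frame E2 K V e \<longrightarrow>
          (\<forall>I\<in>multi K. \<forall>z\<in>fin V. \<eta>2 V e I z = f z * \<omega>2 V e I z))"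
    using triv[unfolded trivializes_on_C_def, THEN spec, THEN spec, THEN mp] U by simp
  then have "\<exists>!f. f \<in> mer U \<and> (\<forall>V e. openin CP1 V \<and> V \<subseteq> U \<and> frame E1 K V e \<longrightarrow>
          (\<forall>I\<in>multi K. \<forall>z\<in>fin V. \<eta>1 V e I z = f z * \<omega>2 (dil c V) (\<lambda>i. T (e i)) I (c * z)))"
    unfolding all_frames_over[OF sh] all_fin_dil \<eta>2 by (subst (asm) bij_ex1[OF bij_push]) simp
  then show "\<exists>!f. f \<in> mer U \<and> (\<forall>V e. openin CP1 V \<and> V \<subseteq> U \<and> frame E1 K V e \<longrightarrow>
          (\<forall>I\<in>multi K. \<forall>z\<in>fin V. \<eta>1 V e I z = f z * \<omega>1 V e I z))"
    using corr by (simp add: tensor_corr_def cong: conj_cong imp_cong)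
qed

lemma tensor_Fil_iff:
  assumes fil: "filtered_bundle UNIV K E2" and corr: "tensor_corr K UNIV T1 T2"
  shows "tensor_Fil E2 K \<alpha> T2 \<longleftrightarrow> tensor_Fil E1 K \<alpha> T1"
proof -
  have sh: "module_sheaf UNIV E2" using fil by (simp add: filtered_bundle_def)
  have sh2: "module_sheaf (dil c UNIV) E2" using sh by simp
  note sh1 = module_sheaf_transport[OF sh2]
  have fil1: "filtered_bundle UNIV K E1" using fil by (intro filtered_bundle_transport) simp
  have ex_sections: "(\<exists>s. P s) \<longleftrightarrow> (\<exists>s. P (\<lambda>j i. T (s j i)))" for P :: "(nat \<Rightarrow> nat \<Rightarrow> 'b) \<Rightarrow> bool"
  proof
    assume "\<exists>s. P s"
    then obtain s where "P s" ..
    then have "P (\<lambda>j i. T (inv_into UNIV T (s j i)))" by simp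
    then show "\<exists>s. P (\<lambda>j i. T (s j i))" by (rule exI[where P = "\<lambda>s. P (\<lambda>j i. T (s j i))"])
  qed auto
  have "(\<forall>W e. openin CP1 W \<and> W \<subseteq> dil c V \<and> frame E2 K W e \<longrightarrow>
          (\<forall>I\<in>multi K. \<forall>z\<in>fin W.
             T2 W e I z = (\<Sum>j<m. \<Prod>i\<in>{1..K}. coord E2 K W e (Res E2 (dil c V) W (T (s j i))) (I i) z)))
     \<longleftrightarrow> (\<forall>W e. openin CP1 W \<and> W \<subseteq> V \<and> frame E1 K W e \<longrightarrow>
          (\<forall>I\<in>multi K. \<forall>z\<in>fin W.
             T1 W e I z = (\<Sum>j<m. \<Prod>i\<in>{1..K}. coord E1 K W e (Res E1 V W (s j i)) (I i) z)))"
    if V: "openin CP1 V" and s: "\<forall>j<m. \<forall>i\<in>{1..K}. s j i \<in> Fil E1 (\<beta> j i) V" for V m \<beta> s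
    unfolding all_frames_over[OF sh] all_fin_dil T_Res[symmetric]
  proof (intro all_cong1 imp_cong refl ball_cong, elim conjE)
    fix W e I z assume W: "openin CP1 W" "W \<subseteq> V" "frame E1 K W e" and I: "I \<in> multi K" and z: "z \<in> fin W"
    have "coord E2 K (dil c W) (\<lambda>i. T (e i)) (T (Res E1 V W (s j i))) (I i) (c * z) =
      coord E1 K W e (Res E1 V W (s j i)) (I i) z" if "j < m" "i \<in> {1..K}" for j i
    proof (rule coord_T_at[OF sh2, symmetric])
      have "locally_free_O_submodule UNIV K E1 (Fil E1 (\<beta> j i))"
        using fil1 by (simp add: filtered_bundle_def)
      then have "s j i \<in> carrier (Sec E1 V)" 
        using s that O_submoduleD(1)[OF _ V] by blast
      then show "Res E1 V W (s j i) \<in> carrier (Sec E1 W)"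
        using W by (intro sheaf_Res_closed[OF sh1 V]) auto
    qed (use W I that in auto)
    then have "(\<Sum>j<m. \<Prod>i\<in>{1..K}. 
        coord E2 K (dil c W) (\<lambda>i. T (e i)) (T (Res E1 V W (s j i))) (I i) (c * z)) = 
        (\<Sum>j<m. \<Prod>i\<in>{1..K}. coord E1 K W e (Res E1 V W (s j i)) (I i) z)"
      by (intro sum.cong prod.cong refl) simp_all
    then show "(T2 (dil c W) (\<lambda>i. T (e i)) I (c * z) = (\<Sum>j<m. \<Prod>i\<in>{1..K}. 
        coord E2 K (dil c W) (\<lambda>i. T (e i)) (T (Res E1 V W (s j i))) (I i) (c * z))) \<longleftrightarrow>
      (T1 W e I z = (\<Sum>j<m. \<Prod>i\<in>{1..K}. coord E1 K W e (Res E1 V W (s j i)) (I i) z))"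
      using corr W I by (simp add: tensor_corr_def)
  qed
  note main = this
  show ?thesis
    unfolding tensor_Fil_def
    by (subst ex_dil, subst ex_sections, intro ex_cong1, unfold openin_dil None_dil T_Fil, 
        intro conj_cong refl main) auto
qed

lemma filtered_SL_bundle_transport:
  assumes "filtered_SL_bundle K E2 \<omega>2" and corr: "tensor_corr K UNIV \<omega>1 \<omega>2"
  shows "filtered_SL_bundle K E1 \<omega>1"
proof -
  from assms(1) have fil: "filtered_bundle UNIV K E2" and w: "wedge_section E2 K UNIV \<omega>2"
     and triv: "trivializes_on_C E2 K \<omega>2" and ord: "tensor_order E2 K \<omega>2 = 0"
    by (auto simp: filtered_SL_bundle_def)
  have sh: "module_sheaf UNIV E2" using fil by (simp add: filtered_bundle_def)
  have "filtered_bundle UNIV K E1" using fil by (intro filtered_bundle_transport) simp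
  moreover have "wedge_section E1 K UNIV \<omega>1" using wedge_section_iff[OF sh corr] w by simp
  moreover have "trivializes_on_C E1 K \<omega>1" by (rule trivializes_transport[OF sh corr triv])
  moreover have "tensor_order E1 K \<omega>1 = 0"
    using ord by (simp add: tensor_order_def tensor_Fil_iff[OF fil corr])
  ultimately show ?thesis by (simp add: filtered_SL_bundle_def)
qed

text \<open>The constant \<open>a\<close> makes room for the two factors in the action: \<open>c\<close> from pulling back \<open>dz\<close>, and \<open>e\<^sup>t\<close>.\<close>

definition higgs_corr :: "complex \<Rightarrow> 'a higgs \<Rightarrow> 'b higgs \<Rightarrow> bool" where
  "higgs_corr a \<Phi>1 \<Phi>2 \<longleftrightarrow> (\<forall>U. openin CP1 U \<longrightarrow> (\<forall>s\<in>carrier (Sec E1 U).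
     T (\<Phi>1 U s) = (\<lambda>z\<in>fin (dil c U). a) \<odot>\<^bsub>Sec E2 (dil c U)\<^esub> \<Phi>2 (dil c U) (T s)))"

lemma higgs_field_transport:
  assumes sh: "module_sheaf UNIV E2" and \<Phi>2: "higgs_field E2 \<Phi>2" and corr: "higgs_corr a \<Phi>1 \<Phi>2"
  shows "higgs_field E1 \<Phi>1"
proof -
  have sh2: "module_sheaf (dil c UNIV) E2" using sh by simp
  note sh1 = module_sheaf_transport[OF sh2]
  have TI: "T s = T t \<Longrightarrow> s = t" for s t by simp
  have TC: "T s \<in> carrier (Sec E2 (dil c U)) \<Longrightarrow> s \<in> carrier (Sec E1 U)" for s U by simp
  have \<Phi>1: "T (\<Phi>1 U s) = (\<lambda>z\<in>fin (dil c U). a) \<odot>\<^bsub>Sec E2 (dil c U)\<^esub> \<Phi>2 (dil c U) (T s)"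
    if "openin CP1 U" "s \<in> carrier (Sec E1 U)" for U s
    using corr that by (simp add: higgs_corr_def)
  have H2: "\<Phi>2 U s \<in> carrier (Sec E2 U)" 
    "\<And>t. t \<in> carrier (Sec E2 U) \<Longrightarrow> \<Phi>2 U (s \<oplus>\<^bsub>Sec E2 U\<^esub> t) = \<Phi>2 U s \<oplus>\<^bsub>Sec E2 U\<^esub> \<Phi>2 U t"
    "\<And>f. f \<in> mer U \<Longrightarrow> \<Phi>2 U (f \<odot>\<^bsub>Sec E2 U\<^esub> s) = f \<odot>\<^bsub>Sec E2 U\<^esub> \<Phi>2 U s"
    "\<And>V. openin CP1 V \<Longrightarrow> V \<subseteq> U \<Longrightarrow> Res E2 U V (\<Phi>2 U s) = \<Phi>2 V (Res E2 U V s)"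
    if "openin CP1 U" "s \<in> carrier (Sec E2 U)" for U s
    using \<Phi>2 that by (auto simp: higgs_field_def sections_def)
  have k: "(\<lambda>z\<in>fin U. a) \<in> carrier (Omer U)" if "openin CP1 U" for U
    using mer_const that by simp
  have 1: "\<Phi>1 U s \<in> carrier (Sec E1 U)" if U: "openin CP1 U" and s: "s \<in> carrier (Sec E1 U)" for U s
  proof -
    interpret M: module "Omer (dil c U)" "Sec E2 (dil c U)" using U sh by (intro sheaf_module) auto
    show ?thesis using U s H2(1)[of "dil c U" "T s"] k[of "dil c U"] 
      by (intro TC) (auto simp: \<Phi>1 simp del: Omer_simps intro!: M.smult_closed)
  qed
  have 2: "\<Phi>1 U (s \<oplus>\<^bsub>Sec E1 U\<^esub> t) = \<Phi>1 U s \<oplus>\<^bsub>Sec E1 U\<^esub> \<Phi>1 U t" 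
    if U: "openin CP1 U" and s: "s \<in> carrier (Sec E1 U)" and t: "t \<in> carrier (Sec E1 U)" for U s t
  proof -
    interpret M: module "Omer (dil c U)" "Sec E2 (dil c U)" using U sh by (intro sheaf_module) auto
    interpret M1: module "Omer U" "Sec E1 U" using U by (intro sheaf_module[OF sh1]) auto
    show ?thesis using U s t k[of "dil c U"] H2[of "dil c U"]
      by (intro TI) (simp add: \<Phi>1 T_add M.smult_r_distr del: Omer_simps)
  qed
  have 3: "\<Phi>1 U (f \<odot>\<^bsub>Sec E1 U\<^esub> s) = f \<odot>\<^bsub>Sec E1 U\<^esub> \<Phi>1 U s" 
    if U: "openin CP1 U" and s: "s \<in> carrier (Sec E1 U)" and f: "f \<in> mer U" for U s f
  proof -
    interpret M: module "Omer (dil c U)" "Sec E2 (dil c U)" using U sh by (intro sheaf_module) auto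
    interpret M1: module "Omer U" "Sec E1 U" using U by (intro sheaf_module[OF sh1]) auto
    let ?a = "\<lambda>z\<in>fin (dil c U). a"
    have f': "f \<in> carrier (Omer U)" "push c f \<in> carrier (Omer (dil c U))" "?a \<in> carrier (Omer (dil c U))" 
      using f k U by simp_all
    have "T (\<Phi>1 U (f \<odot>\<^bsub>Sec E1 U\<^esub> s)) = ?a \<odot>\<^bsub>Sec E2 (dil c U)\<^esub> (push c f \<odot>\<^bsub>Sec E2 (dil c U)\<^esub> \<Phi>2 (dil c U) (T s))"
      using U s f f' H2(3)[of "dil c U" "T s" "push c f"] mer_extensional[OF f] by (simp add: \<Phi>1 T_smult)
    also have "\<dots> = push c f \<odot>\<^bsub>Sec E2 (dil c U)\<^esub> (?a \<odot>\<^bsub>Sec E2 (dil c U)\<^esub> \<Phi>2 (dil c U) (T s))"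
      using U s H2(1)[of "dil c U" "T s"] M.smult_assoc1[OF f'(2,3)] M.smult_assoc1[OF f'(3,2)]
        M.R.m_comm[OF f'(2,3)] by simp
    also have "\<dots> = T (f \<odot>\<^bsub>Sec E1 U\<^esub> \<Phi>1 U s)"
      using U s mer_extensional[OF f] by (simp add: \<Phi>1 T_smult)
    finally show ?thesis by simp
  qed
  have 4: "Res E1 U V (\<Phi>1 U s) = \<Phi>1 V (Res E1 U V s)"
    if UV: "openin CP1 U" "openin CP1 V" "V \<subseteq> U" and s: "s \<in> carrier (Sec E1 U)" for U V s
  proof -
    let ?a = "\<lambda>z\<in>fin (dil c U). a"
    have a: "?a \<in> mer (dil c U)" "restrict ?a (fin (dil c V)) = (\<lambda>z\<in>fin (dil c V). a)"
      using UV mer_const[of "dil c U" a] by (simp, force simp: fun_eq_iff fin_def)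
    have smult: "Res E2 (dil c U) (dil c V) (?a \<odot>\<^bsub>Sec E2 (dil c U)\<^esub> t) = 
        (\<lambda>z\<in>fin (dil c V). a) \<odot>\<^bsub>Sec E2 (dil c V)\<^esub> Res E2 (dil c U) (dil c V) t"
      if "t \<in> carrier (Sec E2 (dil c U))" for t
      unfolding a(2)[symmetric] using sh UV a(1) that 
      by (simp add: module_sheaf_def del: restrict_restrict)
    show ?thesis
      using UV s H2[of "dil c U" "T s"] a(1) sheaf_Res_closed[OF sh1 UV _ s]
      by (intro TI) (simp add: T_Res \<Phi>1 smult)
  qed
  show ?thesis unfolding higgs_field_def sections_def
    by (intro conjI allI impI ballI Pi_I; (elim conjE)?; rule 1 2 3 4; assumption)
qed

lemma traceless_transport:
  assumes sh: "module_sheaf UNIV E2" and \<Phi>2: "higgs_field E2 \<Phi>2" "traceless E2 K \<Phi>2" 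
    and corr: "higgs_corr a \<Phi>1 \<Phi>2"
  shows "traceless E1 K \<Phi>1"
  unfolding traceless_def
proof (intro allI impI ballI; elim conjE)
  have sh2: "module_sheaf (dil c UNIV) E2" using sh by simp
  fix V e z assume V: "openin CP1 V" and e: "frame E1 K V e" and z: "z \<in> fin V"
  let ?Te = "\<lambda>i. T (e i)"
  have V2: "openin CP1 (dil c V)" using V by simp
  have e2: "frame E2 K (dil c V) ?Te" using frame_iff[OF sh2 V] e by simp
  have "coord E1 K V e (\<Phi>1 V (e i)) i z = a * coord E2 K (dil c V) ?Te (\<Phi>2 (dil c V) (T (e i))) i (c * z)"
    if i: "i \<in> {1..K}" for i
  proof -
    have ei: "e i \<in> carrier (Sec E1 V)" using frame_sections[OF e i] .
    have "\<Phi>1 V (e i) \<in> carrier (Sec E1 V)"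
      using higgs_field_transport[OF sh \<Phi>2(1) corr] V ei by (rule higgs_closed)
    then have "coord E1 K V e (\<Phi>1 V (e i)) i z = coord E2 K (dil c V) ?Te (T (\<Phi>1 V (e i))) i (c * z)"
      using V e i by (intro coord_T_at[OF sh2]) auto
    also have "T (\<Phi>1 V (e i)) = (\<lambda>z\<in>fin (dil c V). a) \<odot>\<^bsub>Sec E2 (dil c V)\<^esub> \<Phi>2 (dil c V) (T (e i))"
      using corr V ei by (simp add: higgs_corr_def)
    also have "coord E2 K (dil c V) ?Te \<dots> i (c * z) = 
        (\<lambda>z\<in>fin (dil c V). a) (c * z) * coord E2 K (dil c V) ?Te (\<Phi>2 (dil c V) (T (e i))) i (c * z)"
      using ei z i nz mer_const[OF V2]
      by (intro coord_smult[OF sh V2 _ e2] higgs_closed[OF \<Phi>2(1) V2]) auto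
    finally show ?thesis using z nz by simp
  qed
  then have "(\<Sum>i\<in>{1..K}. coord E1 K V e (\<Phi>1 V (e i)) i z) = 
      a * (\<Sum>i\<in>{1..K}. coord E2 K (dil c V) ?Te (\<Phi>2 (dil c V) (T (e i))) i (c * z))"
    by (simp add: sum_distrib_left)
  also have "(\<Sum>i\<in>{1..K}. coord E2 K (dil c V) ?Te (\<Phi>2 (dil c V) (T (e i))) i (c * z)) = 0"
    using \<Phi>2(2)[unfolded traceless_def, THEN spec, THEN spec, THEN mp, OF conjI[OF V2 e2], THEN bspec] z nz by simp
  finally show "(\<Sum>i\<in>{1..K}. coord E1 K V e (\<Phi>1 V (e i)) i z) = 0" by simp
qed

end

section \<open>The pullback of a filtered SL(K)-Higgs bundle\<close>

context dilation begin

lemma inv_mult: "inv_into UNIV ((*) c) z = z / c"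
  using nz by (intro inv_into_f_eq) (auto intro: injI)

lemma deriv_mult: "deriv ((*) c) z = c"
  by (rule DERIV_imp_deriv) (auto intro!: derivative_eq_intros)

lemma pullback_simps:
  "carrier (Sec (pullback ((*) c) E) U) = carrier (Sec E (dil c U))"
  "\<zero>\<^bsub>Sec (pullback ((*) c) E) U\<^esub> = \<zero>\<^bsub>Sec E (dil c U)\<^esub>"
  "s \<oplus>\<^bsub>Sec (pullback ((*) c) E) U\<^esub> t = s \<oplus>\<^bsub>Sec E (dil c U)\<^esub> t"
  "(f :: complex \<Rightarrow> complex) \<odot>\<^bsub>Sec (pullback ((*) c) E) U\<^esub> s = restrict (push c f) (fin (dil c U)) \<odot>\<^bsub>Sec E (dil c U)\<^esub> s"
  "Res (pullback ((*) c) E) U V = Res E (dil c U) (dil c V)"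
  "Fil (pullback ((*) c) E) \<alpha> U = Fil E \<alpha> (dil c U)"
  by (simp_all add: pullback_def Let_def dil_def[symmetric] inv_mult push_def)

text \<open>Sections of the pullback over \<open>U\<close> are by construction sections over the image of \<open>U\<close>, so the
  isomorphism is the identity on sections.\<close>

lemma pullback_iso: "bundle_iso c (pullback ((*) c) E) E (\<lambda>s. s)"
proof (unfold_locales)
  fix f :: "complex \<Rightarrow> complex" and U s assume f: "f \<in> extensional (fin U)"
  have "restrict (push c f) (fin (dil c U)) = push c f"
    using f by (intro extensional_restrict) simp
  then show "f \<odot>\<^bsub>Sec (pullback ((*) c) E) U\<^esub> s = push c f \<odot>\<^bsub>Sec E (dil c U)\<^esub> s"
    by (simp add: pullback_simps)
qed (simp_all add: pullback_simps bij_def inj_def)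

lemma pullback_tensor_corr:
  assumes sh: "module_sheaf UNIV E" and w: "tensor_section E K UNIV \<omega>"
  shows "bundle_iso.tensor_corr c (pullback ((*) c) E) (\<lambda>s. s) K UNIV (pullback_tensor ((*) c) \<omega>) \<omega>"
proof -
  interpret bundle_iso c "pullback ((*) c) E" E "\<lambda>s. s" by (rule pullback_iso)
  show ?thesis unfolding tensor_corr_def
  proof (intro allI impI ballI; elim conjE)
    fix V e I assume V: "openin CP1 V" and e: "frame (pullback ((*) c) E) K V e" and I: "I \<in> multi K"
    have "frame E K (dil c V) e" using frame_iff[of UNIV V K e] sh V e by simp
    then have "\<omega> (dil c V) e I \<in> mer (dil c V)"
      using w V I unfolding tensor_section_def by simp
    then have "restrict (\<omega> (dil c V) e I) (fin (dil c V)) = \<omega> (dil c V) e I"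
      by (intro extensional_restrict mer_extensional)
    moreover have "restrict (\<omega> (dil c V) e I) (fin (dil c V)) = push c (pullback_tensor ((*) c) \<omega> V e I)"
      using nz by (auto simp: pullback_tensor_def push_def dil_def[symmetric] fun_eq_iff)
    ultimately show "\<omega> (dil c V) e I = push c (pullback_tensor ((*) c) \<omega> V e I)" by simp
  qed
qed

lemma pullback_higgs_corr:
  assumes sh: "module_sheaf UNIV E" and \<Phi>: "higgs_field E \<Phi>"
  shows "bundle_iso.higgs_corr c (pullback ((*) c) E) E (\<lambda>s. s) (b * c) 
      (scale_higgs b (pullback ((*) c) E) (pullback_higgs ((*) c) E \<Phi>)) \<Phi>"
proof -
  show ?thesis unfolding bundle_iso.higgs_corr_def[OF pullback_iso]
  proof (intro allI impI ballI)
    fix U s assume U: "openin CP1 U" and s: "s \<in> carrier (Sec (pullback ((*) c) E) U)"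
    interpret M: module "Omer (dil c U)" "Sec E (dil c U)" using U sh by (intro sheaf_module) auto
    let ?k = "\<lambda>a. \<lambda>z\<in>fin (dil c U). a"
    have k: "restrict (push c (\<lambda>z\<in>fin U. a)) (fin (dil c U)) = ?k a" for a :: complex
      by (auto simp: push_def fun_eq_iff)
    have "\<Phi> (dil c U) s \<in> carrier (Sec E (dil c U))"
      using U s by (intro higgs_closed[OF \<Phi>]) (simp_all add: pullback_simps)
    note \<Phi>s = this
    have "scale_higgs b (pullback ((*) c) E) (pullback_higgs ((*) c) E \<Phi>) U s = 
        ?k b \<odot>\<^bsub>Sec E (dil c U)\<^esub> (?k c \<odot>\<^bsub>Sec E (dil c U)\<^esub> \<Phi> (dil c U) s)"
      by (simp add: scale_higgs_def pullback_higgs_def pullback_simps deriv_mult k dil_def[symmetric])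
    also have "?k b \<odot>\<^bsub>Sec E (dil c U)\<^esub> (?k c \<odot>\<^bsub>Sec E (dil c U)\<^esub> \<Phi> (dil c U) s) = 
        (?k b \<otimes>\<^bsub>Omer (dil c U)\<^esub> ?k c) \<odot>\<^bsub>Sec E (dil c U)\<^esub> \<Phi> (dil c U) s"
      using mer_const[of "dil c U"] U by (intro M.smult_assoc1[symmetric] \<Phi>s) auto
    also have "?k b \<otimes>\<^bsub>Omer (dil c U)\<^esub> ?k c = ?k (b * c)" by (auto simp: fun_eq_iff)
    finally show "scale_higgs b (pullback ((*) c) E) (pullback_higgs ((*) c) E \<Phi>) U s = 
        ?k (b * c) \<odot>\<^bsub>Sec E (dil c U)\<^esub> \<Phi> (dil c U) s" .
  qed
qed

lemma filtered_SL_Higgs_bundle_pullback: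
  assumes "filtered_SL_Higgs_bundle K (E, \<omega>, \<Phi>)"
  shows "filtered_SL_Higgs_bundle K (pullback ((*) c) E, pullback_tensor ((*) c) \<omega>,
     scale_higgs b (pullback ((*) c) E) (pullback_higgs ((*) c) E \<Phi>))"
proof -
  interpret bundle_iso c "pullback ((*) c) E" E "\<lambda>s. s" by (rule pullback_iso)
  from assms have SL: "filtered_SL_bundle K E \<omega>" and H: "higgs_field E \<Phi>" "traceless E K \<Phi>"
    by (auto simp: filtered_SL_Higgs_bundle_def)
  then have sh: "module_sheaf UNIV E" and w: "tensor_section E K UNIV \<omega>" 
    by (auto simp: filtered_SL_bundle_def filtered_bundle_def wedge_section_def)
  note corr = pullback_higgs_corr[OF sh H(1), of b]
  show ?thesis
    using filtered_SL_bundle_transport[OF SL pullback_tensor_corr[OF sh w]]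
      higgs_field_transport[OF sh H(1) corr] traceless_transport[OF sh H corr]
    by (simp add: filtered_SL_Higgs_bundle_def)
qed

end

section \<open>The decomposition on the ramified covering\<close>

lemma ex1_bij_betw: 
  assumes "bij_betw g S1 S2" shows "(\<exists>!y. y \<in> S2 \<and> Q y) \<longleftrightarrow> (\<exists>!x. x \<in> S1 \<and> Q (g x))"
proof -
  have "inj_on g S1" and S2: "S2 = g ` S1" using assms by (auto simp: bij_betw_def)
  then show ?thesis unfolding S2 Ex1_def by (blast dest: inj_onD)
qed

context bundle_iso begin

lemma bij_betw_PiE:
  "bij_betw (\<lambda>\<tau>. \<lambda>i\<in>I. T (\<tau> i)) (\<Pi>\<^sub>E i\<in>I. {s. T s \<in> A i}) (\<Pi>\<^sub>E i\<in>I. A i)"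
  by (rule bij_betw_byWitness[where f' = "\<lambda>\<tau>. \<lambda>i\<in>I. inv_into UNIV T (\<tau> i)"])
    (auto simp: PiE_iff extensional_def fun_eq_iff)

lemma subbundle_iso:
  "bundle_iso c (subbundle E1 (\<lambda>W. {s. T s \<in> A (dil c W)}) (\<lambda>\<alpha> W. {s. T s \<in> B \<alpha> (dil c W)}))
     (subbundle E2 A B) T"
  by unfold_locales (simp_all add: subbundle_def bijT T_zero T_add T_smult T_Res)

text \<open>The components of a section of \<open>E1\<close> are the preimages under \<open>T\<close> of the components of its image.\<close>

lemma decomposition_transport:
  assumes mon: "\<And>W. openin CP1 W \<Longrightarrow> abelian_monoid (Sec E1 W)" "\<And>W. openin CP1 W \<Longrightarrow> abelian_monoid (Sec E2 W)"
    and dec: "filtered_decomposition (dil c X) E2 K A B"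
    and BA: "\<And>r \<alpha> W. \<lbrakk>r \<in> {1..K}; openin CP1 W; W \<subseteq> dil c X\<rbrakk> \<Longrightarrow> B r \<alpha> W \<subseteq> A r W"
  shows "filtered_decomposition X E1 K (\<lambda>r W. {s. T s \<in> A r (dil c W)}) (\<lambda>r \<alpha> W. {s. T s \<in> B r \<alpha> (dil c W)})"
  unfolding filtered_decomposition_def
proof (intro allI impI conjI; elim conjE)
  fix W assume W: "openin CP1 W" "W \<subseteq> X"
  let ?W = "dil c W" and ?T = "\<lambda>\<tau>. \<lambda>r\<in>{1..K}. T (\<tau> r)"
  have W2: "openin CP1 ?W" "?W \<subseteq> dil c X" using W by auto
  note D = dec[unfolded filtered_decomposition_def, THEN spec, THEN mp, OF conjI[OF W2]]
  have A: "T s \<in> A r ?W \<Longrightarrow> s \<in> carrier (Sec E1 W)" if "r \<in> {1..K}" for r s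
    using D[THEN conjunct1] that by (auto simp: sections_def simp flip: carrier_iff)
  interpret M2: abelian_monoid "Sec E2 ?W" by (rule mon(2)[OF W2(1)])
  have fs: "finsum (Sec E2 ?W) (?T \<tau>) {1..K} = T (finsum (Sec E1 W) \<tau> {1..K})" 
    if "\<tau> \<in> (\<Pi>\<^sub>E r\<in>{1..K}. {s. T s \<in> A r ?W})" for \<tau>
  proof -
    have \<tau>: "\<tau> \<in> {1..K} \<rightarrow> carrier (Sec E1 W)" using that A by (auto simp: PiE_iff)
    have "T (finsum (Sec E1 W) \<tau> {1..K}) = finsum (Sec E2 ?W) (\<lambda>r. T (\<tau> r)) {1..K}"
      using mon W W2 \<tau> by (intro finsum_T) auto
    also have "\<dots> = finsum (Sec E2 ?W) (?T \<tau>) {1..K}"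
      using \<tau> by (intro M2.finsum_cong') (auto simp: Pi_iff)
    finally show ?thesis by simp
  qed
  show "\<forall>r\<in>{1..K}. {s. T s \<in> A r ?W} \<subseteq> sections E1 W"
    using A by (auto simp: sections_def)
  show "\<forall>\<sigma>\<in>sections E1 W. \<exists>!\<tau>. \<tau> \<in> (\<Pi>\<^sub>E r\<in>{1..K}. {s. T s \<in> A r ?W}) \<and> \<sigma> = finsum (Sec E1 W) \<tau> {1..K}"
  proof
    fix \<sigma> assume "\<sigma> \<in> sections E1 W"
    then have "T \<sigma> \<in> sections E2 ?W" by simp
    then have "\<exists>!\<tau>. \<tau> \<in> (\<Pi>\<^sub>E r\<in>{1..K}. A r ?W) \<and> T \<sigma> = finsum (Sec E2 ?W) \<tau> {1..K}"
      by (rule D[THEN conjunct2, THEN conjunct1, THEN bspec])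
    then have "\<exists>!\<tau>. \<tau> \<in> (\<Pi>\<^sub>E r\<in>{1..K}. {s. T s \<in> A r ?W}) \<and> T \<sigma> = finsum (Sec E2 ?W) (?T \<tau>) {1..K}"
      by (subst (asm) ex1_bij_betw[OF bij_betw_PiE])
    then show "\<exists>!\<tau>. \<tau> \<in> (\<Pi>\<^sub>E r\<in>{1..K}. {s. T s \<in> A r ?W}) \<and> \<sigma> = finsum (Sec E1 W) \<tau> {1..K}"
      by (rule iffD1[OF arg_cong[where f = Ex1], rotated]) (intro ext conj_cong refl, simp only: fs T_eq)
  qed
  fix \<alpha>
  have img: "(\<Pi>\<^sub>E r\<in>{1..K}. B r \<alpha> ?W) = ?T ` (\<Pi>\<^sub>E r\<in>{1..K}. {s. T s \<in> B r \<alpha> ?W})"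
    using bij_betw_PiE by (rule bij_betw_imp_surj_on[symmetric])
  have PiBA: "\<tau> \<in> (\<Pi>\<^sub>E r\<in>{1..K}. {s. T s \<in> A r ?W})" if "\<tau> \<in> (\<Pi>\<^sub>E r\<in>{1..K}. {s. T s \<in> B r \<alpha> ?W})" for \<tau>
    using that subsetD[OF BA[OF _ W2]] unfolding PiE_iff mem_Collect_eq by blast
  have "s \<in> Fil E1 \<alpha> W \<longleftrightarrow> T s \<in> Fil E2 \<alpha> ?W" for s by simp
  also have "T s \<in> Fil E2 \<alpha> ?W \<longleftrightarrow> (\<exists>\<tau>\<in>(\<Pi>\<^sub>E r\<in>{1..K}. B r \<alpha> ?W). T s = finsum (Sec E2 ?W) \<tau> {1..K})" for s
    unfolding D[THEN conjunct2, THEN conjunct2, THEN spec] by blast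
  also have "(\<exists>\<tau>\<in>(\<Pi>\<^sub>E r\<in>{1..K}. B r \<alpha> ?W). T s = finsum (Sec E2 ?W) \<tau> {1..K}) \<longleftrightarrow>
     (\<exists>\<tau>\<in>(\<Pi>\<^sub>E r\<in>{1..K}. {s. T s \<in> B r \<alpha> ?W}). s = finsum (Sec E1 W) \<tau> {1..K})" for s
    unfolding img bex_simps using fs[OF PiBA] by (simp cong: bex_cong)
  finally show "Fil E1 \<alpha> W = {finsum (Sec E1 W) \<tau> {1..K} |\<tau>. \<tau> \<in> (\<Pi>\<^sub>E r\<in>{1..K}. {s. T s \<in> B r \<alpha> ?W})}"
    by blast
qed

end

context dilation begin

lemma pullback_frame_iff:
  assumes "module_sheaf UNIV E" "openin CP1 V"
  shows "frame (pullback ((*) c) E) K V e \<longleftrightarrow> frame E K (dil c V) e"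
  using bundle_iso.frame_iff[OF pullback_iso, of UNIV E V K e] assms by simp

lemma pullback_coord:
  assumes "module_sheaf UNIV E" "openin CP1 V" "frame E K (dil c V) e" 
    "s \<in> carrier (Sec E (dil c V))" "i \<in> {1..K}"
  shows "coord (pullback ((*) c) E) K V e s i z = coord E K (dil c V) e s i (c * z)"
  using bundle_iso.coord_T_at[OF pullback_iso, of UNIV E V K e s i z] assms 
  by (simp add: pullback_frame_iff pullback_simps)

lemma disc_dil: "dil c (disc (R / norm c)) = disc R"
proof (rule Set.set_eqI)
  fix p show "p \<in> dil c (disc (R / norm c)) \<longleftrightarrow> p \<in> disc R"
    using nz by (cases p) (auto simp: disc_def norm_divide divide_less_cancel)
qed

text \<open>The dilation by \<open>d\<close> lifts the dilation by \<open>c\<close>, because \<open>(d w)\<^sup>n = c w\<^sup>n\<close>.\<close>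

lemma covering_dil: 
  assumes "c = d ^ n" "n > 0"
  shows "covering n -` dil c V = dil d (covering n -` V)"
proof (rule Set.set_eqI)
  interpret D: dilation d using nz assms by unfold_locales auto
  have "(w / d) ^ n = w ^ n / c" for w using assms(1) by (simp add: power_divide)
  then show "p \<in> covering n -` dil c V \<longleftrightarrow> p \<in> dil d (covering n -` V)" for p
    by (cases p) (auto simp: covering_def)
qed

end

lemma openin_disc: "openin CP1 (disc R)"
proof -
  have "disc R = insert None (Some ` (UNIV - cball 0 R))" by (auto simp: disc_def)
  then show ?thesis unfolding CP1_def openin_Alexandroff_compactification
    by (intro disjI2 exI[of _ "cball 0 R"]) auto
qed

lemma cover_pullback_simps:
  "carrier (Sec (cover_pullback E K n U e) W) = ({1..K} \<rightarrow>\<^sub>E mer W)"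
  "\<zero>\<^bsub>Sec (cover_pullback E K n U e) W\<^esub> = (\<lambda>i\<in>{1..K}. \<lambda>w\<in>fin W. 0)"
  "\<sigma> \<oplus>\<^bsub>Sec (cover_pullback E K n U e) W\<^esub> \<tau> = (\<lambda>i\<in>{1..K}. \<lambda>w\<in>fin W. \<sigma> i w + \<tau> i w)"
  "f \<odot>\<^bsub>Sec (cover_pullback E K n U e) W\<^esub> \<sigma> = (\<lambda>i\<in>{1..K}. \<lambda>w\<in>fin W. f w * \<sigma> i w)"
  "Res (cover_pullback E K n U e) W W' \<sigma> = (\<lambda>i\<in>{1..K}. restrict (\<sigma> i) (fin W'))"
  by (simp_all add: cover_pullback_def)

lemma cover_abelian_monoid:
  assumes W: "openin CP1 W" shows "abelian_monoid (Sec (cover_pullback E K n U e) W)"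
proof (rule abelian_monoidI)
  have ext: "undefined = f z" if "f \<in> mer W" "z \<notin> fin W" for f z
    using mer_extensional[OF that(1)] that(2) by (auto simp: extensional_def)
  show "\<zero>\<^bsub>Sec (cover_pullback E K n U e) W\<^esub> \<oplus>\<^bsub>Sec (cover_pullback E K n U e) W\<^esub> \<sigma> = \<sigma>"
    if "\<sigma> \<in> carrier (Sec (cover_pullback E K n U e) W)" for \<sigma>
    using that unfolding cover_pullback_simps by (fastforce simp: fun_eq_iff PiE_iff extensional_def intro: ext)
qed (auto simp: cover_pullback_simps mer_add[OF W] mer_const[OF W] PiE_iff fun_eq_iff add_ac simp del: atLeastAtMost_iff)

text \<open>Sections of the covering bundles are recorded by coordinates in the frames induced by \<open>e\<close>, and the
  isomorphism composes these coordinates with the lifted dilation. For the filtration, a presentation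
  \<open>\<Sum> f\<^sub>j \<psi>\<^sup>*s\<^sub>j\<close> of a section is carried to one with the same \<open>s\<^sub>j\<close>, seen as sections of the other
  bundle, and with \<open>f\<^sub>j\<close> composed with the lift, which has the same pole order.\<close>

lemma cover_iso:
  assumes d: "d \<noteq> 0" "c = d ^ n" "n > 0" and fil: "filtered_bundle UNIV K E" and R: "frame E K (disc R) e"
  shows "bundle_iso d (cover_pullback (pullback ((*) c) E) K n (disc (R / norm c)) e)
     (cover_pullback E K n (disc R) e) (push_coords d K)"
proof -
  interpret D: dilation d using d by unfold_locales
  interpret C: dilation c using d by unfold_locales auto
  let ?E' = "pullback ((*) c) E" and ?R = "R / norm c"
  let ?F' = "cover_pullback ?E' K n (disc ?R) e" and ?F = "cover_pullback E K n (disc R) e"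
  have sh: "module_sheaf UNIV E" using fil by (simp add: filtered_bundle_def)
  have pcPiE: "push_coords d K \<sigma> \<in> {1..K} \<rightarrow>\<^sub>E mer (dil d U) \<longleftrightarrow> \<sigma> \<in> {1..K} \<rightarrow>\<^sub>E mer U" for \<sigma> U
    by (rule D.push_coords_PiE) simp
  have coord: "coord ?E' K V (\<lambda>i. Res ?E' (disc ?R) V (e i)) s i (w ^ n) = 
      coord E K (dil c V) (\<lambda>i. Res E (disc R) (dil c V) (e i)) s i ((d * w) ^ n)"
    if V: "openin CP1 V" "V \<subseteq> disc ?R" and s: "s \<in> Fil E \<beta> (dil c V)" and i: "i \<in> {1..K}" for V s \<beta> i w
  proof -
    have V2: "openin CP1 (dil c V)" "dil c V \<subseteq> disc R"
      using V C.dil_subset[of V "disc ?R"] by (simp_all add: C.disc_dil)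
    have "locally_free_O_submodule UNIV K E (Fil E \<beta>)" using fil by (simp add: filtered_bundle_def)
    then have "s \<in> carrier (Sec E (dil c V))" using O_submoduleD(1)[OF _ V2(1)] s by blast
    moreover have "frame E K (dil c V) (\<lambda>i. Res E (disc R) (dil c V) (e i))"
      using V2 by (intro frame_restrict[OF sh openin_disc _ _ _ R]) auto
    moreover have "(d * w) ^ n = c * w ^ n" by (simp add: d(2) power_mult_distrib)
    ultimately show ?thesis
      using C.pullback_coord[OF sh V(1)] i by (simp add: C.pullback_simps C.disc_dil)
  qed
  have ex_fam: "(\<exists>f. P f) \<longleftrightarrow> (\<exists>f. P (\<lambda>j. push d (f j)))" for P :: "(nat \<Rightarrow> complex \<Rightarrow> complex) \<Rightarrow> bool"
  proof
    assume "\<exists>f. P f"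
    then obtain f where "P f" ..
    then have "P (\<lambda>j. push d (push (inverse d) (f j)))" by simp
    then show "\<exists>f. P (\<lambda>j. push d (f j))" by (rule exI[where P = "\<lambda>f. P (\<lambda>j. push d (f j))"])
  qed auto
  have "push_coords d K \<sigma> \<in> Fil ?F \<alpha> (dil d W) \<longleftrightarrow> push_coords d K \<sigma> \<in> {1..K} \<rightarrow>\<^sub>E mer (dil d W) \<and> 
       (None \<in> dil d W \<longrightarrow>
        (\<exists>W' V (m::nat) \<beta> k f s. openin CP1 (dil d W') \<and> None \<in> dil d W' \<and> dil d W' \<subseteq> dil d W \<and>
           openin CP1 (dil c V) \<and> dil c V \<subseteq> dil c (disc ?R) \<and> dil d W' \<subseteq> covering n -` (dil c V) \<and>
           (\<forall>j<m. s j \<in> Fil E (\<beta> j) (dil c V) \<and> push d (f j) \<in> mer (dil d W') \<and> pole_le (k j) (push d (f j)) \<and>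
              real n * \<beta> j + of_int (k j) \<le> \<alpha>) \<and>
           (\<forall>i\<in>{1..K}. \<forall>w\<in>fin (dil d W').
              push_coords d K \<sigma> i w = (\<Sum>j<m. push d (f j) w * 
                coord E K (dil c V) (\<lambda>i. Res E (disc R) (dil c V) (e i)) (s j) i (w ^ n)))))" for \<sigma> \<alpha> W
    unfolding cover_pullback_def C.disc_dil
    by (simp, subst D.ex_dil, subst C.ex_dil, subst ex_fam, simp)
  also have "\<dots> \<sigma> \<alpha> W \<longleftrightarrow> \<sigma> \<in> {1..K} \<rightarrow>\<^sub>E mer W \<and> 
       (None \<in> W \<longrightarrow>
        (\<exists>W' V (m::nat) \<beta> k f s. openin CP1 W' \<and> None \<in> W' \<and> W' \<subseteq> W \<and>
           openin CP1 V \<and> V \<subseteq> disc ?R \<and> W' \<subseteq> covering n -` V \<and>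
           (\<forall>j<m. s j \<in> Fil ?E' (\<beta> j) V \<and> f j \<in> mer W' \<and> pole_le (k j) (f j) \<and>
              real n * \<beta> j + of_int (k j) \<le> \<alpha>) \<and>
           (\<forall>i\<in>{1..K}. \<forall>w\<in>fin W'.
              \<sigma> i w = (\<Sum>j<m. f j w * coord ?E' K V (\<lambda>i. Res ?E' (disc ?R) V (e i)) (s j) i (w ^ n)))))" for \<sigma> \<alpha> W
    unfolding pcPiE D.openin_dil D.None_dil D.dil_subset C.openin_dil C.dil_subset C.covering_dil[OF d(2,3)] 
      D.mer_push D.pole_le_push D.all_fin_dil C.pullback_simps(6)
  proof (intro conj_cong refl imp_cong ex_cong1 ball_cong)
    fix W' V m \<beta> k f s i w
    assume "openin CP1 V" "V \<subseteq> disc ?R" "i \<in> {1..K}"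
      "\<forall>j<m. s j \<in> Fil E (\<beta> j) (dil c V) \<and> f j \<in> mer W' \<and> pole_le (k j) (f j) \<and> real n * \<beta> j + of_int (k j) \<le> \<alpha>"
    then have "(\<Sum>j<m. push d (f j) (d * w) * 
         coord E K (dil c V) (\<lambda>i. Res E (disc R) (dil c V) (e i)) (s j) i ((d * w) ^ n)) =
       (\<Sum>j<m. f j w * coord ?E' K V (\<lambda>i. Res ?E' (disc ?R) V (e i)) (s j) i (w ^ n))"
      using d(1) by (intro sum.cong refl) (auto simp: coord push_def)
    then show "(push_coords d K \<sigma> i (d * w) = (\<Sum>j<m. push d (f j) (d * w) * 
         coord E K (dil c V) (\<lambda>i. Res E (disc R) (dil c V) (e i)) (s j) i ((d * w) ^ n))) \<longleftrightarrow>
       (\<sigma> i w = (\<Sum>j<m. f j w * coord ?E' K V (\<lambda>i. Res ?E' (disc ?R) V (e i)) (s j) i (w ^ n)))"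
      using \<open>i \<in> {1..K}\<close> d by (simp add: push_coords_def push_def)
  qed
  also have "\<dots> \<sigma> \<alpha> W \<longleftrightarrow> \<sigma> \<in> Fil ?F' \<alpha> W" for \<sigma> \<alpha> W
    unfolding cover_pullback_def by simp
  finally have Fil: "push_coords d K \<sigma> \<in> Fil ?F \<alpha> (dil d W) \<longleftrightarrow> \<sigma> \<in> Fil ?F' \<alpha> W" for \<sigma> \<alpha> W .
  show ?thesis
  proof unfold_locales
    show "bij (push_coords d K)" by (rule D.bij_push_coords)
    show "push_coords d K \<sigma> \<in> Fil ?F \<alpha> (dil d W) \<longleftrightarrow> \<sigma> \<in> Fil ?F' \<alpha> W" for \<sigma> \<alpha> W by (rule Fil)
  qed (use d in \<open>auto simp only: cover_pullback_simps pcPiE; auto simp: push_coords_def push_def fun_eq_iff\<close>)+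
qed

text \<open>Derivatives with respect to \<open>u = 1/w\<close> are taken at the point with coordinate \<open>w\<close>.\<close>

lemma deriv_powi_at_inverse:
  fixes w :: complex
  assumes "w \<noteq> 0" shows "deriv (\<lambda>u. a * u powi m) (1 / w) = a * of_int m * w powi (1 - m)"
proof -
  have "((\<lambda>u. a * u powi m) has_field_derivative a * (of_int m * (1 / w) powi (m - 1))) (at (1 / w))"
    by (rule derivative_eq_intros refl | use assms in simp)+
  then show ?thesis using assms
    by (simp add: DERIV_imp_deriv power_int_divide_distrib power_int_diff)
qed

text \<open>As a function of \<open>w\<close>, the derivative \<open>d\<aa>\<^sub>r/du\<close> is homogeneous of degree \<open>2(N+K) + 1\<close>. Reading it at
  \<open>w/d\<close> gives the factor \<open>d\<^bsup>-2(N+K)-1\<^esup>\<close>, which is \<open>b/d\<close> by the choice of \<open>b\<close>.\<close>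

lemma deriv_polar_push:
  assumes "d \<noteq> 0" "w \<noteq> 0" "b * d ^ (2 * (N + K)) = 1"
  shows "deriv (polar K N r) (1 / (w / d)) = (b / d) * deriv (polar K N r) (1 / w)"
proof -
  have "polar K N r = (\<lambda>u. (of_nat K / of_nat (K + N) * exp (2 * of_real pi * \<i> * of_nat r / of_nat K)) * 
      u powi (- int (2 * (N + K))))"
    by (auto simp: polar_def fun_eq_iff)
  then have D: "deriv (polar K N r) (1 / w) = (of_nat K / of_nat (K + N) * exp (2 * of_real pi * \<i> * of_nat r / of_nat K)) * 
      of_int (- int (2 * (N + K))) * w powi (1 + int (2 * (N + K)))" if "w \<noteq> 0" for w
    by (simp only: deriv_powi_at_inverse[OF that] diff_minus_eq_add)
  have "d powi (1 + int m) * (b / d) = b * d ^ m" for m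
    using assms(1) by (simp add: power_int_add power_int_of_nat)
  then have "d powi (1 + int (2 * (N + K))) * (b / d) = 1" by (simp only: assms(3))
  then have "(w / d) powi (1 + int (2 * (N + K))) = (b / d) * w powi (1 + int (2 * (N + K)))"
    using assms by (simp add: power_int_divide_distrib field_simps)
  moreover have "w / d \<noteq> 0" using assms by simp
  ultimately show ?thesis by (simp only: D[OF assms(2)] D[OF \<open>w / d \<noteq> 0\<close>] mult_ac)
qed

text \<open>The factor \<open>b/d\<close> arises as follows: \<open>\<Phi>\<close> is multiplied by \<open>b c\<close>, and \<open>dz/du = - n w\<^bsup>n+1\<^esup>\<close> read at
  \<open>w/d\<close> contributes \<open>d\<^bsup>-n-1\<^esup> = 1/(c d)\<close>. It agrees with the factor in \<open>deriv_polar_push\<close>, which is why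
  the difference \<open>\<phi>\<^sub>r - d\<aa>\<^sub>r\<close> is preserved up to a constant.\<close>

lemma cover_higgs_push:
  fixes n :: nat
  assumes d: "d \<noteq> 0" "c = d ^ n" "n > 0" and fil: "filtered_bundle UNIV K E" and R: "R > 0" "frame E K (disc R) e"
    and \<Phi>: "higgs_field E \<Phi>" and W: "openin CP1 W" "dil d W \<subseteq> covering n -` disc R"
  shows "push_coords d K (cover_higgs (pullback ((*) c) E) K n (disc (R / norm c)) e 
      (scale_higgs b (pullback ((*) c) E) (pullback_higgs ((*) c) E \<Phi>)) W \<sigma>) = 
    (\<lambda>i\<in>{1..K}. \<lambda>w\<in>fin (dil d W). (b / d) * cover_higgs E K n (disc R) e \<Phi> (dil d W) (push_coords d K \<sigma>) i w)"
proof -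
  interpret D: dilation d using d by unfold_locales
  interpret C: dilation c using d by unfold_locales auto
  let ?E' = "pullback ((*) c) E" and ?U = "disc (R / norm c)"
  let ?\<Phi>' = "scale_higgs b ?E' (pullback_higgs ((*) c) E \<Phi>)"
  have sh: "module_sheaf UNIV E" using fil by (simp add: filtered_bundle_def)
  have U: "openin CP1 ?U" "dil c ?U = disc R" by (simp_all add: openin_disc C.disc_dil)
  have coord: "coord ?E' K ?U e (?\<Phi>' ?U (e j)) i z = b * c * coord E K (disc R) e (\<Phi> (disc R) (e j)) i (c * z)"
    if ij: "i \<in> {1..K}" "j \<in> {1..K}" and z: "c * z \<in> fin (disc R)" for i j z
  proof -
    let ?k = "\<lambda>z\<in>fin (disc R). b * c"
    interpret M: module "Omer (disc R)" "Sec E (disc R)" by (rule sheaf_module[OF sh openin_disc]) simp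
    have ej: "e j \<in> carrier (Sec E (disc R))" using frame_sections[OF R(2) ij(2)] .
    have \<Phi>e: "\<Phi> (disc R) (e j) \<in> carrier (Sec E (disc R))" by (rule higgs_closed[OF \<Phi> openin_disc ej])
    have "?\<Phi>' ?U (e j) = ?k \<odot>\<^bsub>Sec E (disc R)\<^esub> \<Phi> (disc R) (e j)"
      using C.pullback_higgs_corr[OF sh \<Phi>, of b, unfolded bundle_iso.higgs_corr_def[OF C.pullback_iso], 
        rule_format, OF U(1), of "e j"] ej by (simp add: C.pullback_simps U(2))
    moreover have "?k \<odot>\<^bsub>Sec E (disc R)\<^esub> \<Phi> (disc R) (e j) \<in> carrier (Sec E (disc R))"
      using \<Phi>e mer_const[OF openin_disc] by (intro M.smult_closed) simp_all
    ultimately have "coord ?E' K ?U e (?\<Phi>' ?U (e j)) i z = 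
        coord E K (disc R) e (?k \<odot>\<^bsub>Sec E (disc R)\<^esub> \<Phi> (disc R) (e j)) i (c * z)"
      using C.pullback_coord[OF sh U(1), unfolded U(2), OF R(2) _ ij(1)] by simp
    also have "\<dots> = ?k (c * z) * coord E K (disc R) e (\<Phi> (disc R) (e j)) i (c * z)"
      by (rule coord_smult[OF sh openin_disc _ R(2) \<Phi>e mer_const[OF openin_disc] ij(1) z]) simp
    finally show ?thesis using z by simp
  qed
  have deriv: "deriv (\<lambda>u. 1 / u ^ n) (1 / w) = - (of_nat n * w ^ Suc n)" if "w \<noteq> 0" for w :: complex
  proof -
    have "(\<lambda>u. 1 / u ^ n) = (\<lambda>u::complex. 1 * u powi (- int n))"
      by (simp add: power_int_minus power_int_of_nat field_simps)
    then show ?thesis using deriv_powi_at_inverse[OF that, of 1 "- int n"]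
      by (simp only:) (simp add: power_int_add that power_int_of_nat)
  qed
  show ?thesis
  proof (intro ext)
    fix i w
    show "push_coords d K (cover_higgs ?E' K n ?U e ?\<Phi>' W \<sigma>) i w = 
      (\<lambda>i\<in>{1..K}. \<lambda>w\<in>fin (dil d W). (b / d) * cover_higgs E K n (disc R) e \<Phi> (dil d W) (push_coords d K \<sigma>) i w) i w"
    proof (cases "i \<in> {1..K} \<and> w \<in> fin (dil d W)")
      case True
      then have i: "i \<in> {1..K}" and w: "w \<in> fin (dil d W)" by auto
      have wn: "c * (w / d) ^ n = w ^ n" using d by (simp add: power_divide)
      \<comment> \<open>Over the disc \<open>w\<close> does not vanish, so the formulas for derivatives in \<open>u = 1/w\<close> apply.\<close>
      have "Some w \<in> covering n -` disc R" using W(2) w unfolding fin_def by blast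
      then have "w ^ n \<in> fin (disc R)" by (simp add: covering_def fin_def)
      moreover from this have "w \<noteq> 0" using R(1) d(3) by (auto simp: fin_def disc_def zero_power)
      ultimately have *: "c * (w / d) ^ n \<in> fin (disc R)" "w \<noteq> 0" by (simp_all only: wn not_False_eq_True)
      have "(\<Sum>j\<in>{1..K}. coord ?E' K ?U e (?\<Phi>' ?U (e j)) i ((w / d) ^ n) * \<sigma> j (w / d)) = 
          (\<Sum>j\<in>{1..K}. b * c * coord E K (disc R) e (\<Phi> (disc R) (e j)) i (w ^ n) * \<sigma> j (w / d))"
        using coord[OF i _ *(1)] by (intro sum.cong refl) (simp only: wn)
      then have "push_coords d K (cover_higgs ?E' K n ?U e ?\<Phi>' W \<sigma>) i w = 
          - (of_nat n * (w / d) ^ Suc n) * 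
          (\<Sum>j\<in>{1..K}. b * c * coord E K (disc R) e (\<Phi> (disc R) (e j)) i (w ^ n) * \<sigma> j (w / d))"
        using i w *(2) d(1) deriv[of "w / d"]
        by (simp add: push_coords_def push_def cover_higgs_def)
      also have "\<dots> = (- (of_nat n * (w / d) ^ Suc n) * (b * c)) *
          (\<Sum>j\<in>{1..K}. coord E K (disc R) e (\<Phi> (disc R) (e j)) i (w ^ n) * push_coords d K \<sigma> j w)"
        by (simp add: sum_distrib_left push_coords_def push_def mult_ac)
      also have "- (of_nat n * (w / d) ^ Suc n) * (b * c) = (b / d) * deriv (\<lambda>u. 1 / u ^ n) (1 / w)"
        using d *(2) by (simp add: deriv power_divide)
      also have "(b / d) * deriv (\<lambda>u. 1 / u ^ n) (1 / w) *
          (\<Sum>j\<in>{1..K}. coord E K (disc R) e (\<Phi> (disc R) (e j)) i (w ^ n) * push_coords d K \<sigma> j w) =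
        (\<lambda>i\<in>{1..K}. \<lambda>w\<in>fin (dil d W). (b / d) * cover_higgs E K n (disc R) e \<Phi> (dil d W) (push_coords d K \<sigma>) i w) i w"
        using i w by (simp add: cover_higgs_def)
      finally show ?thesis .
    next
      case False
      then show ?thesis by (auto simp: push_coords_def push_def cover_higgs_def)
    qed
  qed
qed


text \<open>The decomposition consists of the preimages \<open>A'\<close>, \<open>B'\<close> of the given line bundles under the
  isomorphism of \<open>cover_iso\<close>. The Higgs field and its difference from \<open>d\<aa>\<^sub>r\<close> correspond up to the
  constant \<open>b/d\<close>, and multiplication by a constant preserves line subbundles and their filtrations.\<close>

lemma irregular_type_pullback:
  assumes d: "d \<noteq> 0" "c = d ^ (2 * K)" "b * d ^ (2 * (N + K)) = 1" and K: "K > 0"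
    and fil: "filtered_bundle UNIV K E" and \<Phi>: "higgs_field E \<Phi>" and irr: "irregular_type K N E \<Phi>"
  shows "irregular_type K N (pullback ((*) c) E) (scale_higgs b (pullback ((*) c) E) (pullback_higgs ((*) c) E \<Phi>))"
proof -
  interpret D: dilation d using d by unfold_locales
  interpret C: dilation c using d by unfold_locales auto
  have sh: "module_sheaf UNIV E" using fil by (simp add: filtered_bundle_def)
  from irr obtain R e A B where R: "R > 0" "frame E K (disc R) e" 
    and dec: "filtered_decomposition (covering (2 * K) -` disc R) (cover_pullback E K (2 * K) (disc R) e) K A B"
    and lines: "\<forall>r\<in>{1..K}.
            filtered_bundle (covering (2 * K) -` disc R) 1 (subbundle (cover_pullback E K (2 * K) (disc R) e) (A r) (B r)) \<and>
            standard_line_filtration (covering (2 * K) -` disc R) (subbundle (cover_pullback E K (2 * K) (disc R) e) (A r) (B r)) \<and>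
            (\<forall>W. openin CP1 W \<and> W \<subseteq> covering (2 * K) -` disc R \<longrightarrow>
               (\<forall>\<sigma>\<in>A r W. cover_higgs E K (2 * K) (disc R) e \<Phi> W \<sigma> \<in> A r W) \<and>
               (\<forall>\<alpha>. \<forall>\<sigma>\<in>B r \<alpha> W.
                  (\<lambda>i\<in>{1..K}. \<lambda>w\<in>fin W. cover_higgs E K (2 * K) (disc R) e \<Phi> W \<sigma> i w - deriv (polar K N r) (1 / w) * \<sigma> i w)
                    \<in> B r (\<alpha> + 1) W))"
    unfolding irregular_type_def Let_def by - (elim exE conjE, rule that, assumption+)
  let ?n = "2 * K" and ?R = "R / norm c" and ?E' = "pullback ((*) c) E"
  let ?\<Phi>' = "scale_higgs b ?E' (pullback_higgs ((*) c) E \<Phi>)"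
  let ?T = "push_coords d K"
  define X where "X = covering ?n -` disc R"
  define X' where "X' = covering ?n -` disc ?R"
  define F where "F = cover_pullback E K ?n (disc R) e"
  define F' where "F' = cover_pullback ?E' K ?n (disc ?R) e"
  define \<Psi> where "\<Psi> = cover_higgs E K ?n (disc R) e \<Phi>"
  define \<Psi>' where "\<Psi>' = cover_higgs ?E' K ?n (disc ?R) e ?\<Phi>'"
  have n: "?n > 0" using K by simp
  have X: "dil d X' = X"
    unfolding X_def X'_def C.covering_dil[OF d(2) n, symmetric] C.disc_dil ..
  interpret I: bundle_iso d F' F ?T
    unfolding F_def F'_def by (rule cover_iso[OF d(1,2) n fil R(2)])
  note dec = dec[folded X_def F_def] and lines = lines[folded X_def F_def \<Psi>_def, THEN bspec]
  note line_fil = lines[THEN conjunct1] and line_std = lines[THEN conjunct2, THEN conjunct1]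
  note line_higgs = lines[THEN conjunct2, THEN conjunct2, THEN spec, THEN mp, OF _ conjI]
  have AB_smult: 
    "\<sigma> \<in> A r W \<Longrightarrow> (\<lambda>i\<in>{1..K}. \<lambda>w\<in>fin W. a * \<sigma> i w) \<in> A r W" 
    "\<sigma> \<in> B r \<alpha> W \<Longrightarrow> (\<lambda>i\<in>{1..K}. \<lambda>w\<in>fin W. a * \<sigma> i w) \<in> B r \<alpha> W" 
    "B r \<alpha> W \<subseteq> A r W"
    if r: "r \<in> {1..K}" and W: "openin CP1 W" "W \<subseteq> X" for r W \<sigma> a \<alpha>
  proof -
    let ?L = "subbundle F (A r) (B r)" and ?a = "\<lambda>w\<in>fin W. a"
    have L: "module_sheaf X ?L" "locally_free_O_submodule X 1 ?L (Fil ?L \<alpha>)"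
      using line_fil[OF r] by (simp_all add: filtered_bundle_def)
    interpret M: module "Omer W" "Sec ?L W" by (rule sheaf_module[OF L(1) W])
    have smult: "?a \<odot>\<^bsub>Sec ?L W\<^esub> \<sigma> = (\<lambda>i\<in>{1..K}. \<lambda>w\<in>fin W. a * \<sigma> i w)" for \<sigma>
      by (auto simp: subbundle_def F_def cover_pullback_def fun_eq_iff)
    have L_simps: "carrier (Sec ?L W) = A r W" "Fil ?L \<alpha> W = B r \<alpha> W"
      by (simp_all add: subbundle_def)
    show "(\<lambda>i\<in>{1..K}. \<lambda>w\<in>fin W. a * \<sigma> i w) \<in> A r W" if "\<sigma> \<in> A r W"
      using M.smult_closed[of ?a \<sigma>] that mer_const[OF W(1)] by (simp add: smult L_simps)
    show "(\<lambda>i\<in>{1..K}. \<lambda>w\<in>fin W. a * \<sigma> i w) \<in> B r \<alpha> W" if "\<sigma> \<in> B r \<alpha> W"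
      using O_submoduleD(4)[OF L(2) W hol_const[OF W(1), of a]] that by (simp add: smult L_simps)
    show "B r \<alpha> W \<subseteq> A r W" using O_submoduleD(1)[OF L(2) W] by (simp add: L_simps)
  qed
  define A' where "A' r W = {\<sigma>. ?T \<sigma> \<in> A r (dil d W)}" for r W
  define B' where "B' r \<alpha> W = {\<sigma>. ?T \<sigma> \<in> B r \<alpha> (dil d W)}" for r \<alpha> W
  have dec': "filtered_decomposition X' F' K A' B'"
    unfolding A'_def B'_def
    by (rule I.decomposition_transport)
      (use cover_abelian_monoid dec AB_smult(3) in \<open>simp_all add: F_def F'_def X\<close>)
  have sub: "bundle_iso d (subbundle F' (A' r) (B' r)) (subbundle F (A r) (B r)) ?T" for r
    unfolding A'_def B'_def by (rule I.subbundle_iso)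
  have fil': "filtered_bundle X' 1 (subbundle F' (A' r) (B' r))" if "r \<in> {1..K}" for r
    by (rule bundle_iso.filtered_bundle_transport[OF sub]) (simp only: X line_fil[OF that])
  have std': "standard_line_filtration X' (subbundle F' (A' r) (B' r))" if "r \<in> {1..K}" for r
    by (rule bundle_iso.standard_line_filtration_transport[OF sub])
      (use line_fil[OF that] line_std[OF that] in \<open>simp_all only: X filtered_bundle_def\<close>)
  have T\<Psi>: "?T (\<Psi>' W \<sigma>) = (\<lambda>i\<in>{1..K}. \<lambda>w\<in>fin (dil d W). (b / d) * \<Psi> (dil d W) (?T \<sigma>) i w)"
    if "openin CP1 W" "dil d W \<subseteq> X" for W \<sigma>
    using cover_higgs_push[OF d(1,2) n fil R \<Phi> that(1), of b \<sigma>] that(2) unfolding X_def \<Psi>_def \<Psi>'_def .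
  have \<Psi>A: "\<Psi>' W \<sigma> \<in> A' r W" if "r \<in> {1..K}" "openin CP1 W" "W \<subseteq> X'" "\<sigma> \<in> A' r W" for r W \<sigma>
  proof -
    have W: "openin CP1 (dil d W)" "dil d W \<subseteq> X" 
      using that D.dil_subset[of W X'] by (simp_all add: X)
    have "\<Psi> (dil d W) (?T \<sigma>) \<in> A r (dil d W)"
      using line_higgs[THEN conjunct1, THEN bspec, OF that(1) W] that(4) by (simp add: A'_def)
    then show ?thesis 
      unfolding A'_def mem_Collect_eq T\<Psi>[OF that(2) W(2)] by (rule AB_smult(1)[OF that(1) W])
  qed
  have \<Psi>B: "(\<lambda>i\<in>{1..K}. \<lambda>w\<in>fin W. \<Psi>' W \<sigma> i w - deriv (polar K N r) (1 / w) * \<sigma> i w) \<in> B' r (\<alpha> + 1) W"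
    if "r \<in> {1..K}" "openin CP1 W" "W \<subseteq> X'" "\<sigma> \<in> B' r \<alpha> W" for r W \<alpha> \<sigma>
  proof -
    have W: "openin CP1 (dil d W)" "dil d W \<subseteq> X" 
      using that D.dil_subset[of W X'] by (simp_all add: X)
    have "?T (\<lambda>i\<in>{1..K}. \<lambda>w\<in>fin W. \<Psi>' W \<sigma> i w - deriv (polar K N r) (1 / w) * \<sigma> i w) =
       (\<lambda>i\<in>{1..K}. \<lambda>w\<in>fin (dil d W). (b / d) * 
         (\<lambda>i\<in>{1..K}. \<lambda>w\<in>fin (dil d W). \<Psi> (dil d W) (?T \<sigma>) i w - deriv (polar K N r) (1 / w) * ?T \<sigma> i w) i w)"
    proof (intro ext)
      fix i w
      show "?T (\<lambda>i\<in>{1..K}. \<lambda>w\<in>fin W. \<Psi>' W \<sigma> i w - deriv (polar K N r) (1 / w) * \<sigma> i w) i w =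
         (\<lambda>i\<in>{1..K}. \<lambda>w\<in>fin (dil d W). (b / d) * 
         (\<lambda>i\<in>{1..K}. \<lambda>w\<in>fin (dil d W). \<Psi> (dil d W) (?T \<sigma>) i w - deriv (polar K N r) (1 / w) * ?T \<sigma> i w) i w) i w"
      proof (cases "i \<in> {1..K} \<and> w \<in> fin (dil d W)")
        case True
        then have i: "i \<in> {1..K}" and w: "w \<in> fin (dil d W)" by auto
        have "Some w \<in> X" using W(2) w unfolding fin_def by blast
        then have "w ^ ?n \<in> fin (disc R)" by (simp add: X_def covering_def fin_def)
        then have "w \<noteq> 0" using R(1) n by (auto simp: fin_def disc_def zero_power)
        note pol = deriv_polar_push[OF d(1) this d(3), of r]
        have "\<Psi>' W \<sigma> i (w / d) = (b / d) * \<Psi> (dil d W) (?T \<sigma>) i w"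
          using fun_cong[OF fun_cong[OF T\<Psi>[OF that(2) W(2), of \<sigma>], of i], of w] i w
          by (simp add: push_coords_def push_def)
        then have "\<Psi>' W \<sigma> i (w / d) - deriv (polar K N r) (1 / (w / d)) * \<sigma> i (w / d) = 
            (b / d) * (\<Psi> (dil d W) (?T \<sigma>) i w - deriv (polar K N r) (1 / w) * ?T \<sigma> i w)"
          unfolding pol using i by (simp add: push_coords_def push_def algebra_simps)
        then show ?thesis using i w by (simp add: push_coords_def push_def)
      next
        case False
        then show ?thesis by (auto simp: push_coords_def push_def)
      qed
    qed
    then show ?thesis using AB_smult(2)[OF that(1) W line_higgs[THEN conjunct2, THEN spec, THEN bspec, OF that(1) W], of "?T \<sigma>" \<alpha> "b / d"] that(4)
      by (simp only: B'_def mem_Collect_eq)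
  qed
  show ?thesis
    unfolding irregular_type_def Let_def
  proof (intro exI conjI)
    show "?R > 0" using R(1) C.nz by simp
    show "frame ?E' K (disc ?R) e"
      using C.pullback_frame_iff[OF sh openin_disc] R(2) by (simp add: C.disc_dil)
    show "filtered_decomposition (covering ?n -` disc ?R) (cover_pullback ?E' K ?n (disc ?R) e) K A' B'"
      using dec' by (simp only: X'_def F'_def)
    show "\<forall>r\<in>{1..K}.
            filtered_bundle (covering ?n -` disc ?R) 1 (subbundle (cover_pullback ?E' K ?n (disc ?R) e) (A' r) (B' r)) \<and>
            standard_line_filtration (covering ?n -` disc ?R) (subbundle (cover_pullback ?E' K ?n (disc ?R) e) (A' r) (B' r)) \<and>
            (\<forall>W. openin CP1 W \<and> W \<subseteq> covering ?n -` disc ?R \<longrightarrow>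
               (\<forall>\<sigma>\<in>A' r W. cover_higgs ?E' K ?n (disc ?R) e ?\<Phi>' W \<sigma> \<in> A' r W) \<and>
               (\<forall>\<alpha>. \<forall>\<sigma>\<in>B' r \<alpha> W.
                  (\<lambda>i\<in>{1..K}. \<lambda>w\<in>fin W. cover_higgs ?E' K ?n (disc ?R) e ?\<Phi>' W \<sigma> i w - deriv (polar K N r) (1 / w) * \<sigma> i w)
                    \<in> B' r (\<alpha> + 1) W))"
      unfolding X'_def[symmetric] F'_def[symmetric] \<Psi>'_def[symmetric]
      by (intro ballI conjI allI impI fil' std' \<Psi>A \<Psi>B; (elim conjE)?; assumption)
  qed
qed

section \<open>The action\<close>

theorem proposition3p1:
  fixes K N :: nat and \<E> :: "'s fbundle \<times> 's tensor \<times> 's higgs"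
  assumes "K \<ge> 2" and "N \<ge> 1" and "coprime K N"
  shows "(\<forall>(t::complex) (m::int).
            act K N (t + 2 * of_real pi * \<i> * of_nat (K + N) * of_int m) \<E> = act K N t \<E>) \<and>
         (\<E> \<in> C_KN K N \<longrightarrow> (\<forall>t::complex. act K N t \<E> \<in> C_KN K N))"
proof (intro conjI allI impI)
  have KN: "of_nat (K + N) \<noteq> (0::complex)" using assms(1) by (simp del: of_nat_add)
  fix t :: complex and m :: int
  let ?p = "2 * of_real pi * \<i> * of_nat (K + N) * of_int m :: complex"
  have "exp (t + ?p) = exp t * exp (2 * of_real pi * \<i> * of_int (int (K + N) * m))"
    by (simp add: exp_add mult_ac)
  also have "exp (2 * of_real pi * \<i> * of_int (int (K + N) * m)) = (1::complex)"
    using exp_integer_2pi[of "of_int (int (K + N) * m)"] by (simp add: mult_ac)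
  finally have e: "exp (t + ?p) = exp t" by simp
  have "- (of_nat K * (t + ?p) / of_nat (K + N)) = 
      - (of_nat K * t / of_nat (K + N)) + 2 * of_real pi * \<i> * of_int (- (int K * m))"
    using KN by (simp add: field_simps)
  then have "exp (- (of_nat K * (t + ?p) / of_nat (K + N))) = 
      exp (- (of_nat K * t / of_nat (K + N))) * exp (2 * of_real pi * \<i> * of_int (- (int K * m)))"
    by (simp only: exp_add)
  also have "exp (2 * of_real pi * \<i> * of_int (- (int K * m))) = (1::complex)"
    using exp_integer_2pi[of "of_int (- (int K * m))"] by (simp add: mult_ac)
  finally have rho: "rho K N (t + ?p) = rho K N t" by (simp add: rho_def fun_eq_iff)
  then show "act K N (t + ?p) \<E> = act K N t \<E>"
    by (simp only: act_def e rho)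
next
  have KN: "of_nat (K + N) \<noteq> (0::complex)" using assms(1) by (simp del: of_nat_add)
  fix t :: complex
  assume "\<E> \<in> C_KN K N"
  obtain E \<omega> \<Phi> where \<E>: "\<E> = (E, \<omega>, \<Phi>)" by (cases \<E>)
  with \<open>\<E> \<in> C_KN K N\<close> have SL: "filtered_SL_Higgs_bundle K (E, \<omega>, \<Phi>)" and irr: "irregular_type K N E \<Phi>"
    by (auto simp: C_KN_def)
  \<comment> \<open>Among the roots of \<open>d\<^bsup>2K\<^esup> = c\<close> this one also satisfies \<open>e\<^sup>t d\<^bsup>2(N+K)\<^esup> = 1\<close>; another root could
    permute the \<open>\<aa>\<^sub>r\<close>.\<close>
  define d where "d = exp (- (t / (2 * of_nat (K + N))))"
  define c where "c = exp (- (of_nat K * t / of_nat (K + N)))"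
  have c: "c = d ^ (2 * K)"
  proof -
    have "- (k * t / M) = 2 * k * - (t / (2 * M))" for k M :: complex by simp
    then show ?thesis unfolding c_def d_def exp_of_nat_mult[symmetric] by (simp only: of_nat_mult of_nat_numeral)
  qed
  have b: "exp t * d ^ (2 * (N + K)) = 1"
  proof -
    have M: "of_nat (2 * (N + K)) = (2 * of_nat (K + N) :: complex)" by simp
    have "t + 2 * of_nat (K + N) * - (t / (2 * of_nat (K + N))) = 0" using KN by (simp del: of_nat_add)
    then show ?thesis unfolding d_def exp_of_nat_mult[symmetric] exp_add[symmetric] M by simp
  qed
  have rho: "rho K N t = (*) c" by (simp add: rho_def c_def fun_eq_iff)
  interpret dilation c by unfold_locales (simp add: c_def)
  have "filtered_bundle UNIV K E" "higgs_field E \<Phi>"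
    using SL by (auto simp: filtered_SL_Higgs_bundle_def filtered_SL_bundle_def)
  then have "irregular_type K N (pullback ((*) c) E) (scale_higgs (exp t) (pullback ((*) c) E) (pullback_higgs ((*) c) E \<Phi>))"
    using assms(1) by (intro irregular_type_pullback[OF _ c b _ _ _ irr]) (auto simp: d_def)
  then show "act K N t \<E> \<in> C_KN K N"
    using filtered_SL_Higgs_bundle_pullback[OF SL, of "exp t"] by (simp add: \<E> act_def rho C_KN_def)
qed

end
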